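(* Let $T$ be an invertible measure preserving transformation of a Lebesgue probability space $(X,\mu)$. Given two measurable partitions $\xi$ and $\eta$ of $X$, $$h(\xi\vee\eta,T)\le h(\eta,T)+h(\xi\vee\eta_T,T).$$
   Context: For measurable partitions $\alpha,\beta$ of $(X,\mu)$ the conditional entropy is $H(\alpha|\beta)=-\int\log\mu_x^{\beta}(\alpha(x))\,d\mu(x)$, where $\mu^\beta_x$ is the conditional measure of $\mu$ on the element $\beta(x)$ of $\beta$ containing $x$. For a measurable partition $\eta$ put $\eta^+=\bigvee_{n\ge0}T^n\eta$ and $\eta_T=\bigvee_{n\in\mathbb{Z}}T^n\eta$. The entropy of $T$ with respect to a measurable partition $\eta$ is $h(\eta,T)=H(T^{-1}\eta\,|\,\eta^+)$. *)

theory Defs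
  imports "HOL-Probability.Probability" "HOL-Library.Disjoint_Sets"
begin

section \<open>Lebesgue spaces and their automorphisms\<close>

definition isomorphic_mod0 :: "'a measure \<Rightarrow> 'b measure \<Rightarrow> bool" where
  "isomorphic_mod0 M N \<longleftrightarrow>
     (\<exists>X Y f. X \<in> sets M \<and> space M - X \<in> null_sets M \<and>
        Y \<in> sets N \<and> space N - Y \<in> null_sets N \<and>
        bij_betw f X Y \<and>
        f \<in> measurable (restrict_space M X) (restrict_space N Y) \<and>
        the_inv_into X f \<in> measurable (restrict_space N Y) (restrict_space M X) \<and>
        (\<forall>A\<in>sets N. A \<subseteq> Y \<longrightarrow> emeasure M (f -` A \<inter> X) = emeasure N A))"

text \<open>A complete probability space which, once its (at most countably many) atoms are removed, is
  isomorphic mod 0 to an interval with Lebesgue measure. The interval may be degenerate.\<close>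

definition lebesgue_prob_space :: "'a measure \<Rightarrow> bool" where
  "lebesgue_prob_space M \<longleftrightarrow>
     prob_space M \<and> complete_measure M \<and>
     (\<exists>D. countable D \<and> D \<subseteq> space M \<and>
        (\<forall>x\<in>D. {x} \<in> sets M \<and> 0 < emeasure M {x}) \<and>
        isomorphic_mod0 (restrict_space M (space M - D))
          (lebesgue_on {0..measure M (space M - D)}))"

definition invertible_measure_preserving :: "'a measure \<Rightarrow> ('a \<Rightarrow> 'a) \<Rightarrow> bool" where
  "invertible_measure_preserving M T \<longleftrightarrow>
     bij_betw T (space M) (space M) \<and>
     T \<in> measurable M M \<and>
     the_inv_into (space M) T \<in> measurable M M \<and>
     (\<forall>A\<in>sets M. emeasure M (T -` A \<inter> space M) = emeasure M A)"

definition int_iterate :: "'a measure \<Rightarrow> ('a \<Rightarrow> 'a) \<Rightarrow> int \<Rightarrow> 'a \<Rightarrow> 'a" where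
  "int_iterate M T n =
     (if 0 \<le> n then T ^^ nat n else the_inv_into (space M) T ^^ nat (- n))"


section \<open>Measurable partitions\<close>

text \<open>Rokhlin's definition mod 0: away from a null set \<open>N\<close>, the elements of the partition are
  separated by countably many measurable sets, each of which is a union of elements. With
  \<open>N = {}\<close> this is the strict form of the definition.\<close>

definition measurable_partition :: "'a measure \<Rightarrow> 'a set set \<Rightarrow> bool" where
  "measurable_partition M \<eta> \<longleftrightarrow>
     partition_on (space M) \<eta> \<and>
     (\<exists>N\<in>null_sets M. \<exists>B :: nat \<Rightarrow> 'a set.
        (\<forall>n. B n \<in> sets M) \<and>
        (\<forall>n. \<forall>C\<in>\<eta>. C - N \<subseteq> B n \<or> B n \<inter> C \<subseteq> N) \<and>
        (\<forall>C\<in>\<eta>. \<forall>D\<in>\<eta>. C \<noteq> D \<longrightarrow>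
           (\<exists>n. (C - N \<subseteq> B n \<and> B n \<inter> D \<subseteq> N) \<or> (D - N \<subseteq> B n \<and> B n \<inter> C \<subseteq> N))))"

definition part_of :: "'a set set \<Rightarrow> 'a \<Rightarrow> 'a set" where
  "part_of \<eta> x = (THE C. C \<in> \<eta> \<and> x \<in> C)"

definition partition_join :: "'a set set \<Rightarrow> 'a set set \<Rightarrow> 'a set set" where
  "partition_join \<xi> \<eta> = common_refinement {\<xi>, \<eta>}"

definition shift_partition :: "'a measure \<Rightarrow> ('a \<Rightarrow> 'a) \<Rightarrow> int \<Rightarrow> 'a set set \<Rightarrow> 'a set set" where
  "shift_partition M T n \<eta> = (\<lambda>C. int_iterate M T n ` C) ` \<eta>"

definition past_partition :: "'a measure \<Rightarrow> ('a \<Rightarrow> 'a) \<Rightarrow> 'a set set \<Rightarrow> 'a set set" where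
  "past_partition M T \<eta> = common_refinement ((\<lambda>n. shift_partition M T n \<eta>) ` {0..})"

definition full_partition :: "'a measure \<Rightarrow> ('a \<Rightarrow> 'a) \<Rightarrow> 'a set set \<Rightarrow> 'a set set" where
  "full_partition M T \<eta> = common_refinement (range (\<lambda>n. shift_partition M T n \<eta>))"


section \<open>Conditional measures and entropy\<close>

text \<open>\<open>\<kappa> C\<close> is the conditional measure on the element \<open>C\<close>; it is a measure on \<open>C\<close> itself, so the
  measure of a set \<open>A\<close> is that of \<open>A \<inter> C\<close>. A canonical system of conditional measures exists for
  every measurable partition of a Lebesgue space, and is unique mod 0 (Rokhlin).\<close>

definition conditional_measures :: "'a measure \<Rightarrow> 'a set set \<Rightarrow> ('a set \<Rightarrow> 'a measure) \<Rightarrow> bool" where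
  "conditional_measures M \<beta> \<kappa> \<longleftrightarrow>
     (AE x in M. prob_space (\<kappa> (part_of \<beta> x)) \<and> complete_measure (\<kappa> (part_of \<beta> x)) \<and>
        space (\<kappa> (part_of \<beta> x)) = part_of \<beta> x) \<and>
     (\<forall>A\<in>sets M.
        (AE x in M. A \<inter> part_of \<beta> x \<in> sets (\<kappa> (part_of \<beta> x))) \<and>
        (\<lambda>x. emeasure (\<kappa> (part_of \<beta> x)) (A \<inter> part_of \<beta> x)) \<in> borel_measurable M \<and>
        emeasure M A = (\<integral>\<^sup>+x. emeasure (\<kappa> (part_of \<beta> x)) (A \<inter> part_of \<beta> x) \<partial>M))"

definition cond_measure :: "'a measure \<Rightarrow> 'a set set \<Rightarrow> 'a \<Rightarrow> 'a measure" where
  "cond_measure M \<beta> x = (SOME \<kappa>. conditional_measures M \<beta> \<kappa>) (part_of \<beta> x)"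

text \<open>The library has \<open>ln 0 = 0\<close>, whereas here \<open>- log 0 = \<infinity>\<close>.\<close>

definition neg_log :: "real \<Rightarrow> ennreal" where
  "neg_log p = (if p = 0 then \<infinity> else ennreal (- ln p))"

definition cond_entropy :: "'a measure \<Rightarrow> 'a set set \<Rightarrow> 'a set set \<Rightarrow> ennreal" where
  "cond_entropy M \<alpha> \<beta> =
     (\<integral>\<^sup>+x. neg_log (measure (cond_measure M \<beta> x) (part_of \<alpha> x \<inter> part_of \<beta> x)) \<partial>M)"

definition partition_entropy :: "'a measure \<Rightarrow> 'a set set \<Rightarrow> ('a \<Rightarrow> 'a) \<Rightarrow> ennreal" where
  "partition_entropy M \<eta> T =
     cond_entropy M (shift_partition M T (- 1) \<eta>) (past_partition M T \<eta>)"

end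

theory Submission
  imports Defs
begin

text \<open>
  Everything is reduced to finite families of events. For a finite family \<open>P\<close> let \<open>h P\<close> be the
  Shannon entropy of the finite partition that \<open>P\<close> generates. For arbitrary families \<open>F\<close> and \<open>G\<close> put
  \<open>H(P | F) = inf (h (P \<union> Q) - h Q)\<close> over the finite \<open>Q \<subseteq> F\<close>, and \<open>H(G | F) = sup H(P | F)\<close> over the
  finite \<open>P \<subseteq> G\<close>. As \<open>h\<close> is monotone and submodular (\<open>fentropy_mono\<close>, \<open>fentropy_submodular\<close>), it
  follows by pure combinatorics that \<open>H(G \<union> G' | F) = H(G | F) + H(G' | F \<union> G)\<close>
  (\<open>family_entropy_chain\<close>) and that, for a finite \<open>P\<close>, \<open>H(P | F)\<close> is continuous along increasing
  unions of \<open>F\<close> (\<open>cond_fentropy_Union_incseq\<close>): a finite subfamily of the union lies in one member.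

  The bridge to partitions is \<open>cond_entropy_eq_family_entropy\<close>: the conditional entropy of \<open>\<alpha>\<close>
  given \<open>\<beta>\<close> is \<open>H(G | F)\<close> as soon as \<open>G\<close> and \<open>F\<close> consist of measurable unions of elements of \<open>\<alpha>\<close>
  and \<open>\<beta>\<close> and countably many members separate the elements mod 0 (\<open>generates\<close>). It rests on
  Rokhlin's theorem, proved here as \<open>conditional_measures_exist\<close>: canonical systems of conditional
  measures exist, and they depend measurably on a separating family \<open>F\<close> alone. The second part shows
  that \<open>F\<close> generates all measurable unions of elements mod 0, so that \<open>H(P | F)\<close> sees all of them
  (\<open>saturated_subset_entropy_closure\<close>). Joins, translates and infinite joins of partitions are
  generated by unions, translates and infinite unions of families.

  The inequality itself is \<open>family_entropy_filtration_le\<close>. Let \<open>A k\<close> and \<open>B k\<close> generate the partitions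
  \<open>\<eta>\<close> and \<open>\<xi>\<close> translated by the \<open>k\<close>-th power of the inverse of \<open>T\<close>, let \<open>P\<close> be the common past (all
  \<open>A k\<close>, \<open>B k\<close> with \<open>k \<le> 0\<close>), and let \<open>h\<close> be the entropy of \<open>\<eta>\<close>, which may be assumed finite. Write
  \<open>D n = H(A 1, ..., A n | P)\<close>. Then \<open>D (n + 1) \<le> D n + h\<close>, so all \<open>D n\<close> are finite. For a finite
  \<open>v \<subseteq> B 1\<close> the chain rule, applied in two ways, gives
  \<open>D (n + 1) + H(v | P, A 1, ..., A (n + 1)) = H(v, A 1 | P) + H(A 2, ..., A (n + 1) | P, v, A 1)\<close>.
  The last term is at least \<open>D n\<close>, because \<open>P, v, A 1\<close> belong to the past of one step later.
  Cancelling \<open>D n\<close> leaves \<open>H(v, A 1 | P) \<le> h + H(v | P, A 1, ..., A (n + 1))\<close>. Now let \<open>n\<close> tend to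
  infinity, and only then let \<open>v\<close> exhaust \<open>B 1\<close>. In this order the limits are legitimate even
  if the entropies of \<open>\<xi>\<close> are infinite; with all of \<open>B 1\<close> in place of the finite \<open>v\<close> the continuity
  in \<open>n\<close> fails in general.
\<close>

section \<open>Entropy of finite families of events\<close>

definition pattern :: "'a set set \<Rightarrow> 'a \<Rightarrow> 'a set set" where
  "pattern P x = {A \<in> P. x \<in> A}"

definition cell :: "'a measure \<Rightarrow> 'a set set \<Rightarrow> 'a set set \<Rightarrow> 'a set" where
  "cell M P a = {x \<in> space M. pattern P x = a}"

text \<open>The cells of \<open>P\<close> are indexed by the subfamilies of \<open>P\<close>; subfamilies that are no point's pattern
  have an empty cell and contribute \<open>0\<close>, since \<open>ln 0 = 0\<close>.\<close>

definition fentropy :: "'a measure \<Rightarrow> 'a set set \<Rightarrow> real" where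
  "fentropy M P = (\<Sum>a\<in>Pow P. - measure M (cell M P a) * ln (measure M (cell M P a)))"

text \<open>
  For \<open>0 < s \<le> t\<close> this is \<open>- s ln (s / t)\<close>, the contribution of a cell of measure \<open>s\<close> inside a
  conditioning cell of measure \<open>t\<close>.\<close>

definition fterm :: "real \<Rightarrow> real \<Rightarrow> real" where
  "fterm s t = - s * (ln s - ln t)"

lemma pattern_in_Pow: "pattern P x \<in> Pow P"
  by (auto simp: pattern_def)

lemma pattern_Int: "Q \<subseteq> P \<Longrightarrow> pattern Q x = pattern P x \<inter> Q"
  by (auto simp: pattern_def)

lemma cell_empty: "\<not> a \<subseteq> P \<Longrightarrow> cell M P a = {}"
  by (auto simp: cell_def pattern_def)

lemma cell_sets [measurable]:
  assumes "finite P" "P \<subseteq> sets M"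
  shows "cell M P a \<in> sets M"
proof (cases "a \<subseteq> P")
  case True
  have "cell M P a = {x \<in> space M. \<forall>A\<in>P. x \<in> A \<longleftrightarrow> A \<in> a}"
    using True by (auto simp: cell_def pattern_def)
  moreover have "{x \<in> space M. \<forall>A\<in>P. x \<in> A \<longleftrightarrow> A \<in> a} \<in> sets M"
  proof (rule sets.sets_Collect_finite_All)
    show "{x \<in> space M. x \<in> A \<longleftrightarrow> A \<in> a} \<in> sets M" if "A \<in> P" for A
    proof -
      have "A \<in> sets M" using that assms by auto
      then have "A \<in> sets M" "{x \<in> space M. x \<in> A} = A" "{x \<in> space M. x \<notin> A} = space M - A"
        using sets.sets_into_space by blast+
      then show ?thesis by (cases "A \<in> a") auto
    qed
  qed (use assms True in auto)
  ultimately show ?thesis by simp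
next
  case False
  then show ?thesis by (simp add: cell_empty)
qed

context prob_space begin

lemma prob_eq_sum_cells:
  assumes "finite Q" "Q \<subseteq> events" "A \<in> events"
  shows "prob A = (\<Sum>b\<in>Pow Q. prob (A \<inter> cell M Q b))"
proof -
  have "A = (\<Union>b\<in>Pow Q. A \<inter> cell M Q b)"
    using assms(3)[THEN sets.sets_into_space] pattern_in_Pow by (fastforce simp: cell_def)
  moreover have "prob (\<Union>b\<in>Pow Q. A \<inter> cell M Q b) = (\<Sum>b\<in>Pow Q. prob (A \<inter> cell M Q b))"
    using assms by (intro finite_measure_finite_Union)
      (auto simp: disjoint_family_on_def cell_def intro!: sets.Int cell_sets[unfolded cell_def])
  ultimately show ?thesis by simp
qed

text \<open>Indexing the cells of \<open>P \<union> Q\<close> by pairs of subfamilies only adds empty cells: a pair whose components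
  disagree on a common member of \<open>P\<close> and \<open>Q\<close> is not realised by any point.\<close>

lemma sum_cells_Un:
  assumes "finite P" "finite Q" and "f {} = (0::real)"
  shows "(\<Sum>c\<in>Pow (P \<union> Q). f (cell M (P \<union> Q) c))
     = (\<Sum>a\<in>Pow P. \<Sum>b\<in>Pow Q. f (cell M P a \<inter> cell M Q b))"
proof -
  let ?j = "\<lambda>c. (c \<inter> P, c \<inter> Q)"
  have eq: "cell M (P \<union> Q) c = cell M P (c \<inter> P) \<inter> cell M Q (c \<inter> Q)" if "c \<subseteq> P \<union> Q" for c
    using that by (auto simp: cell_def pattern_def)
  have inj: "inj_on ?j (Pow (P \<union> Q))"
    by (auto simp: inj_on_def)
  have "(\<Sum>c\<in>Pow (P \<union> Q). f (cell M (P \<union> Q) c))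
      = (\<Sum>(a, b)\<in>?j ` Pow (P \<union> Q). f (cell M P a \<inter> cell M Q b))"
    by (subst sum.reindex[OF inj]) (auto simp: eq)
  also have "\<dots> = (\<Sum>(a, b)\<in>Pow P \<times> Pow Q. f (cell M P a \<inter> cell M Q b))"
  proof (rule sum.mono_neutral_left)
    show "\<forall>i\<in>Pow P \<times> Pow Q - ?j ` Pow (P \<union> Q). (case i of (a, b) \<Rightarrow> f (cell M P a \<inter> cell M Q b)) = 0"
    proof (clarify)
      fix a b assume ab: "a \<subseteq> P" "b \<subseteq> Q" "(a, b) \<notin> ?j ` Pow (P \<union> Q)"
      have "cell M P a \<inter> cell M Q b = {}"
      proof (rule ccontr)
        assume "cell M P a \<inter> cell M Q b \<noteq> {}"
        then obtain x where x: "a = pattern P x" "b = pattern Q x" by (auto simp: cell_def)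
        have "pattern P x = pattern (P \<union> Q) x \<inter> P" "pattern Q x = pattern (P \<union> Q) x \<inter> Q"
          by (rule pattern_Int; blast)+
        then have "(a, b) = ?j (pattern (P \<union> Q) x)" unfolding x by (simp only: prod.inject)
        moreover have "?j (pattern (P \<union> Q) x) \<in> ?j ` Pow (P \<union> Q)"
          by (rule imageI, rule pattern_in_Pow)
        ultimately have "(a, b) \<in> ?j ` Pow (P \<union> Q)" by (rule ssubst)
        with ab(3) show False by contradiction
      qed
      then show "f (cell M P a \<inter> cell M Q b) = 0" using assms by simp
    qed
  qed (use assms in auto)
  finally show ?thesis by (simp add: sum.cartesian_product)
qed

lemma fentropy_Un_diff:
  assumes "finite P" "P \<subseteq> events" "finite Q" "Q \<subseteq> events"
  shows "fentropy M (P \<union> Q) - fentropy M Q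
    = (\<Sum>a\<in>Pow P. \<Sum>b\<in>Pow Q. fterm (prob (cell M P a \<inter> cell M Q b)) (prob (cell M Q b)))"
proof -
  let ?m = "\<lambda>a b. prob (cell M P a \<inter> cell M Q b)"
  have 1: "fentropy M (P \<union> Q) = (\<Sum>a\<in>Pow P. \<Sum>b\<in>Pow Q. - ?m a b * ln (?m a b))"
    unfolding fentropy_def using assms by (intro sum_cells_Un) auto
  have "prob (cell M Q b) = (\<Sum>a\<in>Pow P. ?m a b)" for b
    using prob_eq_sum_cells[OF assms(1,2) cell_sets[OF assms(3,4)], of b] by (simp only: Int_commute)
  then have "fentropy M Q = (\<Sum>b\<in>Pow Q. - (\<Sum>a\<in>Pow P. ?m a b) * ln (prob (cell M Q b)))"
    unfolding fentropy_def by simp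
  also have "\<dots> = (\<Sum>b\<in>Pow Q. \<Sum>a\<in>Pow P. - ?m a b * ln (prob (cell M Q b)))"
    by (simp only: sum_distrib_right sum_negf[symmetric])
  also have "\<dots> = (\<Sum>a\<in>Pow P. \<Sum>b\<in>Pow Q. - ?m a b * ln (prob (cell M Q b)))"
    by (rule sum.swap)
  finally have 2: "fentropy M Q = \<dots>" .
  show ?thesis
    unfolding 1 2 sum_subtractf[symmetric] fterm_def
    by (intro sum.cong refl) (simp add: algebra_simps)
qed

lemma fterm_nonneg: "0 \<le> s \<Longrightarrow> s \<le> t \<Longrightarrow> 0 \<le> fterm s t"
  unfolding fterm_def by (cases "s = 0") (auto intro!: mult_nonneg_nonpos simp: mult_le_0_iff)

lemma fentropy_mono:
  assumes "finite P" "P \<subseteq> events" "finite Q" "Q \<subseteq> events"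
  shows "fentropy M Q \<le> fentropy M (P \<union> Q)"
proof -
  have "0 \<le> fentropy M (P \<union> Q) - fentropy M Q"
    unfolding fentropy_Un_diff[OF assms] using assms
    by (intro sum_nonneg fterm_nonneg finite_measure_mono) (auto intro: cell_sets)
  then show ?thesis by simp
qed

text \<open>
  Concavity of \<open>- x ln x\<close>, in the form in which it replaces Jensen's inequality below: the graph
  lies below its tangent at \<open>s\<close>.\<close>

lemma xlogx_tangent:
  fixes s x :: real
  assumes "0 < s" "0 \<le> x"
  shows "- x * ln x \<le> - x * ln s + s - x"
proof (cases "x = 0")
  case False
  then have "ln (s / x) \<le> s / x - 1" using assms by (intro ln_le_minus_one) auto
  then have "x * ln (s / x) \<le> x * (s / x - 1)" using assms by (intro mult_left_mono) auto
  then show ?thesis using assms False by (simp add: ln_div algebra_simps)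
qed (use assms in auto)

lemma fterm_tangent:
  assumes "0 < s" "0 \<le> x" "x \<le> t"
  shows "fterm x t \<le> - x * ln s + s * t - x"
proof (cases "t = 0")
  case False
  then show ?thesis using xlogx_tangent[of "s * t" x] assms
    by (simp add: fterm_def ln_mult algebra_simps)
qed (use assms in \<open>auto simp: fterm_def\<close>)

text \<open>Conditioning on a finer family decreases entropy. On a cell of \<open>Q\<close>, the tangent inequality at the
  average \<open>s\<close> of the conditional probabilities is summed over the cells of \<open>R\<close> inside it; the linear
  terms add up to the term of the cell of \<open>Q\<close>.\<close>

lemma fentropy_submodular:
  assumes P: "finite P" "P \<subseteq> events" and R: "finite R" "R \<subseteq> events" and "Q \<subseteq> R"
  shows "fentropy M (P \<union> R) - fentropy M R \<le> fentropy M (P \<union> Q) - fentropy M Q"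
proof -
  have Q: "finite Q" "Q \<subseteq> events" using assms finite_subset by auto
  note [measurable] = cell_sets[OF P] cell_sets[OF R] cell_sets[OF Q]
  let ?m = "\<lambda>a b. prob (cell M P a \<inter> cell M R b)"
  have fib: "(\<Sum>b\<in>{b\<in>Pow R. b \<inter> Q = d}. prob (A \<inter> cell M R b)) = prob (A \<inter> cell M Q d)"
    if "A \<in> events" for A d
  proof -
    have "prob (A \<inter> cell M Q d) = (\<Sum>b\<in>Pow R. prob (A \<inter> cell M Q d \<inter> cell M R b))"
      using that R by (intro prob_eq_sum_cells) auto
    also have "\<dots> = (\<Sum>b\<in>{b\<in>Pow R. b \<inter> Q = d}. prob (A \<inter> cell M R b))"
    proof (intro sum.mono_neutral_cong_right ballI)
      fix i assume "i \<in> Pow R - {b \<in> Pow R. b \<inter> Q = d}"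
      then have "cell M Q d \<inter> cell M R i = {}"
        using \<open>Q \<subseteq> R\<close> by (auto simp: cell_def pattern_def)
      then show "prob (A \<inter> cell M Q d \<inter> cell M R i) = 0" by (simp add: Int_assoc)
    next
      fix i assume "i \<in> {b \<in> Pow R. b \<inter> Q = d}"
      then have "cell M R i \<subseteq> cell M Q d"
        using \<open>Q \<subseteq> R\<close> by (auto simp: cell_def pattern_def)
      then show "prob (A \<inter> cell M Q d \<inter> cell M R i) = prob (A \<inter> cell M R i)"
        by (intro arg_cong[of _ _ prob]) auto
    qed (use R in auto)
    finally show ?thesis by simp
  qed
  have "(\<Sum>b\<in>Pow R. fterm (?m a b) (prob (cell M R b)))
      \<le> (\<Sum>d\<in>Pow Q. fterm (prob (cell M P a \<inter> cell M Q d)) (prob (cell M Q d)))" for a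
  proof -
    have "(\<Sum>b\<in>Pow R. fterm (?m a b) (prob (cell M R b)))
        = (\<Sum>d\<in>Pow Q. \<Sum>b\<in>{b\<in>Pow R. b \<inter> Q = d}. fterm (?m a b) (prob (cell M R b)))"
      using R Q by (intro sum.group[symmetric]) auto
    also have "\<dots> \<le> (\<Sum>d\<in>Pow Q. fterm (prob (cell M P a \<inter> cell M Q d)) (prob (cell M Q d)))"
    proof (rule sum_mono)
      fix d
      let ?B = "{b\<in>Pow R. b \<inter> Q = d}"
      let ?x = "prob (cell M P a \<inter> cell M Q d)" and ?t = "prob (cell M Q d)"
      have x: "(\<Sum>b\<in>?B. ?m a b) = ?x" by (rule fib) simp
      have t: "(\<Sum>b\<in>?B. prob (cell M R b)) = ?t"
        using fib[of "space M" d] by (simp add: Int_absorb1 cell_def)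
      show "(\<Sum>b\<in>?B. fterm (?m a b) (prob (cell M R b))) \<le> fterm ?x ?t"
      proof (cases "?x = 0")
        case True
        then have "\<forall>b\<in>?B. ?m a b = 0"
          using x R member_le_sum[of _ ?B "?m a"] by (auto intro!: antisym)
        then show ?thesis using True by (simp add: fterm_def)
      next
        case False
        have le: "?x \<le> ?t" by (intro finite_measure_mono) auto
        have pos: "0 < ?x" using False by (simp add: zero_less_measure_iff)
        then have pt: "0 < ?t" using le by linarith
        define s where "s = ?x / ?t"
        have s: "0 < s" using pos pt by (simp add: s_def)
        have "(\<Sum>b\<in>?B. fterm (?m a b) (prob (cell M R b)))
            \<le> (\<Sum>b\<in>?B. - ?m a b * ln s + s * prob (cell M R b) - ?m a b)"
          by (intro sum_mono fterm_tangent s finite_measure_mono) auto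
        also have "\<dots> = - (\<Sum>b\<in>?B. ?m a b) * ln s + s * (\<Sum>b\<in>?B. prob (cell M R b)) - (\<Sum>b\<in>?B. ?m a b)"
          by (simp only: sum.distrib sum_subtractf sum_distrib_left sum_distrib_right sum_negf[symmetric])
        also have "\<dots> = - ?x * ln s + s * ?t - ?x" by (simp only: x t)
        also have "\<dots> = fterm ?x ?t" using pos pt by (simp add: s_def fterm_def ln_div)
        finally show ?thesis .
      qed
    qed
    finally show ?thesis .
  qed
  then show ?thesis
    unfolding fentropy_Un_diff[OF P R] fentropy_Un_diff[OF P Q] by (rule sum_mono)
qed

end

section \<open>Conditional entropy of families of events\<close>

text \<open>The entropy of the finite partition generated by \<open>P\<close>, given the \<open>\<sigma>\<close>-algebra generated by \<open>F\<close>.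
  The infimum over finite subfamilies replaces conditional probabilities; the agreement with them is
  \<open>cond_fentropy_eq_integral\<close>.\<close>

definition cond_fentropy :: "'a measure \<Rightarrow> 'a set set \<Rightarrow> 'a set set \<Rightarrow> ennreal" where
  "cond_fentropy M P F = (INF Q\<in>{Q. finite Q \<and> Q \<subseteq> F}. ennreal (fentropy M (P \<union> Q) - fentropy M Q))"

definition family_entropy :: "'a measure \<Rightarrow> 'a set set \<Rightarrow> 'a set set \<Rightarrow> ennreal" where
  "family_entropy M G F = (SUP P\<in>{P. finite P \<and> P \<subseteq> G}. cond_fentropy M P F)"

text \<open>Addition commutes with infima in \<open>[0, \<infinity>]\<close> over an index set of any size; only this direction
  needs an argument.\<close>

lemma le_add_INF_ennreal:
  fixes x c :: ennreal
  assumes "\<And>i. i \<in> I \<Longrightarrow> x \<le> c + f i"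
  shows "x \<le> c + (INF i\<in>I. f i)"
proof (cases "c = top")
  case False
  then have "x - c \<le> f i" if "i \<in> I" for i
    using assms[OF that] by (simp add: ennreal_minus_le_iff)
  then have "x - c \<le> (INF i\<in>I. f i)" by (rule INF_greatest)
  then show ?thesis using False by (simp add: ennreal_minus_le_iff)
qed simp

lemma cond_fentropy_antimono: "F \<subseteq> F' \<Longrightarrow> cond_fentropy M P F' \<le> cond_fentropy M P F"
  unfolding cond_fentropy_def by (rule INF_superset_mono) auto

lemma family_entropy_antimono: "F \<subseteq> F' \<Longrightarrow> family_entropy M G F' \<le> family_entropy M G F"
  unfolding family_entropy_def by (intro SUP_mono) (auto intro: cond_fentropy_antimono)

lemma cond_fentropy_le_family_entropy:
  "finite P \<Longrightarrow> P \<subseteq> G \<Longrightarrow> cond_fentropy M P F \<le> family_entropy M G F"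
  unfolding family_entropy_def by (rule SUP_upper) auto

lemma cond_fentropy_le: "finite Q \<Longrightarrow> Q \<subseteq> F \<Longrightarrow> cond_fentropy M P F \<le> ennreal (fentropy M (P \<union> Q) - fentropy M Q)"
  unfolding cond_fentropy_def by (rule INF_lower) auto

text \<open>A finite subfamily of an increasing union lies in one of its members. This is the form of the
  martingale convergence theorem that the argument needs.\<close>

lemma cond_fentropy_Union_incseq:
  assumes "incseq F"
  shows "cond_fentropy M P (\<Union>n. F n) = (INF n::nat. cond_fentropy M P (F n))"
proof (rule antisym)
  show "(INF n. cond_fentropy M P (F n)) \<le> cond_fentropy M P (\<Union>n. F n)"
    unfolding cond_fentropy_def[of M P "\<Union>n. F n"]
  proof (rule INF_greatest, clarify)
    fix Q assume Q: "finite Q" "Q \<subseteq> (\<Union>n. F n)"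
    then have "\<exists>n. Q \<subseteq> F n"
    proof induction
      case (insert q Q)
      then obtain n m where "Q \<subseteq> F n" "q \<in> F m" by auto
      moreover have "F n \<subseteq> F (max n m)" "F m \<subseteq> F (max n m)"
        using incseqD[OF assms, of n "max n m"] incseqD[OF assms, of m "max n m"] by auto
      ultimately have "insert q Q \<subseteq> F (max n m)" by auto
      then show ?case ..
    qed simp
    then obtain n where "Q \<subseteq> F n" ..
    then show "(INF n. cond_fentropy M P (F n)) \<le> ennreal (fentropy M (P \<union> Q) - fentropy M Q)"
      by (intro INF_lower2[of n] cond_fentropy_le Q) auto
  qed
qed (intro INF_greatest cond_fentropy_antimono, auto)

context prob_space begin

lemma cond_fentropy_mono:
  assumes "P \<subseteq> P'" "finite P'" "P' \<subseteq> events" "F \<subseteq> events"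
  shows "cond_fentropy M P F \<le> cond_fentropy M P' F"
  unfolding cond_fentropy_def
proof (rule INF_superset_mono[OF order_refl], clarify, rule ennreal_leI)
  fix Q assume "finite Q" "Q \<subseteq> F"
  moreover have "P' \<union> (P \<union> Q) = P' \<union> Q" "P \<subseteq> events" using assms by auto
  ultimately show "fentropy M (P \<union> Q) - fentropy M Q \<le> fentropy M (P' \<union> Q) - fentropy M Q"
    using fentropy_mono[of P' "P \<union> Q"] assms finite_subset[of P P'] by (auto 4 3)
qed

text \<open>For each finite \<open>Q \<subseteq> F\<close> the identity \<open>h (P \<union> R \<union> Q) - h Q = (h (P \<union> Q) - h Q) + (h (R \<union> P \<union> Q) - h (P \<union> Q))\<close>
  holds, and \<open>P \<union> Q\<close> is a finite subfamily of \<open>F \<union> P\<close>. For the converse inequality the two infima are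
  approximated separately, by \<open>Q\<close> and \<open>W\<close>; submodularity allows passing to their common
  enlargement.\<close>

lemma cond_fentropy_chain:
  assumes P: "finite P" "P \<subseteq> events" and R: "finite R" "R \<subseteq> events" and F: "F \<subseteq> events"
  shows "cond_fentropy M (P \<union> R) F = cond_fentropy M P F + cond_fentropy M R (F \<union> P)"
proof (rule antisym)
  have sum: "ennreal (fentropy M (P \<union> R \<union> Q) - fentropy M Q)
      = ennreal (fentropy M (P \<union> Q) - fentropy M Q) + ennreal (fentropy M (R \<union> (P \<union> Q)) - fentropy M (P \<union> Q))"
    if "finite Q" "Q \<subseteq> F" for Q
  proof -
    have "P \<union> R \<union> Q = R \<union> (P \<union> Q)" by auto
    then show ?thesis
      using fentropy_mono[of R "P \<union> Q"] fentropy_mono[of P Q] that P R F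
      by (subst ennreal_plus[symmetric]) auto
  qed
  show "cond_fentropy M P F + cond_fentropy M R (F \<union> P) \<le> cond_fentropy M (P \<union> R) F"
    unfolding cond_fentropy_def[of M "P \<union> R"]
  proof (rule INF_greatest, clarify)
    fix Q assume Q: "finite Q" "Q \<subseteq> F"
    show "cond_fentropy M P F + cond_fentropy M R (F \<union> P) \<le> ennreal (fentropy M (P \<union> R \<union> Q) - fentropy M Q)"
      unfolding sum[OF Q] using Q P by (intro add_mono cond_fentropy_le) auto
  qed
  have le: "cond_fentropy M (P \<union> R) F \<le> ennreal (fentropy M (P \<union> Q) - fentropy M Q) + ennreal (fentropy M (R \<union> W) - fentropy M W)"
    if Q: "finite Q" "Q \<subseteq> F" and W: "finite W" "W \<subseteq> F \<union> P" for Q W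
  proof -
    \<comment> \<open>the part of \<open>W\<close> outside \<open>P\<close> lies in \<open>F\<close>, and \<open>P \<union> ?Q\<close> contains \<open>W\<close>\<close>
    let ?Q = "Q \<union> (W - P)"
    have Q': "finite ?Q" "?Q \<subseteq> F" using Q W by auto
    have "cond_fentropy M (P \<union> R) F \<le> ennreal (fentropy M (P \<union> R \<union> ?Q) - fentropy M ?Q)"
      by (rule cond_fentropy_le[OF Q'])
    also have "\<dots> \<le> ennreal (fentropy M (P \<union> Q) - fentropy M Q) + ennreal (fentropy M (R \<union> W) - fentropy M W)"
      unfolding sum[OF Q'] using P R Q Q' W F
      by (intro add_mono ennreal_leI fentropy_submodular) auto
    finally show ?thesis .
  qed
  have "cond_fentropy M (P \<union> R) F \<le> cond_fentropy M R (F \<union> P) + cond_fentropy M P F"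
    unfolding cond_fentropy_def[of M P F]
  proof (rule le_add_INF_ennreal, clarify)
    fix Q assume Q: "finite Q" "Q \<subseteq> F"
    have "cond_fentropy M (P \<union> R) F \<le> ennreal (fentropy M (P \<union> Q) - fentropy M Q) + cond_fentropy M R (F \<union> P)"
      unfolding cond_fentropy_def[of M R "F \<union> P"] by (rule le_add_INF_ennreal) (use le Q in auto)
    then show "cond_fentropy M (P \<union> R) F \<le> cond_fentropy M R (F \<union> P) + ennreal (fentropy M (P \<union> Q) - fentropy M Q)"
      by (simp add: add.commute)
  qed
  then show "cond_fentropy M (P \<union> R) F \<le> cond_fentropy M P F + cond_fentropy M R (F \<union> P)"
    by (simp add: add.commute)
qed

text \<open>The finite chain rule passes to suprema. The inequality \<open>\<le>\<close> is the delicate one: a finite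
  \<open>W \<subseteq> F \<union> G\<close> that nearly realises the condition \<open>F \<union> G\<close> uses finitely many members of \<open>G\<close>, and these
  are first added to \<open>P\<close>.\<close>

lemma family_entropy_chain:
  assumes G: "G \<subseteq> events" and G': "G' \<subseteq> events" and F: "F \<subseteq> events"
  shows "family_entropy M (G \<union> G') F = family_entropy M G F + family_entropy M G' (F \<union> G)"
proof (rule antisym)
  show "family_entropy M (G \<union> G') F \<le> family_entropy M G F + family_entropy M G' (F \<union> G)"
    unfolding family_entropy_def[of M "G \<union> G'"]
  proof (rule SUP_least, clarify)
    fix S assume S: "finite S" "S \<subseteq> G \<union> G'"
    define P R where "P = S \<inter> G" and "R = S - G"
    have PR: "finite P" "P \<subseteq> G" "finite R" "R \<subseteq> G'" "S = P \<union> R" using S by (auto simp: P_def R_def)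
    have "cond_fentropy M S F \<le> family_entropy M G F + cond_fentropy M R (F \<union> G)"
      unfolding cond_fentropy_def[of M R]
    proof (rule le_add_INF_ennreal, clarify)
      fix W assume W: "finite W" "W \<subseteq> F \<union> G"
      let ?P = "P \<union> (W - F)"
      have P': "finite ?P" "?P \<subseteq> G" "?P \<union> R \<subseteq> events" using PR W G G' by auto
      have "cond_fentropy M S F \<le> cond_fentropy M (?P \<union> R) F"
        by (rule cond_fentropy_mono) (use PR P' F in auto)
      also have "\<dots> = cond_fentropy M ?P F + cond_fentropy M R (F \<union> ?P)"
        by (rule cond_fentropy_chain) (use PR P' F in auto)
      also have "\<dots> \<le> family_entropy M G F + ennreal (fentropy M (R \<union> W) - fentropy M W)"
        using W by (intro add_mono cond_fentropy_le_family_entropy P' cond_fentropy_le) auto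
      finally show "cond_fentropy M S F \<le> family_entropy M G F + ennreal (fentropy M (R \<union> W) - fentropy M W)" .
    qed
    also have "\<dots> \<le> family_entropy M G F + family_entropy M G' (F \<union> G)"
      by (intro add_mono cond_fentropy_le_family_entropy PR order_refl)
    finally show "cond_fentropy M S F \<le> family_entropy M G F + family_entropy M G' (F \<union> G)" .
  qed
  have ne: "{P. finite P \<and> P \<subseteq> H} \<noteq> {}" for H :: "'a set set" by (auto intro: exI[of _ "{}"])
  have "cond_fentropy M P F + cond_fentropy M R (F \<union> G) \<le> family_entropy M (G \<union> G') F"
    if "finite P" "P \<subseteq> G" "finite R" "R \<subseteq> G'" for P R
  proof -
    have "cond_fentropy M P F + cond_fentropy M R (F \<union> G) \<le> cond_fentropy M P F + cond_fentropy M R (F \<union> P)"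
      using that by (intro add_mono cond_fentropy_antimono) auto
    also have "\<dots> = cond_fentropy M (P \<union> R) F"
      by (rule cond_fentropy_chain[symmetric]) (use that G G' F in auto)
    also have "\<dots> \<le> family_entropy M (G \<union> G') F"
      using that by (intro cond_fentropy_le_family_entropy) auto
    finally show ?thesis .
  qed
  note le = this
  have "(SUP R\<in>{P. finite P \<and> P \<subseteq> G'}. cond_fentropy M R (F \<union> G)) + cond_fentropy M P F
      \<le> family_entropy M (G \<union> G') F" if "finite P" "P \<subseteq> G" for P
    by (subst ennreal_SUP_add_left[OF ne, symmetric], rule SUP_least)
       (use le that in \<open>auto simp: add.commute\<close>)
  then have "(SUP P\<in>{P. finite P \<and> P \<subseteq> G}. cond_fentropy M P F) + family_entropy M G' (F \<union> G)
      \<le> family_entropy M (G \<union> G') F"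
    by (subst ennreal_SUP_add_left[OF ne, symmetric], intro SUP_least)
       (auto simp: add.commute family_entropy_def[of M G'])
  then show "family_entropy M G F + family_entropy M G' (F \<union> G) \<le> family_entropy M (G \<union> G') F"
    by (simp add: family_entropy_def[of M G])
qed

text \<open>If membership in \<open>q\<close> depends only on the pattern, each cell of \<open>Q\<close> lies inside \<open>q\<close> or misses it,
  so \<open>q\<close> adds no information.\<close>

lemma fentropy_determined:
  assumes Q: "finite Q" "Q \<subseteq> events" and q: "q \<in> events"
    and det: "\<And>x y. x \<in> space M \<Longrightarrow> y \<in> space M \<Longrightarrow> pattern Q x = pattern Q y \<Longrightarrow> x \<in> q \<Longrightarrow> y \<in> q"
  shows "fentropy M ({q} \<union> Q) = fentropy M Q"
proof -
  have "fterm (prob (cell M {q} a \<inter> cell M Q b)) (prob (cell M Q b)) = 0" for a b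
  proof -
    have "cell M {q} a \<inter> cell M Q b = {} \<or> cell M {q} a \<inter> cell M Q b = cell M Q b"
      using det by (auto simp: cell_def pattern_def[of "{q}"])
    then show ?thesis by (auto simp: fterm_def)
  qed
  then show ?thesis
    using fentropy_Un_diff[of "{q}" Q] Q q by simp
qed

end

text \<open>The point \<open>0\<close> is the limit of \<open>ln y / y\<close> at infinity, with \<open>y\<close> the inverse of the argument.\<close>

lemma continuous_on_xlogx: "continuous_on {0..} (\<lambda>t::real. - t * ln t)"
proof (rule continuous_on_eq_continuous_within[THEN iffD2], rule ballI)
  fix t :: real assume "t \<in> {0..}"
  then consider "t = 0" | "t > 0" by fastforce
  then show "continuous (at t within {0..}) (\<lambda>t. - t * ln t)"
  proof cases
    case 1
    have "((\<lambda>t::real. ln (inverse t) / inverse t) \<longlongrightarrow> 0) (at_right 0)"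
      by (rule filterlim_compose[OF ln_x_over_x_tendsto_0 filterlim_inverse_at_top_right])
    moreover have "\<forall>\<^sub>F t::real in at_right 0. ln (inverse t) / inverse t = - t * ln t"
      using eventually_at_right_less[of 0] by eventually_elim (simp add: ln_inverse divide_inverse)
    ultimately have "((\<lambda>t::real. - t * ln t) \<longlongrightarrow> 0) (at_right 0)"
      by (rule Lim_transform_eventually)
    then show ?thesis
      by (simp add: 1 continuous_within at_within_Ici_at_right)
  qed (auto intro!: continuous_intros)
qed

section \<open>The sets determined by a family\<close>

text \<open>The events about which \<open>F\<close> leaves no uncertainty. They turn out to form a \<open>\<sigma>\<close>-algebra that contains
  \<open>F\<close> and all null sets, hence all sets that \<open>F\<close> generates mod 0.\<close>

definition entropy_closure :: "'a measure \<Rightarrow> 'a set set \<Rightarrow> 'a set set" where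
  "entropy_closure M F = {q \<in> sets M. cond_fentropy M {q} F = 0}"

lemma cell_singleton:
  assumes "q \<subseteq> space M"
  shows "cell M {q} {q} = q" "cell M {q} {} = space M - q"
  using assms by (auto simp: cell_def pattern_def)

context prob_space begin

lemma cond_fentropy_eq_0:
  assumes "finite P" "P \<subseteq> entropy_closure M F" "F \<subseteq> events"
  shows "cond_fentropy M P F = 0"
  using assms(1,2)
proof induction
  case empty
  show ?case using cond_fentropy_le[of "{}" F M "{}"] by simp
next
  case (insert q P)
  have "cond_fentropy M ({q} \<union> P) F = cond_fentropy M {q} F + cond_fentropy M P (F \<union> {q})"
    by (rule cond_fentropy_chain) (use insert assms(3) in \<open>auto simp: entropy_closure_def\<close>)
  moreover have "cond_fentropy M P (F \<union> {q}) \<le> cond_fentropy M P F"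
    by (rule cond_fentropy_antimono) auto
  ultimately show ?case using insert by (simp add: entropy_closure_def)
qed

text \<open>In the infimum that defines \<open>H(P | F)\<close>, finite families of events determined by \<open>F\<close> are as good as
  finite subfamilies of \<open>F\<close>: by the chain rule, adding them to the condition changes nothing.\<close>

lemma cond_fentropy_le_closure:
  assumes "finite Q" "Q \<subseteq> entropy_closure M F" "F \<subseteq> events" "finite P" "P \<subseteq> events"
  shows "cond_fentropy M P F \<le> ennreal (fentropy M (P \<union> Q) - fentropy M Q)"
proof -
  have Q: "Q \<subseteq> events" using assms(2) by (auto simp: entropy_closure_def)
  have "cond_fentropy M P F \<le> cond_fentropy M (Q \<union> P) F"
    by (rule cond_fentropy_mono) (use assms Q in auto)
  also have "\<dots> = cond_fentropy M Q F + cond_fentropy M P (F \<union> Q)"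
    by (rule cond_fentropy_chain) (use assms Q in auto)
  also have "cond_fentropy M Q F = 0" by (rule cond_fentropy_eq_0) fact+
  also have "0 + cond_fentropy M P (F \<union> Q) \<le> ennreal (fentropy M (P \<union> Q) - fentropy M Q)"
    using assms by (simp add: cond_fentropy_le)
  finally show ?thesis .
qed

lemma subset_entropy_closure:
  assumes "F \<subseteq> events"
  shows "F \<subseteq> entropy_closure M F"
proof
  fix q assume q: "q \<in> F"
  then have "cond_fentropy M {q} F = 0"
    using cond_fentropy_le[of "{q}" F M "{q}"] by simp
  then show "q \<in> entropy_closure M F"
    using q assms by (auto simp: entropy_closure_def)
qed

lemma null_sets_subset_entropy_closure: "null_sets M \<subseteq> entropy_closure M F"
proof
  fix q assume q: "q \<in> null_sets M"
  then have e: "q \<in> events" "q \<subseteq> space M" using sets.sets_into_space by auto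
  have m: "prob q = 0" "prob (space M - q) = 1"
    using q e by (auto simp: null_sets_def measure_def prob_compl emeasure_compl emeasure_space_1)
  have "cell M {} {} = space M" by (auto simp: cell_def pattern_def)
  then have "fentropy M ({q} \<union> {}) - fentropy M {} = 0"
    using e m sets.sets_into_space[OF e(1)]
    by (subst fentropy_Un_diff)
       (auto simp: Pow_insert cell_singleton fterm_def prob_space Int_absorb2)
  then have "cond_fentropy M {q} F = 0"
    using cond_fentropy_le[of "{}" F M "{q}"] by simp
  then show "q \<in> entropy_closure M F" using e by (simp add: entropy_closure_def)
qed

lemma cond_fentropy_determined_closure:
  assumes "finite Q" "Q \<subseteq> entropy_closure M F" "F \<subseteq> events" "q \<in> events"
    and "\<And>x y. x \<in> space M \<Longrightarrow> y \<in> space M \<Longrightarrow> pattern Q x = pattern Q y \<Longrightarrow> x \<in> q \<Longrightarrow> y \<in> q"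
  shows "q \<in> entropy_closure M F"
proof -
  have Q: "Q \<subseteq> events" using assms(2) by (auto simp: entropy_closure_def)
  have "fentropy M ({q} \<union> Q) = fentropy M Q"
    by (rule fentropy_determined[OF assms(1) Q assms(4,5)])
  then have "cond_fentropy M {q} F = 0"
    using cond_fentropy_le_closure[OF assms(1-3), of "{q}"] assms(4) by simp
  then show ?thesis using assms(4) by (simp add: entropy_closure_def)
qed

text \<open>Given \<open>A n\<close>, the only uncertainty about the union \<open>q\<close> is whether a point outside \<open>A n\<close> lies in \<open>q\<close>.
  Its entropy \<open>e n\<close> tends to \<open>0\<close> by continuity of \<open>x ln x\<close>, because \<open>q - A n\<close> has small measure.\<close>

lemma entropy_closure_incseq:
  assumes A: "range A \<subseteq> entropy_closure M F" and "incseq A" and F: "F \<subseteq> events"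
  shows "(\<Union>n::nat. A n) \<in> entropy_closure M F"
proof -
  let ?q = "\<Union>n. A n"
  let ?\<phi> = "\<lambda>t::real. - t * ln t"
  have ev: "A n \<in> events" "?q \<in> events" for n using A by (auto simp: entropy_closure_def)
  have sp: "A n \<subseteq> space M" "?q \<subseteq> space M" for n using ev[THEN sets.sets_into_space] by auto
  define e where "e n = fentropy M ({?q} \<union> {A n}) - fentropy M {A n}" for n
  have e: "e n = ?\<phi> (prob ?q - prob (A n)) + ?\<phi> (1 - prob ?q) - ?\<phi> (1 - prob (A n))" for n
  proof -
    have i: "?q \<inter> A n = A n" "(space M - ?q) \<inter> A n = {}" "?q \<inter> (space M - A n) = ?q - A n"
        "(space M - ?q) \<inter> (space M - A n) = space M - ?q"
      using sp by auto
    have p: "prob (?q - A n) = prob ?q - prob (A n)"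
      by (rule finite_measure_Diff) (use ev in auto)
    have "e n = fterm (prob ((space M - ?q) \<inter> (space M - A n))) (prob (space M - A n))
        + fterm (prob ((space M - ?q) \<inter> A n)) (prob (A n))
        + (fterm (prob (?q \<inter> (space M - A n))) (prob (space M - A n)) + fterm (prob (?q \<inter> A n)) (prob (A n)))"
      unfolding e_def using ev
      by (subst fentropy_Un_diff) (auto simp: Pow_insert cell_singleton[OF sp(1)] cell_singleton[OF sp(2)])
    then show ?thesis
      unfolding i p prob_compl[OF ev(1)] prob_compl[OF ev(2)] by (simp add: fterm_def algebra_simps)
  qed
  have lim: "(\<lambda>n. prob (A n)) \<longlonglongrightarrow> prob ?q"
    by (rule finite_Lim_measure_incseq) (use ev \<open>incseq A\<close> in auto)
  have mono: "prob (A n) \<le> prob ?q" for n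
    by (rule finite_measure_mono) (use ev in auto)
  have "(\<lambda>n. ?\<phi> (prob ?q - prob (A n))) \<longlonglongrightarrow> ?\<phi> 0"
    by (rule continuous_on_tendsto_compose[OF continuous_on_xlogx])
       (use mono tendsto_diff[OF tendsto_const lim, of "prob ?q"] in auto)
  note l1 = this
  have l2: "(\<lambda>n. ?\<phi> (1 - prob (A n))) \<longlonglongrightarrow> ?\<phi> (1 - prob ?q)"
    by (rule continuous_on_tendsto_compose[OF continuous_on_xlogx])
       (use tendsto_diff[OF tendsto_const lim, of 1] in auto)
  have "(\<lambda>n. ?\<phi> (prob ?q - prob (A n)) + ?\<phi> (1 - prob ?q) - ?\<phi> (1 - prob (A n)))
      \<longlonglongrightarrow> ?\<phi> 0 + ?\<phi> (1 - prob ?q) - ?\<phi> (1 - prob ?q)"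
    by (rule tendsto_diff[OF tendsto_add[OF l1 tendsto_const] l2])
  then have "(\<lambda>n. e n) \<longlonglongrightarrow> 0" unfolding e by simp
  then have "(\<lambda>n. ennreal (e n)) \<longlonglongrightarrow> ennreal 0" by (rule tendsto_ennrealI)
  moreover have "cond_fentropy M {?q} F \<le> ennreal (e n)" for n
    unfolding e_def by (rule cond_fentropy_le_closure) (use A F ev in auto)
  ultimately have "cond_fentropy M {?q} F \<le> ennreal 0"
    by (intro LIMSEQ_le_const) auto
  then show ?thesis using ev by (simp add: entropy_closure_def)
qed

lemma sigma_algebra_entropy_closure:
  assumes F: "F \<subseteq> events"
  shows "sigma_algebra (space M) (entropy_closure M F)"
proof -
  have ev: "entropy_closure M F \<subseteq> events" by (auto simp: entropy_closure_def)
  have "(\<Union>i. A i) \<in> entropy_closure M F" if A: "range A \<subseteq> entropy_closure M F" for A :: "nat \<Rightarrow> 'a set"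
  proof -
    have "(\<Union>i<n. A i) \<in> entropy_closure M F" for n
    proof (rule cond_fentropy_determined_closure[OF _ _ F])
      show "finite (A ` {..<n})" "A ` {..<n} \<subseteq> entropy_closure M F" using A by auto
      show "(\<Union>i<n. A i) \<in> events" using A ev by (intro sets.finite_UN) auto
      show "y \<in> (\<Union>i<n. A i)" if "pattern (A ` {..<n}) x = pattern (A ` {..<n}) y" "x \<in> (\<Union>i<n. A i)" for x y
        using that by (auto simp: pattern_def set_eq_iff)
    qed
    then have "(\<Union>n. \<Union>i<n. A i) \<in> entropy_closure M F"
      by (intro entropy_closure_incseq F) (auto simp: incseq_def intro: less_le_trans)
    also have "(\<Union>n. \<Union>i<n. A i) = (\<Union>i. A i)" by auto
    finally show ?thesis .
  qed
  moreover have "space M - q \<in> entropy_closure M F" if "q \<in> entropy_closure M F" for q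
  proof (rule cond_fentropy_determined_closure[OF _ _ F])
    show "finite {q}" "{q} \<subseteq> entropy_closure M F" "space M - q \<in> events" using that ev by auto
  qed (auto simp: pattern_def)
  moreover have "{} \<in> entropy_closure M F"
    using null_sets_subset_entropy_closure by auto
  ultimately show ?thesis
    using ev sets.sets_into_space unfolding sigma_algebra_iff2 by blast
qed

section \<open>Invariance under measure preserving bijections\<close>

lemma pattern_image:
  assumes U: "bij_betw U (space M) (space M)" and P: "P \<subseteq> events" and z: "z \<in> space M"
  shows "pattern ((`) U ` P) (U z) = (`) U ` pattern P z"
proof -
  have "U z \<in> U ` A \<longleftrightarrow> z \<in> A" if "A \<in> P" for A
  proof -
    have "A \<subseteq> space M" using that P sets.sets_into_space by auto
    then show ?thesis using bij_betw_imp_inj_on[OF U] z by (auto simp: inj_on_def)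
  qed
  then show ?thesis by (auto simp: pattern_def)
qed

lemma fentropy_image:
  assumes U: "bij_betw U (space M) (space M)"
    and mp: "\<And>A. A \<in> events \<Longrightarrow> prob (U ` A) = prob A"
    and P: "finite P" "P \<subseteq> events"
  shows "fentropy M ((`) U ` P) = fentropy M P"
proof -
  have "P \<subseteq> Pow (space M)" using P sets.sets_into_space by auto
  then have inj: "inj_on ((`) U) P"
    using inj_on_image_Pow[OF bij_betw_imp_inj_on[OF U]] inj_on_subset by blast
  have cell: "cell M ((`) U ` P) ((`) U ` a) = U ` cell M P a" if "a \<subseteq> P" for a
  proof -
    have "(`) U ` pattern P z = (`) U ` a \<longleftrightarrow> pattern P z = a" for z
      using inj that pattern_in_Pow[of P z] by (intro inj_on_image_eq_iff) auto
    then have "U ` cell M P a = {U z |z. z \<in> space M \<and> pattern ((`) U ` P) (U z) = (`) U ` a}"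
      by (auto simp: cell_def pattern_image[OF U P(2)])
    also have "\<dots> = cell M ((`) U ` P) ((`) U ` a)"
      using bij_betw_imp_surj_on[OF U] by (auto simp: cell_def image_iff)
    finally show ?thesis by simp
  qed
  have "(\<Sum>a\<in>Pow ((`) U ` P). - prob (cell M ((`) U ` P) a) * ln (prob (cell M ((`) U ` P) a)))
      = (\<Sum>a\<in>Pow P. - prob (cell M P a) * ln (prob (cell M P a)))"
    unfolding image_Pow_surj[OF refl, symmetric]
    by (subst sum.reindex[OF inj_on_image_Pow[OF inj]], intro sum.cong refl)
       (use cell mp[OF cell_sets[OF P]] in auto)
  then show ?thesis by (simp add: fentropy_def)
qed

lemma cond_fentropy_image:
  assumes U: "bij_betw U (space M) (space M)"
    and mp: "\<And>A. A \<in> events \<Longrightarrow> prob (U ` A) = prob A"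
    and P: "finite P" "P \<subseteq> events" and F: "F \<subseteq> events"
  shows "cond_fentropy M ((`) U ` P) ((`) U ` F) = cond_fentropy M P F"
proof -
  have "{Q. finite Q \<and> Q \<subseteq> (`) U ` F} = (`) ((`) U) ` {Q. finite Q \<and> Q \<subseteq> F}"
    by (auto dest: finite_subset_image)
  moreover have "fentropy M ((`) U ` P \<union> (`) U ` Q) - fentropy M ((`) U ` Q) = fentropy M (P \<union> Q) - fentropy M Q"
    if "finite Q" "Q \<subseteq> F" for Q
    unfolding image_Un[symmetric] using that P F
    by (subst (1 2) fentropy_image[OF U mp]) auto
  ultimately show ?thesis
    unfolding cond_fentropy_def by (auto simp: image_image intro!: INF_cong)
qed

lemma family_entropy_image:
  assumes U: "bij_betw U (space M) (space M)"
    and mp: "\<And>A. A \<in> events \<Longrightarrow> prob (U ` A) = prob A"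
    and G: "G \<subseteq> events" and F: "F \<subseteq> events"
  shows "family_entropy M ((`) U ` G) ((`) U ` F) = family_entropy M G F"
proof -
  have "{Q. finite Q \<and> Q \<subseteq> (`) U ` G} = (`) ((`) U) ` {Q. finite Q \<and> Q \<subseteq> G}"
    by (auto dest: finite_subset_image)
  moreover have "cond_fentropy M ((`) U ` P) ((`) U ` F) = cond_fentropy M P F"
    if "finite P" "P \<subseteq> G" for P
    by (rule cond_fentropy_image[OF U mp]) (use that G F in auto)
  ultimately show ?thesis
    unfolding family_entropy_def by (auto simp: image_image intro!: SUP_cong)
qed

end

section \<open>Conditional entropy through conditional probabilities\<close>

context prob_space begin

lemma xlogx_bounds:
  fixes t :: real
  assumes "0 \<le> t" "t \<le> 1"
  shows "0 \<le> - t * ln t" "- t * ln t \<le> 1"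
proof -
  show "0 \<le> - t * ln t" using assms by (cases "t = 0") (auto simp: mult_nonneg_nonpos)
  show "- t * ln t \<le> 1" using xlogx_tangent[of 1 t] assms by simp
qed

lemma integral_eq_sum_cells:
  fixes f :: "'a \<Rightarrow> real"
  assumes "finite Q" "Q \<subseteq> events" "integrable M f"
  shows "(\<integral>x. f x \<partial>M) = (\<Sum>b\<in>Pow Q. \<integral>x. indicator (cell M Q b) x * f x \<partial>M)"
proof -
  have "(\<Sum>b\<in>Pow Q. \<integral>x. indicator (cell M Q b) x * f x \<partial>M)
      = (\<integral>x. (\<Sum>b\<in>Pow Q. indicator (cell M Q b) x * f x) \<partial>M)"
    using integrable_mult_indicator[OF cell_sets[OF assms(1,2)] assms(3)]
    by (intro Bochner_Integration.integral_sum[symmetric]) simp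
  also have "\<dots> = (\<integral>x. f x \<partial>M)"
  proof (rule Bochner_Integration.integral_cong[OF refl])
    fix x assume "x \<in> space M"
    then have "(\<Sum>b\<in>Pow Q. indicator (cell M Q b) x * f x) = (\<Sum>b\<in>Pow Q. if b = pattern Q x then f x else 0)"
      by (intro sum.cong) (auto simp: cell_def)
    then show "(\<Sum>b\<in>Pow Q. indicator (cell M Q b) x * f x) = f x"
      using assms(1) pattern_in_Pow[of Q x] by simp
  qed
  finally show ?thesis ..
qed

text \<open>Here \<open>v\<close> is a conditional probability of \<open>A\<close>, and \<open>q\<close> a set of the conditioning \<open>\<sigma>\<close>-algebra. By
  Jensen's inequality, averaging \<open>v\<close> over \<open>q\<close> can only increase the entropy.\<close>

lemma integral_xlogx_le_fterm:
  assumes A: "A \<in> events" and q: "q \<in> events" and v [measurable]: "v \<in> borel_measurable M"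
    and v01: "\<And>x. 0 \<le> v x" "\<And>x. v x \<le> 1"
    and int: "prob (A \<inter> q) = (\<integral>x. indicator q x * v x \<partial>M)"
  shows "(\<integral>x. indicator q x * (- v x * ln (v x)) \<partial>M) \<le> fterm (prob (A \<inter> q)) (prob q)"
proof -
  note [measurable] = A q
  let ?m = "prob (A \<inter> q)"
  have qi: "integrable M (\<lambda>x. c * indicator q x :: real)" for c :: real
    by (rule integrable_const_bound[of _ "\<bar>c\<bar>"]) (auto simp: indicator_def)
  have integ: "integrable M (\<lambda>x. indicator q x * v x)"
    by (rule integrable_const_bound[of _ 1]) (use v01 in \<open>auto simp: indicator_def\<close>)
  have integ': "integrable M (\<lambda>x. indicator q x * (- v x * ln (v x)))"
    by (rule integrable_const_bound[of _ 1]) (use xlogx_bounds[OF v01] in \<open>auto simp: indicator_def\<close>)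
  show ?thesis
  proof (cases "?m = 0")
    case True
    then have "AE x in M. indicator q x * v x = 0"
      using int integral_nonneg_eq_0_iff_AE[OF integ] v01 by simp
    then have "AE x in M. indicator q x * (- v x * ln (v x)) = 0" by eventually_elim auto
    then have "(\<integral>x. indicator q x * (- v x * ln (v x)) \<partial>M) = 0" by (rule integral_eq_zero_AE)
    then show ?thesis using True by (simp add: fterm_def)
  next
    case False
    have le: "?m \<le> prob q" by (intro finite_measure_mono) auto
    have m: "0 < ?m" using False by (simp add: zero_less_measure_iff)
    then have t: "0 < prob q" using le by linarith
    define s where "s = ?m / prob q"
    have s: "0 < s" using m t by (simp add: s_def)
    have "(\<integral>x. indicator q x * (- v x * ln (v x)) \<partial>M)
        \<le> (\<integral>x. (- ln s - 1) * (indicator q x * v x) + s * indicator q x \<partial>M)"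
    proof (rule integral_mono[OF integ'])
      show "integrable M (\<lambda>x. (- ln s - 1) * (indicator q x * v x) + s * indicator q x)"
        by (rule Bochner_Integration.integrable_add[OF integrable_mult_right qi]) (rule integ)
      show "indicator q x * (- v x * ln (v x)) \<le> (- ln s - 1) * (indicator q x * v x) + s * indicator q x" for x
        using xlogx_tangent[OF s v01(1)[of x]] by (auto simp: indicator_def algebra_simps)
    qed
    also have "\<dots> = (- ln s - 1) * ?m + s * prob q"
      using integ qi by (subst Bochner_Integration.integral_add) (auto simp: int)
    also have "\<dots> = fterm ?m (prob q)" using m t by (simp add: s_def fterm_def ln_div algebra_simps)
    finally show ?thesis .
  qed
qed

text \<open>Conversely little is lost by averaging when \<open>v\<close> oscillates by at most \<open>d\<close> on \<open>q\<close>: the average \<open>s\<close> is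
  then within \<open>d\<close> of all values of \<open>v\<close>, and \<open>- x ln x\<close> changes by at most \<open>e\<close> on that scale.\<close>

lemma fterm_le_integral_xlogx:
  assumes A: "A \<in> events" and q: "q \<in> events" and v [measurable]: "v \<in> borel_measurable M"
    and v01: "\<And>x. 0 \<le> v x" "\<And>x. v x \<le> 1"
    and int: "prob (A \<inter> q) = (\<integral>x. indicator q x * v x \<partial>M)"
    and osc: "\<And>x y. x \<in> q \<Longrightarrow> y \<in> q \<Longrightarrow> v x \<le> v y + d"
    and cont: "\<And>s t. 0 \<le> s \<Longrightarrow> s \<le> 1 \<Longrightarrow> 0 \<le> t \<Longrightarrow> t \<le> 1 \<Longrightarrow> \<bar>s - t\<bar> \<le> d \<Longrightarrow> - s * ln s \<le> - t * ln t + e"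
  shows "fterm (prob (A \<inter> q)) (prob q) \<le> (\<integral>x. indicator q x * (- v x * ln (v x)) \<partial>M) + e * prob q"
proof -
  note [measurable] = A q
  let ?m = "prob (A \<inter> q)"
  have qi: "integrable M (\<lambda>x. c * indicator q x :: real)" for c :: real
    by (rule integrable_const_bound[of _ "\<bar>c\<bar>"]) (auto simp: indicator_def)
  have integ: "integrable M (\<lambda>x. indicator q x * v x)"
    by (rule integrable_const_bound[of _ 1]) (use v01 in \<open>auto simp: indicator_def\<close>)
  have integ': "integrable M (\<lambda>x. indicator q x * (- v x * ln (v x)))"
    by (rule integrable_const_bound[of _ 1]) (use xlogx_bounds[OF v01] in \<open>auto simp: indicator_def\<close>)
  have le: "?m \<le> prob q" by (intro finite_measure_mono) auto
  show ?thesis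
  proof (cases "prob q = 0")
    case True
    then have "?m = 0" using le measure_nonneg[of M "A \<inter> q"] by linarith
    moreover have "0 \<le> (\<integral>x. indicator q x * (- v x * ln (v x)) \<partial>M)"
      by (intro Bochner_Integration.integral_nonneg) (use xlogx_bounds[OF v01] in \<open>auto simp: indicator_def\<close>)
    ultimately show ?thesis using True by (simp add: fterm_def)
  next
    case False
    then have t: "0 < prob q" by (simp add: zero_less_measure_iff)
    define s where "s = ?m / prob q"
    have s: "0 \<le> s" "s \<le> 1" using le t by (auto simp: s_def)
    have near: "\<bar>s - v x\<bar> \<le> d" if x: "x \<in> q" for x
    proof -
      have "?m \<le> (\<integral>y. (v x + d) * indicator q y \<partial>M)"
        unfolding int using osc x by (intro integral_mono integ qi) (auto simp: indicator_def)
      then have 1: "?m \<le> (v x + d) * prob q" by simp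
      have "(\<integral>y. (v x - d) * indicator q y \<partial>M) \<le> ?m"
        unfolding int using osc[OF x] by (intro integral_mono integ qi) (auto simp: indicator_def diff_le_eq)
      then have 2: "(v x - d) * prob q \<le> ?m" by simp
      from 1 2 t have "s \<le> v x + d" "v x - d \<le> s" by (auto simp: s_def field_simps)
      then show ?thesis by linarith
    qed
    have "(\<integral>x. (- s * ln s - e) * indicator q x \<partial>M) \<le> (\<integral>x. indicator q x * (- v x * ln (v x)) \<partial>M)"
    proof (rule integral_mono[OF _ integ'])
      show "(- s * ln s - e) * indicator q x \<le> indicator q x * (- v x * ln (v x))" for x
        using cont[OF s v01[of x] near[of x]] by (auto simp: indicator_def)
    qed (rule qi)
    then have "(- s * ln s - e) * prob q \<le> (\<integral>x. indicator q x * (- v x * ln (v x)) \<partial>M)" by simp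
    moreover have "fterm ?m (prob q) = - s * ln s * prob q"
    proof (cases "?m = 0")
      case False
      then have "0 < ?m" by (simp add: zero_less_measure_iff)
      then show ?thesis using t by (simp add: fterm_def s_def ln_div)
    qed (simp add: fterm_def s_def)
    ultimately show ?thesis by (simp add: algebra_simps)
  qed
qed

text \<open>The infimum over finite families is the usual conditional entropy of a finite partition given a
  \<open>\<sigma>\<close>-algebra \<open>S\<close>; \<open>v a\<close> is a conditional probability of the cell with index \<open>a\<close>. Jensen's inequality
  shows that no finite \<open>Q\<close> does better. The level sets of the functions \<open>v a\<close> at the multiples of
  \<open>1 / N\<close> form a finite \<open>Q\<close> on whose cells every \<open>v a\<close> is nearly constant, so that it is nearly
  optimal.\<close>

lemma cond_fentropy_eq_integral:
  assumes sub: "subalgebra M S" and P: "finite P" "P \<subseteq> events"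
    and v: "\<And>a. v a \<in> borel_measurable S" and v01: "\<And>a x. 0 \<le> v a x" "\<And>a x. v a x \<le> 1"
    and int: "\<And>a q. q \<in> sets S \<Longrightarrow> prob (cell M P a \<inter> q) = (\<integral>x. indicator q x * v a x \<partial>M)"
  shows "cond_fentropy M P (sets S) = ennreal (\<Sum>a\<in>Pow P. \<integral>x. - v a x * ln (v a x) \<partial>M)"
proof -
  let ?I = "\<lambda>a. \<integral>x. - v a x * ln (v a x) \<partial>M"
  have subS: "sets S \<subseteq> events" "space S = space M" using sub by (auto simp: subalgebra_def)
  have [measurable]: "v a \<in> borel_measurable M" for a using v by (rule measurable_from_subalg[OF sub])
  have integ: "integrable M (\<lambda>x. - v a x * ln (v a x))" for a
    by (rule integrable_const_bound[of _ 1]) (use xlogx_bounds[OF v01] in auto)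
  have cellS: "cell M Q b \<in> sets S" if "finite Q" "Q \<subseteq> sets S" for Q b
    using cell_sets[OF that] subS by (simp add: cell_def)
  show ?thesis
    unfolding cond_fentropy_def
  proof (rule ennreal_approx_INF[symmetric])
    fix Q assume "Q \<in> {Q. finite Q \<and> Q \<subseteq> sets S}"
    then have Q: "finite Q" "Q \<subseteq> sets S" "Q \<subseteq> events" using subS by auto
    show "ennreal (\<Sum>a\<in>Pow P. ?I a) \<le> ennreal (fentropy M (P \<union> Q) - fentropy M Q)"
      unfolding fentropy_Un_diff[OF P Q(1,3)]
    proof (rule ennreal_leI, rule sum_mono)
      fix a
      have "?I a = (\<Sum>b\<in>Pow Q. \<integral>x. indicator (cell M Q b) x * (- v a x * ln (v a x)) \<partial>M)"
        by (rule integral_eq_sum_cells[OF Q(1,3) integ])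
      also have "\<dots> \<le> (\<Sum>b\<in>Pow Q. fterm (prob (cell M P a \<inter> cell M Q b)) (prob (cell M Q b)))"
        by (intro sum_mono integral_xlogx_le_fterm cell_sets P Q v01 int cellS) auto
      finally show "?I a \<le> (\<Sum>b\<in>Pow Q. fterm (prob (cell M P a \<inter> cell M Q b)) (prob (cell M Q b)))" .
    qed
  next
    fix e :: real assume e: "e > 0"
    define c where "c = real (card (Pow P))"
    have c: "0 < c" using P by (auto simp: c_def card_gt_0_iff)
    have "uniformly_continuous_on {0..1} (\<lambda>t::real. - t * ln t)"
      by (intro compact_uniformly_continuous continuous_on_subset[OF continuous_on_xlogx]) auto
    moreover have "0 < e / c" using e c by simp
    ultimately obtain \<delta> where \<delta>: "\<delta> > 0"
      "\<And>t s :: real. t \<in> {0..1} \<Longrightarrow> s \<in> {0..1} \<Longrightarrow> dist s t < \<delta> \<Longrightarrow> dist (- s * ln s) (- t * ln t) < e / c"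
      by (rule uniformly_continuous_onE) (rule that)
    obtain n where "inverse (real (Suc n)) < \<delta>" using reals_Archimedean[OF \<delta>(1)] by blast
    then obtain N :: nat where N: "0 < N" "1 / real N < \<delta>"
      by (intro that[of "Suc n"]) (simp_all only: inverse_eq_divide zero_less_Suc)
    define Q where "Q = (\<lambda>(a, k). {x \<in> space M. v a x \<le> real k / real N}) ` (Pow P \<times> {..N})"
    have Q: "finite Q" "Q \<subseteq> sets S"
    proof -
      show "finite Q" using P by (auto simp: Q_def)
      have "{x \<in> space S. v a x \<le> real k / real N} \<in> sets S" for a k using v[of a] by measurable
      then show "Q \<subseteq> sets S" by (auto simp: Q_def subS)
    qed
    have Qe: "Q \<subseteq> events" using Q subS by auto
    have osc: "v a x \<le> v a y + 1 / real N" if "a \<subseteq> P" "x \<in> cell M Q b" "y \<in> cell M Q b" for a b x y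
    proof (rule ccontr)
      assume "\<not> v a x \<le> v a y + 1 / real N"
      then have less: "v a y + 1 / real N < v a x" by simp
      define k where "k = nat \<lceil>real N * v a y\<rceil>"
      have ky: "real N * v a y \<le> real k" "real k < real N * v a y + 1"
        using v01[of a y] N by (auto simp: k_def) linarith+
      have kN: "k \<le> N"
        using v01(2)[of a y] N by (auto simp: k_def ceiling_le_iff)
      let ?L = "{x \<in> space M. v a x \<le> real k / real N}"
      have xy: "pattern Q x = pattern Q y" "x \<in> space M" "y \<in> space M" using that by (simp_all add: cell_def)
      have "v a y \<le> real k / real N" using ky N by (simp add: field_simps)
      moreover have "?L \<in> Q" using that(1) kN unfolding Q_def by (intro image_eqI[of _ _ "(a, k)"]) auto
      ultimately have "?L \<in> pattern Q y" using xy(3) by (simp add: pattern_def)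
      then have "?L \<in> pattern Q x" by (simp only: xy(1))
      then have "v a x \<le> real k / real N" by (simp add: pattern_def)
      also have "\<dots> < (real N * v a y + 1) / real N" using ky(2) N by (intro divide_strict_right_mono) auto
      also have "\<dots> = v a y + 1 / real N" using N by (simp add: field_simps)
      finally show False using less by simp
    qed
    have "fentropy M (P \<union> Q) - fentropy M Q \<le> (\<Sum>a\<in>Pow P. ?I a) + e"
    proof -
      have "(\<Sum>b\<in>Pow Q. fterm (prob (cell M P a \<inter> cell M Q b)) (prob (cell M Q b))) \<le> ?I a + e / c"
        if a: "a \<in> Pow P" for a
      proof -
        have "(\<Sum>b\<in>Pow Q. fterm (prob (cell M P a \<inter> cell M Q b)) (prob (cell M Q b)))
            \<le> (\<Sum>b\<in>Pow Q. (\<integral>x. indicator (cell M Q b) x * (- v a x * ln (v a x)) \<partial>M) + e / c * prob (cell M Q b))"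
        proof (intro sum_mono fterm_le_integral_xlogx)
          show "v a x \<le> v a y + 1 / real N" if "x \<in> cell M Q b" "y \<in> cell M Q b" for x y b
            using osc[of a x b y] that a by auto
          show "- s * ln s \<le> - t * ln t + e / c"
            if "0 \<le> s" "s \<le> 1" "0 \<le> t" "t \<le> 1" "\<bar>s - t\<bar> \<le> 1 / real N" for s t
          proof -
            have "dist (- s * ln s) (- t * ln t) < e / c"
              using that N by (intro \<delta>(2)) (auto simp: dist_real_def)
            then show ?thesis by (simp add: dist_real_def)
          qed
        qed (use P Q Qe cellS v01 int cell_sets in auto)
        also have "\<dots> = ?I a + e / c * (\<Sum>b\<in>Pow Q. prob (cell M Q b))"
          by (simp only: sum.distrib sum_distrib_left[symmetric] integral_eq_sum_cells[OF Q(1) Qe integ])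
        also have "(\<Sum>b\<in>Pow Q. prob (cell M Q b)) = 1"
        proof -
          have "space M \<inter> cell M Q b = cell M Q b" for b by (auto simp: cell_def)
          then show ?thesis using prob_eq_sum_cells[OF Q(1) Qe sets.top] prob_space by simp
        qed
        finally show ?thesis by simp
      qed
      then have "(\<Sum>a\<in>Pow P. \<Sum>b\<in>Pow Q. fterm (prob (cell M P a \<inter> cell M Q b)) (prob (cell M Q b)))
          \<le> (\<Sum>a\<in>Pow P. ?I a + e / c)" by (rule sum_mono)
      also have "\<dots> = (\<Sum>a\<in>Pow P. ?I a) + c * (e / c)" by (simp only: sum.distrib sum_constant c_def)
      also have "c * (e / c) = e" using c by simp
      finally show ?thesis unfolding fentropy_Un_diff[OF P Q(1) Qe] .
    qed
    then have "ennreal (fentropy M (P \<union> Q) - fentropy M Q) \<le> ennreal ((\<Sum>a\<in>Pow P. ?I a) + e)"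
      by (rule ennreal_leI)
    also have "\<dots> = ennreal (\<Sum>a\<in>Pow P. ?I a) + ennreal e"
      using e xlogx_bounds(1)[OF v01] by (intro ennreal_plus sum_nonneg Bochner_Integration.integral_nonneg) auto
    finally show "\<exists>Q\<in>{Q. finite Q \<and> Q \<subseteq> sets S}. ennreal (fentropy M (P \<union> Q) - fentropy M Q)
        \<le> ennreal (\<Sum>a\<in>Pow P. ?I a) + ennreal e"
      by (rule bexI[of _ Q]) (simp add: Q)
  qed
qed

end

section \<open>Regular conditional distributions\<close>

text \<open>The kernel is built from its distribution functions. Conditional probabilities \<open>G q\<close> of \<open>{g \<le> q}\<close>
  at rational \<open>q\<close> are, for almost every \<open>x\<close>, increasing in \<open>q\<close>; the infimum \<open>H x r\<close> of \<open>G q x\<close> over the rational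
  \<open>q > r\<close> is then automatically right continuous. Bounds on \<open>g\<close> make the limits \<open>0\<close> and \<open>1\<close> at infinity
  immediate, and they cost no generality for the purpose of coding a space by real numbers. The
  values of \<open>K\<close> depend on \<open>x\<close> only through \<open>F\<close>-measurable functions everywhere, not merely almost
  everywhere, so \<open>K\<close> is constant on sets that \<open>F\<close> does not split.\<close>

lemma regular_conditional_distribution:
  fixes g :: "'a \<Rightarrow> real"
  assumes "prob_space M" and sub: "subalgebra M F" and g [measurable]: "g \<in> borel_measurable M"
    and bounded: "\<And>x. x \<in> space M \<Longrightarrow> - 1 \<le> g x \<and> g x \<le> 2"
  obtains K where "K \<in> measurable F (prob_algebra borel)"
    and "\<And>S b. S \<in> sets F \<Longrightarrow> b \<in> sets borel \<Longrightarrow>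
      emeasure M (g -` b \<inter> S) = (\<integral>\<^sup>+x\<in>S. emeasure (K x) b \<partial>M)"
proof -
  interpret prob_space M by fact
  interpret finite_measure_subalgebra M F by unfold_locales fact
  have spF: "space F = space M" and setsF: "sets F \<subseteq> sets M" using sub by (auto simp: subalgebra_def)
  define e :: "real \<Rightarrow> 'a \<Rightarrow> real" where "e q x = indicator {..q} (g x)" for q x
  have e_meas [measurable]: "e q \<in> borel_measurable M" for q unfolding e_def by measurable
  have e_int [simp]: "integrable M (e q)" for q
    by (rule integrable_const_bound[of _ 1]) (auto simp: e_def indicator_def)
  define G where "G q = real_cond_exp M F (e (of_rat q))" for q :: rat
  have G_meas [measurable]: "G q \<in> borel_measurable F" for q unfolding G_def by measurable
  define good where "good x \<longleftrightarrow> (\<forall>p q. p \<le> q \<longrightarrow> G p x \<le> G q x) \<and>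
      (\<forall>q. q < - 1 \<longrightarrow> G q x = 0) \<and> (\<forall>q\<ge>2. G q x = 1)" for x
  have good_meas [measurable]: "Measurable.pred F good" unfolding good_def by measurable
  have AE_good: "AE x in M. good x"
  proof -
    have "AE x in M. p \<le> q \<longrightarrow> G p x \<le> G q x" for p q
    proof (cases "p \<le> q")
      case True
      then have "AE x in M. G p x \<le> G q x"
        unfolding G_def by (intro real_cond_exp_mono) (auto simp: e_def indicator_def intro!: AE_I2 order_trans[OF _ of_rat_less_eq[THEN iffD2, OF True]])
      then show ?thesis by simp
    qed simp
    moreover have "AE x in M. q < - 1 \<longrightarrow> G q x = 0" for q
    proof (cases "q < - 1")
      case True
      then have "real_of_rat q < - 1" using of_rat_less[of q "- 1", where 'a=real] by simp
      then have "AE x in M. e (of_rat q) x = 0"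
        using bounded by (intro AE_I2) (force simp: e_def)
      then have "AE x in M. G q x = real_cond_exp M F (\<lambda>x. 0) x"
        unfolding G_def by (intro real_cond_exp_cong) auto
      moreover have "AE x in M. real_cond_exp M F (\<lambda>x. 0) x = 0"
        by (rule real_cond_exp_F_meas) auto
      ultimately show ?thesis by eventually_elim simp
    qed simp
    moreover have "AE x in M. 2 \<le> q \<longrightarrow> G q x = 1" for q
    proof (cases "2 \<le> q")
      case True
      then have "2 \<le> real_of_rat q" using of_rat_less_eq[of 2 q, where 'a=real] by simp
      then have "AE x in M. e (of_rat q) x = 1"
        using bounded by (intro AE_I2) (force simp: e_def)
      then have "AE x in M. G q x = real_cond_exp M F (\<lambda>x. 1) x"
        unfolding G_def by (intro real_cond_exp_cong) auto
      moreover have "AE x in M. real_cond_exp M F (\<lambda>x. 1) x = 1"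
        by (rule real_cond_exp_F_meas) auto
      ultimately show ?thesis by eventually_elim simp
    qed simp
    ultimately show ?thesis unfolding good_def AE_conj_iff AE_all_countable by blast
  qed
  define above :: "real \<Rightarrow> rat set" where "above r = {q. r < of_rat q}" for r
  have above_ne: "above r \<noteq> {}" for r
    using of_rat_dense[of r "r + 1"] by (auto simp: above_def)
  have bounds: "0 \<le> G q x" "G q x \<le> 1" if "good x" for q x
  proof -
    have "min q (- 2) \<le> q" "min q (- 2) < - 1" "q \<le> max q 2" "2 \<le> max q 2" by auto
    then show "0 \<le> G q x" "G q x \<le> 1" using that unfolding good_def by metis+
  qed
  \<comment> \<open>on the exceptional set, the distribution function of the point mass at \<open>0\<close>\<close>
  define H where "H x r = (if good x then (INF q\<in>above r. if good x then G q x else 0)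
      else indicator {0..} r)" for x r
  have bdd: "bdd_below ((\<lambda>q. if good x then G q x else 0) ` A)" for x A
    using bounds by (intro bdd_belowI[of _ 0]) (auto split: if_splits)
  have H_le: "H x r \<le> G q x" if "good x" "r < of_rat q" for x r q
    using that cINF_lower[OF bdd, of q "above r" x] by (auto simp: H_def above_def)
  have H_approx: "\<exists>q. r < of_rat q \<and> G q x < H x r + \<epsilon>" if "good x" "\<epsilon> > 0" for x r \<epsilon>
  proof -
    have "\<exists>q\<in>above r. G q x < H x r + \<epsilon>"
      using that cINF_less_iff[OF above_ne bdd, of x r "H x r + \<epsilon>"] by (auto simp: H_def)
    then show ?thesis by (auto simp: above_def)
  qed
  have H_bounds: "0 \<le> H x r" "H x r \<le> 1" for x r
  proof -
    obtain q where "r < of_rat q" using above_ne[of r] by (auto simp: above_def)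
    then show "H x r \<le> 1" using H_le[of x r q] bounds[of x q] by (cases "good x") (auto simp: H_def indicator_def)
    show "0 \<le> H x r" using above_ne bounds by (auto simp: H_def intro!: cINF_greatest)
  qed
  have H_mono: "H x r \<le> H x s" if "r \<le> s" for x r s
  proof (cases "good x")
    case True
    have "above s \<subseteq> above r" using that by (auto simp: above_def)
    then have "(INF q\<in>above r. if good x then G q x else 0) \<le> (INF q\<in>above s. if good x then G q x else 0)"
      by (intro cINF_superset_mono above_ne bdd) auto
    then show ?thesis using True by (simp add: H_def)
  qed (use that in \<open>auto simp: H_def indicator_def\<close>)
  have H_right: "continuous (at_right a) (H x)" for a x
  proof (subst continuous_at_right_real_increasing)
    show "H x r \<le> H x s" if "r \<le> s" for r s using that by (rule H_mono)
    show "\<forall>\<epsilon>>0. \<exists>d>0. H x (a + d) - H x a < \<epsilon>"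
    proof (intro allI impI)
      fix \<epsilon> :: real assume \<epsilon>: "\<epsilon> > 0"
      show "\<exists>d>0. H x (a + d) - H x a < \<epsilon>"
      proof (cases "good x")
        case True
        then obtain q where q: "a < of_rat q" "G q x < H x a + \<epsilon>" using H_approx[OF True \<epsilon>] by blast
        have "H x (a + (of_rat q - a) / 2) \<le> G q x"
          by (rule H_le[OF True]) (use q in \<open>simp add: field_simps\<close>)
        then show ?thesis using q by (intro exI[of _ "(of_rat q - a) / 2"]) auto
      next
        case False
        then show ?thesis using \<epsilon>
          by (intro exI[of _ "if a < 0 then - a / 2 else 1"]) (auto simp: H_def indicator_def)
      qed
    qed
  qed
  have H_bot: "(H x \<longlongrightarrow> 0) at_bot" for x
  proof (rule tendsto_eventually)
    have "H x r = 0" if "r \<le> - 2" for r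
    proof (cases "good x")
      case True
      have "G (- 3 / 2) x = 0" using True by (simp add: good_def)
      moreover have "H x r \<le> G (- 3 / 2) x"
        by (rule H_le[OF True]) (use that in \<open>simp add: of_rat_divide of_rat_minus\<close>)
      ultimately show ?thesis using H_bounds[of x r] by simp
    qed (use that in \<open>auto simp: H_def\<close>)
    then show "\<forall>\<^sub>F r in at_bot. H x r = 0" unfolding eventually_at_bot_linorder by blast
  qed
  have H_top: "(H x \<longlongrightarrow> 1) at_top" for x
  proof (rule tendsto_eventually)
    have "H x r = 1" if "2 \<le> r" for r
    proof (cases "good x")
      case True
      have "G q x = 1" if "q \<in> above r" for q
      proof -
        have "real_of_rat 2 \<le> of_rat q" using that \<open>2 \<le> r\<close> by (auto simp: above_def)
        then have "2 \<le> q" by (simp only: of_rat_less_eq)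
        then show ?thesis using True by (simp add: good_def)
      qed
      then show ?thesis using True above_ne[of r] by (simp add: H_def cong: INF_cong_simp)
    qed (use that in \<open>auto simp: H_def\<close>)
    then show "\<forall>\<^sub>F r in at_top. H x r = 1" unfolding eventually_at_top_linorder by blast
  qed
  define K where "K x = interval_measure (H x)" for x
  have K_Iic: "emeasure (K x) {..r} = ennreal (H x r)" for x r
    unfolding K_def by (rule emeasure_interval_measure_Iic[OF H_mono H_right H_bot])
  have H_meas [measurable]: "(\<lambda>x. H x r) \<in> borel_measurable F" for r
    unfolding H_def by (intro measurable_If borel_measurable_cINF bdd) auto
  have borel_gen: "sets (borel :: real measure) = sigma_sets UNIV (range atMost)"
    by (subst borel_eq_atMost) simp
  have Int_st: "Int_stable (range (atMost :: real \<Rightarrow> real set))"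
    by (auto simp: Int_stable_def)
  have K: "K \<in> measurable F (prob_algebra borel)"
  proof (rule measurable_prob_algebra_generated[OF borel_gen Int_st])
    show "prob_space (K x)" for x
      using real_distribution_interval_measure[OF H_mono H_right H_bot H_top]
      unfolding K_def real_distribution_def by blast
    show "(\<lambda>a. emeasure (K a) A) \<in> borel_measurable F" if "A \<in> range atMost" for A
      using that by (auto simp: K_Iic)
  qed (auto simp: K_def)
  have K_M: "K \<in> measurable M (subprob_algebra borel)"
    using measurable_prob_algebraD[OF K] by (rule measurable_from_subalg[OF sub])
  \<comment> \<open>the defining identity for half lines, by dominated convergence along rationals \<open>q n\<close> that tend to \<open>r\<close> from above\<close>
  have Iic: "emeasure M (g -` {..r} \<inter> S) = (\<integral>\<^sup>+x\<in>S. emeasure (K x) {..r} \<partial>M)" if S: "S \<in> sets F" for S r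
  proof -
    have [measurable]: "S \<in> sets M" using S setsF by auto
    have "\<forall>n. \<exists>q. r < of_rat q \<and> real_of_rat q < r + 1 / Suc n"
      using of_rat_dense[of r] by simp
    then obtain q where q: "\<And>n. r < of_rat (q n)" "\<And>n. real_of_rat (q n) < r + 1 / Suc n" by metis
    have ql: "(\<lambda>n. real_of_rat (q n)) \<longlonglongrightarrow> r"
    proof (rule tendsto_sandwich[OF _ _ tendsto_const])
      show "(\<lambda>n. r + 1 / Suc n) \<longlonglongrightarrow> r"
        using tendsto_add[OF tendsto_const LIMSEQ_Suc[OF lim_1_over_n], of r] by simp
    qed (use q in \<open>auto intro!: always_eventually less_imp_le\<close>)
    have [measurable]: "G k \<in> borel_measurable M" "(\<lambda>x. H x r) \<in> borel_measurable M" for k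
      using G_meas H_meas by (auto intro: measurable_from_subalg[OF sub])
    have "(\<lambda>n. \<integral>x. indicator S x * G (q n) x \<partial>M) \<longlonglongrightarrow> (\<integral>x. indicator S x * H x r \<partial>M)"
    proof (rule integral_dominated_convergence[where w="\<lambda>_. 1"])
      show "AE x in M. (\<lambda>n. indicator S x * G (q n) x) \<longlonglongrightarrow> indicator S x * H x r"
        using AE_good
      proof eventually_elim
        fix x assume x: "good x"
        have "(\<lambda>n. G (q n) x) \<longlonglongrightarrow> H x r"
        proof (rule order_tendstoI)
          show "\<forall>\<^sub>F n in sequentially. a < G (q n) x" if "a < H x r" for a
            using H_le[OF x q(1)] that by (intro always_eventually allI) (rule less_le_trans)
          show "\<forall>\<^sub>F n in sequentially. G (q n) x < a" if a: "H x r < a" for a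
          proof -
            obtain p where p: "r < of_rat p" "G p x < a" using H_approx[OF x, of "a - H x r" r] a by auto
            have "\<forall>\<^sub>F n in sequentially. real_of_rat (q n) < of_rat p"
              using order_tendstoD(2)[OF ql p(1)] .
            then show ?thesis
            proof eventually_elim
              fix n assume "real_of_rat (q n) < of_rat p"
              then have "q n \<le> p" by (simp add: of_rat_less)
              then have "G (q n) x \<le> G p x" using x by (auto simp: good_def)
              then show "G (q n) x < a" using p by simp
            qed
          qed
        qed
        then show "(\<lambda>n. indicator S x * G (q n) x) \<longlonglongrightarrow> indicator S x * H x r"
          by (intro tendsto_intros)
      qed
      show "AE x in M. norm (indicator S x * G (q n) x) \<le> 1" for n
        using AE_good by eventually_elim (use bounds in \<open>auto simp: indicator_def\<close>)
    qed auto
    moreover have "(\<integral>x. indicator S x * G (q n) x \<partial>M) = (\<integral>x. indicator S x * e (of_rat (q n)) x \<partial>M)" for n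
      using real_cond_exp_intA[OF e_int S, of "of_rat (q n)"]
      by (simp add: G_def set_lebesgue_integral_def)
    moreover have "(\<lambda>n. \<integral>x. indicator S x * e (of_rat (q n)) x \<partial>M) \<longlonglongrightarrow> (\<integral>x. indicator S x * e r x \<partial>M)"
    proof (rule integral_dominated_convergence[where w="\<lambda>_. 1"])
      show "AE x in M. (\<lambda>n. indicator S x * e (of_rat (q n)) x) \<longlonglongrightarrow> indicator S x * e r x"
      proof (rule AE_I2, rule tendsto_mult[OF tendsto_const], rule tendsto_eventually)
        fix x
        show "\<forall>\<^sub>F n in sequentially. e (of_rat (q n)) x = e r x"
        proof (cases "g x \<le> r")
          case True
          then show ?thesis using q(1) by (auto simp: e_def indicator_def intro!: always_eventually) (meson less_imp_le order_trans)
        next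
          case False
          then have "\<forall>\<^sub>F n in sequentially. real_of_rat (q n) < g x"
            using order_tendstoD(2)[OF ql, of "g x"] by simp
          then show ?thesis using False by (auto elim!: eventually_mono simp: e_def indicator_def)
        qed
      qed
      show "AE x in M. norm (indicator S x * e (of_rat (q n)) x) \<le> 1" for n
        by (auto simp: e_def indicator_def)
    qed auto
    ultimately have eq: "(\<integral>x. indicator S x * H x r \<partial>M) = (\<integral>x. indicator S x * e r x \<partial>M)"
      by (simp add: LIMSEQ_unique)
    have "(\<integral>\<^sup>+x\<in>S. emeasure (K x) {..r} \<partial>M) = (\<integral>\<^sup>+x. ennreal (indicator S x * H x r) \<partial>M)"
      by (intro nn_integral_cong) (auto simp: K_Iic indicator_def)
    also have "\<dots> = ennreal (\<integral>x. indicator S x * H x r \<partial>M)"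
      by (intro nn_integral_eq_integral integrable_const_bound[of _ 1])
         (use H_bounds in \<open>auto simp: indicator_def\<close>)
    also have "\<dots> = ennreal (\<integral>x. indicator (g -` {..r} \<inter> S) x \<partial>M)"
      unfolding eq by (intro arg_cong[of _ _ ennreal] Bochner_Integration.integral_cong) (auto simp: e_def indicator_def)
    also have "\<dots> = emeasure M (g -` {..r} \<inter> S)"
    proof -
      have "g -` {..r} \<inter> S = (g -` {..r} \<inter> space M) \<inter> S" using sets.sets_into_space[OF \<open>S \<in> sets M\<close>] by auto
      also have "\<dots> \<in> sets M" by measurable
      finally show ?thesis by (simp add: emeasure_eq_measure)
    qed
    finally show ?thesis by simp
  qed
  have "emeasure M (g -` b \<inter> S) = (\<integral>\<^sup>+x\<in>S. emeasure (K x) b \<partial>M)" if S: "S \<in> sets F" and b: "b \<in> sets borel" for S b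
  proof -
    have [measurable]: "S \<in> sets M" using S setsF by auto
    \<comment> \<open>both sides are finite Borel measures in \<open>b\<close>, and half lines determine them\<close>
    let ?D = "density M (indicator S)"
    have 1: "emeasure (distr ?D borel g) c = emeasure M (g -` c \<inter> S)" if "c \<in> sets borel" for c
    proof -
      have [measurable]: "c \<in> sets borel" by fact
      have "emeasure (distr ?D borel g) c = (\<integral>\<^sup>+x. indicator S x * indicator (g -` c \<inter> space M) x \<partial>M)"
        by (simp add: emeasure_distr emeasure_density)
      also have "\<dots> = (\<integral>\<^sup>+x. indicator ((g -` c \<inter> space M) \<inter> S) x \<partial>M)"
        by (intro nn_integral_cong) (auto simp: indicator_def)
      also have "\<dots> = emeasure M ((g -` c \<inter> space M) \<inter> S)" by (rule nn_integral_indicator) measurable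
      also have "(g -` c \<inter> space M) \<inter> S = g -` c \<inter> S"
        using sets.sets_into_space[OF \<open>S \<in> sets M\<close>] by auto
      finally show ?thesis .
    qed
    have 2: "emeasure (bind ?D K) c = (\<integral>\<^sup>+x\<in>S. emeasure (K x) c \<partial>M)" if "c \<in> sets borel" for c
    proof -
      have [measurable]: "c \<in> sets borel" "K \<in> measurable M (subprob_algebra borel)" by fact+
      have "emeasure (bind ?D K) c = (\<integral>\<^sup>+x. emeasure (K x) c \<partial>?D)"
        by (rule emeasure_bind[where N=borel]) (use that not_empty in auto)
      then show ?thesis by (simp add: nn_integral_density mult.commute)
    qed
    have "distr ?D borel g = bind ?D K"
    proof (rule measure_eqI_generator_eq[where E="range atMost" and \<Omega>=UNIV and A="\<lambda>n. {..real n}"])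
      show "emeasure (distr ?D borel g) X = emeasure (bind ?D K) X" if "X \<in> range atMost" for X
        using that 1 2 Iic[OF S] by auto
      show "sets (bind ?D K) = sigma_sets UNIV (range atMost)"
        using sets_bind[of ?D K borel] not_empty borel_gen by (auto simp: K_def)
      show "(\<Union>i. {..real i}) = UNIV" using real_arch_simple by auto
      show "emeasure (distr ?D borel g) {..real i} \<noteq> \<infinity>" for i
        by (simp add: 1)
    qed (use Int_st borel_gen in auto)
    then show ?thesis using 1 2 b by simp
  qed
  with K show thesis by (rule that)
qed

section \<open>A Borel model of a Lebesgue space\<close>

text \<open>A Lebesgue set is a Borel set up to a subset of a Borel null set, so it stays measurable for the
  completion of any distribution for which Lebesgue null Borel sets are null.\<close>

lemma completion_of_distr_lebesgue:
  assumes g: "g \<in> borel_measurable M"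
    and null: "\<And>n. n \<in> null_sets lborel \<Longrightarrow> n \<subseteq> {0..c} \<Longrightarrow> g -` n \<inter> space M \<in> null_sets M"
    and L: "L \<in> sets lebesgue" "L \<subseteq> {0..c::real}"
  shows "L \<in> sets (completion (distr M borel g))"
proof -
  obtain S n n' where L_eq: "L = S \<union> n" and n: "n \<subseteq> n'" "n' \<in> null_sets lborel" and S: "S \<in> sets lborel"
    using L(1) by (elim sets_completionE)
  have "n' \<inter> {0..c} \<in> null_sets lborel"
    by (rule null_sets_subset[OF n(2)]) (use n(2) in auto)
  then have "g -` (n' \<inter> {0..c}) \<inter> space M \<in> null_sets M" by (rule null) auto
  then have "n' \<inter> {0..c} \<in> null_sets (distr M borel g)"
    using n(2) g by (auto simp: null_sets_distr_iff)
  then show ?thesis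
    by (intro sets_completionI[OF L_eq, of "n' \<inter> {0..c}"]) (use L_eq n L S in auto)
qed

lemma sets_restrict_space_twice:
  assumes "\<Omega> \<in> sets M" "Y \<in> sets (restrict_space M \<Omega>)"
  shows "A \<in> sets (restrict_space (restrict_space M \<Omega>) Y) \<longleftrightarrow> A \<subseteq> Y \<and> A \<in> sets M"
proof -
  have "\<Omega> \<inter> space M \<in> sets M" "Y \<inter> space (restrict_space M \<Omega>) \<in> sets (restrict_space M \<Omega>)"
    by (simp_all only: sets.Int_space_eq2 assms)
  moreover have "Y \<subseteq> \<Omega>" using assms(2) by (auto simp: sets_restrict_space)
  ultimately show ?thesis by (auto simp: sets_restrict_space_iff)
qed

text \<open>Mod 0, a Lebesgue space is a Borel probability measure on the line together with its completion:
  \<open>g\<close> codes points by reals, and \<open>j\<close> decodes them. It is important that \<open>j\<close> is defined on the whole line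
  and pulls every measurable set of \<open>M\<close> back to a measurable set for the completed distribution; for a
  merely injective \<open>g\<close> with nonmeasurable range this, and the existence of conditional measures,
  may fail.\<close>

lemma lebesgue_prob_space_model:
  fixes M :: "'a measure"
  assumes "lebesgue_prob_space M"
  obtains g :: "'a \<Rightarrow> real" and j :: "real \<Rightarrow> 'a" where
    "g \<in> borel_measurable M" "\<And>x. x \<in> space M \<Longrightarrow> - 1 \<le> g x \<and> g x \<le> 2"
    "\<And>r. j r \<in> space M" "AE x in M. j (g x) = x"
    "\<And>A. A \<in> sets M \<Longrightarrow> j -` A \<in> sets (completion (distr M borel g))"
proof -
  interpret prob_space M using assms by (simp add: lebesgue_prob_space_def)
  obtain D where D: "countable D" "D \<subseteq> space M" "\<And>x. x \<in> D \<Longrightarrow> {x} \<in> sets M"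
    and iso: "isomorphic_mod0 (restrict_space M (space M - D)) (lebesgue_on {0..prob (space M - D)})"
    using assms unfolding lebesgue_prob_space_def by blast
  define c where "c = prob (space M - D)"
  let ?R = "restrict_space M (space M - D)" and ?N = "lebesgue_on {0..c}"
  obtain X Y f where X: "X \<in> sets ?R" "space ?R - X \<in> null_sets ?R" and Y: "Y \<in> sets ?N"
    and bij: "bij_betw f X Y"
    and f: "f \<in> measurable (restrict_space ?R X) (restrict_space ?N Y)"
    and fi: "the_inv_into X f \<in> measurable (restrict_space ?N Y) (restrict_space ?R X)"
    and mp: "\<And>A. A \<in> sets ?N \<Longrightarrow> A \<subseteq> Y \<Longrightarrow> emeasure ?R (f -` A \<inter> X) = emeasure ?N A"
    using iso unfolding isomorphic_mod0_def c_def by blast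
  have Dm: "A \<in> sets M" if "A \<subseteq> D" for A
  proof -
    have "countable A" using that D(1) by (rule countable_subset)
    moreover have "{a} \<in> sets M" if "a \<in> A" for a using that \<open>A \<subseteq> D\<close> by (auto intro: D(3))
    ultimately show ?thesis by (rule sets.countable[rotated]) auto
  qed
  have MD: "space M - D \<in> sets M" using Dm by auto
  have Xs: "X \<in> sets M" "X \<inter> D = {}" "X \<subseteq> space M"
    using X(1) MD sets.sets_into_space by (auto simp: sets_restrict_space_iff)
  have Icc: "{0..c} \<in> sets lebesgue" by simp
  note RX = sets_restrict_space_twice[OF MD X(1)]
  note NY = sets_restrict_space_twice[OF Icc Y]
  have Xnull: "space M - D - X \<in> null_sets M"
    using X(2) MD sets.sets_into_space by (auto simp: null_sets_restrict_space space_restrict_space Int_absorb1)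
  have Yc: "Y \<subseteq> {0..c}" "Y \<in> sets lebesgue" using Y by (auto simp: sets_restrict_space_iff)
  have c: "0 \<le> c" "c \<le> 1" by (auto simp: c_def)
  \<comment> \<open>the atoms are coded injectively in \<open>]1, 2]\<close>, away from the interval \<open>[0, c]\<close> that codes the rest\<close>
  define v where "v d = 1 + 1 / (1 + real (to_nat_on D d))" for d
  have v: "1 < v d" "v d \<le> 2" for d by (auto simp: v_def field_simps)
  have v_inj: "inj_on v D"
    using inj_on_to_nat_on[OF D(1)] by (auto simp: inj_on_def v_def)
  have fY: "f x \<in> Y" if "x \<in> X" for x using bij that by (auto simp: bij_betw_def)
  define g where "g x = (if x \<in> X then f x else if x \<in> D then v x else - 1)" for x
  obtain x0 where x0: "x0 \<in> space M" using not_empty by auto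
  define j where "j r = (if r \<in> Y then the_inv_into X f r else if r \<in> v ` D then the_inv_into D v r else x0)" for r
  have finv: "the_inv_into X f r \<in> X" if "r \<in> Y" for r
    using the_inv_into_into[OF bij_betw_imp_inj_on[OF bij], of r X] bij that by (auto simp: bij_betw_def)
  have vinv: "the_inv_into D v r \<in> D" if "r \<in> v ` D" for r
    using the_inv_into_into[OF v_inj that] by simp
  have YvD: "r \<notin> v ` D" if "r \<in> Y" for r
  proof
    assume "r \<in> v ` D"
    then obtain d where "r = v d" by blast
    moreover have "r \<in> {0..c}" using that Yc(1) by blast
    ultimately show False using v(1)[of d] c by simp
  qed
  have g: "g \<in> borel_measurable M"
  proof (rule measurableI)
    fix B :: "real set" assume B: "B \<in> sets borel"
    have "B \<inter> Y \<in> sets (restrict_space ?N Y)"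
      using sets_completionI_sets[of B lborel] B Yc(2) by (auto simp: NY)
    then have "f -` (B \<inter> Y) \<inter> space (restrict_space ?R X) \<in> sets (restrict_space ?R X)"
      by (rule measurable_sets[OF f])
    then have "f -` (B \<inter> Y) \<inter> space (restrict_space ?R X) \<in> sets M" by (simp only: RX)
    also have "f -` (B \<inter> Y) \<inter> space (restrict_space ?R X) = f -` B \<inter> X"
      using Xs fY by (auto simp: space_restrict_space)
    finally have 1: "f -` B \<inter> X \<in> sets M" .
    have "g -` B \<inter> space M = (f -` B \<inter> X) \<union> {d \<in> D. v d \<in> B} \<union> (if - 1 \<in> B then space M - X - D else {})"
      using Xs D by (auto simp: g_def split: if_splits)
    also have "\<dots> \<in> sets M" using 1 Dm Xs by auto
    finally show "g -` B \<inter> space M \<in> sets M" .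
  qed simp
  have null: "g -` n \<inter> space M \<in> null_sets M" if n: "n \<in> null_sets lborel" "n \<subseteq> {0..c}" for n
  proof -
    have nY: "n \<inter> Y \<in> sets ?N" "n \<inter> Y \<subseteq> Y" using n Yc by (auto simp: sets_restrict_space_iff)
    have "n \<inter> Y \<in> null_sets lebesgue"
      by (rule null_sets_subset[OF null_sets_completionI[OF n(1)]]) (use n Yc in auto)
    then have "emeasure ?N (n \<inter> Y) = 0"
      using nY Yc by (subst emeasure_restrict_space) auto
    then have "emeasure ?R (f -` (n \<inter> Y) \<inter> X) = 0" using mp[OF nY] by simp
    moreover have "g -` n \<inter> space M = f -` (n \<inter> Y) \<inter> X"
    proof -
      have "v d \<notin> n" "- 1 \<notin> n" for d using n(2) v[of d] c by auto
      then show ?thesis using Xs fY by (auto simp: g_def split: if_splits)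
    qed
    moreover have "f -` (n \<inter> Y) \<inter> X \<subseteq> space M - D" using Xs by auto
    ultimately have "emeasure M (g -` n \<inter> space M) = 0"
      using MD by (subst (asm) emeasure_restrict_space) auto
    moreover have "g -` n \<inter> space M \<in> sets M" using n g by (auto intro: measurable_sets)
    ultimately show ?thesis by auto
  qed
  show thesis
  proof
    show "g \<in> borel_measurable M" by fact
    show "- 1 \<le> g x \<and> g x \<le> 2" if "x \<in> space M" for x
      using fY[of x] Yc(1) c v[of x] by (auto simp: g_def)
    show "j r \<in> space M" for r
      using finv[of r] vinv[of r] Xs D x0 by (auto simp: j_def)
    show "AE x in M. j (g x) = x"
    proof (rule AE_I'[OF Xnull], clarify)
      fix x assume x: "x \<in> space M" "j (g x) \<noteq> x"
      have "j (g x) = x" if "x \<in> X"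
        using that fY the_inv_into_f_f[OF bij_betw_imp_inj_on[OF bij]] by (simp add: g_def j_def)
      moreover have "j (g x) = x" if "x \<in> D"
      proof -
        have "v x \<notin> Y" using YvD[of "v x"] that by auto
        then show ?thesis using that Xs the_inv_into_f_f[OF v_inj] by (auto simp: g_def j_def)
      qed
      ultimately show "x \<in> space M - D - X" using x by auto
    qed
    show "j -` A \<in> sets (completion (distr M borel g))" if A: "A \<in> sets M" for A
    proof -
      let ?C = "sets (completion (distr M borel g))"
      have leb: "L \<in> ?C" if "L \<in> sets lebesgue" "L \<subseteq> {0..c}" for L
        using completion_of_distr_lebesgue[OF g null that] .
      have "A \<inter> X \<in> sets (restrict_space ?R X)" using A Xs by (simp add: RX)
      then have "the_inv_into X f -` (A \<inter> X) \<inter> space (restrict_space ?N Y) \<in> sets (restrict_space ?N Y)"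
        by (rule measurable_sets[OF fi])
      also have "the_inv_into X f -` (A \<inter> X) \<inter> space (restrict_space ?N Y) = the_inv_into X f -` A \<inter> Y"
        using finv Yc by (auto simp: space_restrict_space)
      finally have "the_inv_into X f -` A \<inter> Y \<in> sets lebesgue"
        by (simp only: NY)
      then have 1: "the_inv_into X f -` A \<inter> Y \<in> ?C" using leb Yc by blast
      have 2: "Y \<in> ?C" using leb Yc by blast
      have cnt: "v ` E \<in> ?C" if "E \<subseteq> D" for E
      proof -
        have "countable (v ` E)" using countable_subset[OF that D(1)] by simp
        then have "v ` E \<in> sets borel" by (rule sets.countable[rotated]) auto
        then show ?thesis by (intro sets_completionI_sets) simp
      qed
      have UN: "UNIV \<in> ?C" using sets.top[of "completion (distr M borel g)"] by simp
      have "j -` A = (the_inv_into X f -` A \<inter> Y) \<union> v ` (D \<inter> A) \<union> (if x0 \<in> A then UNIV - Y - v ` D else {})"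
      proof (rule set_eqI)
        fix r
        have "the_inv_into D v r \<in> A \<longleftrightarrow> r \<in> v ` (D \<inter> A)" if "r \<in> v ` D"
          using that the_inv_into_f_f[OF v_inj] inj_onD[OF v_inj] by auto
        moreover have "v ` (D \<inter> A) \<subseteq> v ` D" by auto
        ultimately show "r \<in> j -` A \<longleftrightarrow> r \<in> (the_inv_into X f -` A \<inter> Y) \<union> v ` (D \<inter> A) \<union> (if x0 \<in> A then UNIV - Y - v ` D else {})"
          using YvD[of r] by (auto simp: j_def)
      qed
      also have "\<dots> \<in> ?C"
      proof (intro sets.Un 1)
        have "UNIV - Y - v ` D \<in> ?C" using UN 2 cnt[OF order_refl] by (intro sets.Diff)
        then show "(if x0 \<in> A then UNIV - Y - v ` D else {}) \<in> ?C" by (cases "x0 \<in> A") simp_all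
      qed (rule cnt, blast)
      finally show ?thesis .
    qed
  qed
qed

section \<open>Conditional measures\<close>

definition saturated :: "'a measure \<Rightarrow> 'a set set \<Rightarrow> 'a set set" where
  "saturated M \<beta> = {S \<in> sets M. \<forall>C\<in>\<beta>. C \<subseteq> S \<or> C \<inter> S = {}}"

text \<open>Separation is required of points rather than of elements: outside the null set \<open>N\<close>, two points that
  no member of \<open>B\<close> distinguishes lie in the same element. In this form the property is stable under
  countable joins, with the unions of the sets \<open>N\<close> and \<open>B\<close>.\<close>

definition generates :: "'a measure \<Rightarrow> 'a set set \<Rightarrow> 'a set set \<Rightarrow> bool" where
  "generates M \<beta> F \<longleftrightarrow> partition_on (space M) \<beta> \<and> F \<subseteq> saturated M \<beta> \<and>
     (\<exists>N\<in>null_sets M. \<exists>B. countable B \<and> B \<subseteq> F \<and>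
        (\<forall>x\<in>space M - N. \<forall>y\<in>space M - N. (\<forall>S\<in>B. x \<in> S \<longleftrightarrow> y \<in> S) \<longrightarrow> part_of \<beta> x = part_of \<beta> y))"

lemma part_of_eq:
  assumes "partition_on A \<beta>" "C \<in> \<beta>" "x \<in> C"
  shows "part_of \<beta> x = C"
  unfolding part_of_def
proof (rule the_equality)
  show "C' = C" if "C' \<in> \<beta> \<and> x \<in> C'" for C'
    using partition_onD2[OF assms(1)] assms(2,3) that by (auto simp: disjoint_def)
qed (use assms in auto)

lemma part_of_in:
  assumes "partition_on A \<beta>" "x \<in> A"
  shows "part_of \<beta> x \<in> \<beta>" "x \<in> part_of \<beta> x"
proof -
  obtain C where "C \<in> \<beta>" "x \<in> C" using partition_onD1[OF assms(1)] assms(2) by auto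
  then show "part_of \<beta> x \<in> \<beta>" "x \<in> part_of \<beta> x" using part_of_eq[OF assms(1)] by auto
qed

lemma part_of_subset: "partition_on A \<beta> \<Longrightarrow> x \<in> A \<Longrightarrow> part_of \<beta> x \<subseteq> A"
  using part_of_in(1) partition_onD1 by fastforce

lemma saturated_part_of:
  assumes "partition_on (space M) \<beta>" "S \<in> saturated M \<beta>" "x \<in> space M"
  shows "x \<in> S \<Longrightarrow> part_of \<beta> x \<subseteq> S" "x \<notin> S \<Longrightarrow> part_of \<beta> x \<inter> S = {}"
  using part_of_in[OF assms(1,3)] assms(2) by (auto simp: saturated_def)

lemma sigma_algebra_saturated:
  assumes "partition_on (space M) \<beta>"
  shows "sigma_algebra (space M) (saturated M \<beta>)"
proof -
  have sub: "C \<subseteq> space M" if "C \<in> \<beta>" for C using assms that partition_onD1 by blast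
  have "(\<Union>i. A i) \<in> saturated M \<beta>" if A: "range A \<subseteq> saturated M \<beta>" for A :: "nat \<Rightarrow> 'a set"
  proof -
    have "C \<subseteq> (\<Union>i. A i) \<or> C \<inter> (\<Union>i. A i) = {}" if "C \<in> \<beta>" for C
    proof (cases "\<exists>i. C \<subseteq> A i")
      case False
      then have "C \<inter> A i = {}" for i using A that by (auto simp: saturated_def)
      then show ?thesis by auto
    qed auto
    moreover have "(\<Union>i. A i) \<in> sets M" using A by (auto simp: saturated_def)
    ultimately show ?thesis by (simp add: saturated_def)
  qed
  moreover have "space M - S \<in> saturated M \<beta>" if "S \<in> saturated M \<beta>" for S
  proof -
    have "C \<subseteq> space M - S \<or> C \<inter> (space M - S) = {}" if C: "C \<in> \<beta>" for C
      using \<open>S \<in> saturated M \<beta>\<close> C sub[OF C] by (auto simp: saturated_def)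
    then show ?thesis using that by (auto simp: saturated_def)
  qed
  moreover have "saturated M \<beta> \<subseteq> Pow (space M)" "{} \<in> saturated M \<beta>"
    using sets.sets_into_space by (auto simp: saturated_def)
  ultimately show ?thesis unfolding sigma_algebra_iff2 by simp
qed

lemma (in complete_measure) borel_measurable_AE_cong:
  fixes f h :: "'a \<Rightarrow> 'b::topological_space"
  assumes "f \<in> borel_measurable M" "AE x in M. f x = h x"
  shows "h \<in> borel_measurable M"
proof (rule measurableI)
  fix B :: "'b set" assume "B \<in> sets borel"
  then have m: "f -` B \<inter> space M \<in> sets M" by (rule measurable_sets[OF assms(1)])
  have "AE x in M. x \<in> f -` B \<inter> space M \<longleftrightarrow> x \<in> h -` B \<inter> space M"
    using assms(2) by eventually_elim simp
  from this m show "h -` B \<inter> space M \<in> sets M" by (rule in_sets_AE) auto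
qed simp

text \<open>The completion of \<open>k\<close>, moved to \<open>C\<close> by \<open>j\<close>. The measurable sets are all those whose preimage is
  measurable; with this largest possible \<open>\<sigma>\<close>-algebra the result is complete.\<close>

definition transported :: "real measure \<Rightarrow> (real \<Rightarrow> 'a) \<Rightarrow> 'a set \<Rightarrow> 'a measure" where
  "transported k j C = distr (restrict_space (completion k) (j -` C))
     (sigma C {A. A \<subseteq> C \<and> j -` A \<in> sets (completion k)}) j"

lemma transported:
  assumes k: "prob_space k" "sets k = sets borel" and C: "AE r in completion k. j r \<in> C"
  shows "space (transported k j C) = C"
    and "sets (transported k j C) = {A. A \<subseteq> C \<and> j -` A \<in> sets (completion k)}"
    and "A \<in> sets (transported k j C) \<Longrightarrow> emeasure (transported k j C) A = emeasure (completion k) (j -` A)"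
    and "prob_space (transported k j C)"
    and "complete_measure (transported k j C)"
proof -
  interpret k: prob_space k by fact
  have sp: "space k = UNIV" using sets_eq_imp_space_eq[OF k(2)] by simp
  have jC: "j -` C \<in> sets (completion k)"
  proof -
    have "{r \<in> space (completion k). \<not> j r \<in> C} \<in> null_sets (completion k)"
      using C by (simp only: completion.AE_iff_null_sets)
    then have "UNIV - {r. j r \<notin> C} \<in> sets (completion k)"
      using sp sets.top[of "completion k"] by (intro sets.Diff) auto
    also have "UNIV - {r. j r \<notin> C} = j -` C" by auto
    finally show ?thesis .
  qed
  let ?S = "{A. A \<subseteq> C \<and> j -` A \<in> sets (completion k)}"
  have "sigma_algebra C ?S"
    unfolding sigma_algebra_iff2
  proof (intro conjI allI ballI impI)
    show "C - s \<in> ?S" if "s \<in> ?S" for s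
    proof -
      have "j -` (C - s) = j -` C - j -` s" by auto
      then show ?thesis using that jC by auto
    qed
    show "(\<Union>i. A i) \<in> ?S" if "range A \<subseteq> ?S" for A :: "nat \<Rightarrow> 'a set"
      using that by (auto simp: vimage_UN)
  qed auto
  then have sets_sigma: "sets (sigma C ?S) = ?S"
    by (intro sigma_algebra.sets_measure_of_eq)
  have space_sigma: "space (sigma C ?S) = C" by (rule space_measure_of) auto
  show space: "space (transported k j C) = C" by (simp add: transported_def space_sigma)
  show sets: "sets (transported k j C) = ?S" by (simp add: transported_def sets_sigma)
  have j: "j \<in> measurable (restrict_space (completion k) (j -` C)) (sigma C ?S)"
  proof (rule measurableI)
    show "j -` A \<inter> space (restrict_space (completion k) (j -` C)) \<in> sets (restrict_space (completion k) (j -` C))"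
      if "A \<in> sets (sigma C ?S)" for A
      using that unfolding sets_sigma by (auto simp: sp space_restrict_space sets_restrict_space)
  qed (auto simp: space_sigma space_restrict_space)
  show em: "emeasure (transported k j C) A = emeasure (completion k) (j -` A)"
    if "A \<in> sets (transported k j C)" for A
  proof -
    have A: "A \<subseteq> C" "A \<in> sets (sigma C ?S)" using that sets sets_sigma by auto
    have "emeasure (transported k j C) A
        = emeasure (restrict_space (completion k) (j -` C)) (j -` A \<inter> space (restrict_space (completion k) (j -` C)))"
      unfolding transported_def by (rule emeasure_distr[OF j A(2)])
    also have "j -` A \<inter> space (restrict_space (completion k) (j -` C)) = j -` A"
      using A by (auto simp: sp space_restrict_space)
    also have "emeasure (restrict_space (completion k) (j -` C)) (j -` A) = emeasure (completion k) (j -` A)"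
      by (rule emeasure_restrict_space) (use jC A sp in auto)
    finally show ?thesis .
  qed
  show "prob_space (transported k j C)"
  proof
    have "emeasure (completion k) (j -` C) = 1"
      using prob_space.emeasure_eq_1_AE[OF k.prob_space_completion jC] C by simp
    then show "emeasure (transported k j C) (space (transported k j C)) = 1"
      using em[of C] jC sets by (simp add: space)
  qed
  show "complete_measure (transported k j C)"
  proof
    fix A B assume "B \<subseteq> A" "A \<in> null_sets (transported k j C)"
    then have A: "A \<in> sets (transported k j C)" "emeasure (transported k j C) A = 0" by auto
    then have "A \<subseteq> C" "j -` A \<in> sets (completion k)" unfolding sets by auto
    moreover have "emeasure (completion k) (j -` A) = 0" using em[OF A(1)] A(2) by (simp only:)
    ultimately have "j -` A \<in> null_sets (completion k)" by (intro null_setsI)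
    then have "j -` B \<in> sets (completion k)"
      by (rule completion.complete[rotated]) (use \<open>B \<subseteq> A\<close> in auto)
    then show "B \<in> sets (transported k j C)" unfolding sets using \<open>B \<subseteq> A\<close> \<open>A \<subseteq> C\<close> by simp
  qed
qed

text \<open>Rokhlin's theorem. Let \<open>K\<close> be the conditional distribution of the code \<open>g\<close> given the \<open>\<sigma>\<close>-algebra
  generated by \<open>F\<close>. Members of \<open>F\<close> are unions of elements of \<open>\<beta>\<close>, so \<open>K x\<close> depends only on the
  element that contains \<open>x\<close>. For almost every \<open>x\<close> and every separating set \<open>S\<close>, almost all codes drawn
  from \<open>K x\<close> decode to points on the same side of \<open>S\<close> as \<open>x\<close>, and outside \<open>N\<close>; hence they decode into the
  element of \<open>x\<close>, and \<open>K x\<close> can be moved to a measure on that element.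

  The second conclusion records that the conditional measures of a fixed set form a function of
  \<open>F\<close> alone mod 0. It is what makes \<open>F\<close> generate all measurable unions of elements.\<close>

lemma conditional_measures_exist:
  fixes M :: "'a measure"
  assumes leb: "lebesgue_prob_space M" and gen: "generates M \<beta> F"
  obtains \<kappa> where "conditional_measures M \<beta> \<kappa>"
    and "\<And>A. A \<in> sets M \<Longrightarrow> \<exists>u\<in>borel_measurable (sigma (space M) F).
      AE x in M. emeasure (\<kappa> (part_of \<beta> x)) (A \<inter> part_of \<beta> x) = u x"
proof -
  interpret prob_space M by (rule leb[unfolded lebesgue_prob_space_def, THEN conjunct1])
  interpret complete_measure M
    by (rule leb[unfolded lebesgue_prob_space_def, THEN conjunct2, THEN conjunct1])
  obtain N B where part: "partition_on (space M) \<beta>" and F_sat: "F \<subseteq> saturated M \<beta>"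
    and N: "N \<in> null_sets M" and B: "countable B" "B \<subseteq> F"
    and sep': "\<forall>x\<in>space M - N. \<forall>y\<in>space M - N. (\<forall>S\<in>B. x \<in> S \<longleftrightarrow> y \<in> S) \<longrightarrow> part_of \<beta> x = part_of \<beta> y"
    using gen unfolding generates_def by (elim conjE bexE exE) (rule that)
  have sep: "part_of \<beta> x = part_of \<beta> y"
    if "x \<in> space M - N" "y \<in> space M - N" "\<forall>S\<in>B. x \<in> S \<longleftrightarrow> y \<in> S" for x y
    using sep'[rule_format, OF that(1,2)] that(3) by blast
  obtain g :: "'a \<Rightarrow> real" and j :: "real \<Rightarrow> 'a" where g [measurable]: "g \<in> borel_measurable M"
    and g_bd: "\<And>x. x \<in> space M \<Longrightarrow> - 1 \<le> g x \<and> g x \<le> 2"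
    and j: "\<And>r. j r \<in> space M" "AE x in M. j (g x) = x"
    and j_compl: "\<And>A. A \<in> sets M \<Longrightarrow> j -` A \<in> sets (completion (distr M borel g))"
    using lebesgue_prob_space_model[OF leb] by blast
  let ?F = "sigma (space M) F"
  have "F \<subseteq> sets M" using F_sat by (auto simp: saturated_def)
  then have Fpow: "F \<subseteq> Pow (space M)" using sets.space_closed[of M] by (rule subset_trans)
  have setsF: "sets ?F = sigma_sets (space M) F" by (rule sets_measure_of[OF Fpow])
  have spF: "space ?F = space M" by (rule space_measure_of[OF Fpow])
  have sat: "S \<in> saturated M \<beta>" if "S \<in> sets ?F" for S
    using that sigma_algebra.sigma_sets_subset[OF sigma_algebra_saturated[OF part] F_sat] setsF by auto
  have subF: "sets ?F \<subseteq> sets M" using sat by (auto simp: saturated_def)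
  have subalg: "subalgebra M ?F" using subF spF by (simp add: subalgebra_def)
  obtain K where K: "K \<in> measurable ?F (prob_algebra borel)"
    and K_int: "\<And>S b. S \<in> sets ?F \<Longrightarrow> b \<in> sets borel \<Longrightarrow>
      emeasure M (g -` b \<inter> S) = (\<integral>\<^sup>+x\<in>S. emeasure (K x) b \<partial>M)"
    using regular_conditional_distribution[OF prob_space_axioms subalg g g_bd] by blast
  have K_prob: "prob_space (K x)" "sets (K x) = sets borel" if "x \<in> space M" for x
    using measurable_space[OF K, of x] that spF by (auto simp: space_prob_algebra)
  have K_meas [measurable]: "(\<lambda>x. emeasure (K x) b) \<in> borel_measurable ?F" if "b \<in> sets borel" for b
    using measurable_prob_algebraD[OF K] that by (rule measurable_emeasure_kernel)
  have K_measM [measurable]: "(\<lambda>x. emeasure (K x) b) \<in> borel_measurable M" if "b \<in> sets borel" for b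
    using K_meas[OF that] by (rule measurable_from_subalg[OF subalg])
  have K_const: "K x = K y" if "x \<in> space M" "y \<in> part_of \<beta> x" for x y
  proof (rule measure_eqI)
    have y: "y \<in> space M" using part_of_subset[OF part that(1)] that(2) by auto
    show "sets (K x) = sets (K y)" using K_prob that(1) y by simp
    fix b assume "b \<in> sets (K x)"
    then have "b \<in> sets borel" using K_prob that(1) by simp
    then have "(\<lambda>z. emeasure (K z) b) -` {emeasure (K x) b} \<inter> space ?F \<in> sets ?F"
      by (intro measurable_sets[OF K_meas]) auto
    from saturated_part_of(1)[OF part sat[OF this] that(1)] that
    show "emeasure (K x) b = emeasure (K y) b" by (auto simp: spF)
  qed
  define k where "k x = completion (K x)" for x
  \<comment> \<open>\<open>K\<close> disintegrates \<open>M\<close>, not only the distribution of \<open>g\<close>: the preimage of \<open>A\<close> under \<open>j\<close> is Borel up to a null set\<close>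
  have dis: "\<exists>b\<in>sets borel. (AE x in M. j -` A \<in> sets (k x) \<and> emeasure (k x) (j -` A) = emeasure (K x) b) \<and>
      (\<forall>S\<in>sets ?F. emeasure M (A \<inter> S) = (\<integral>\<^sup>+x\<in>S. emeasure (K x) b \<partial>M))" if A: "A \<in> sets M" for A
  proof -
    obtain b n z where b: "j -` A = b \<union> n" and nz: "n \<subseteq> z" "z \<in> null_sets (distr M borel g)" and "b \<in> sets (distr M borel g)"
      using j_compl[OF A] by (elim sets_completionE)
    then have [measurable]: "b \<in> sets borel" "z \<in> sets borel" by auto
    have gz: "g -` z \<inter> space M \<in> null_sets M" using nz(2) by (auto simp: null_sets_distr_iff)
    have "(\<integral>\<^sup>+x. emeasure (K x) z \<partial>M) = (\<integral>\<^sup>+x\<in>space M. emeasure (K x) z \<partial>M)"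
      by (intro nn_integral_cong) auto
    also have "\<dots> = emeasure M (g -` z \<inter> space M)"
      using sets.top[of ?F] spF by (intro K_int[symmetric]) auto
    also have "\<dots> = 0" using gz by (rule null_setsD1)
    finally have "AE x in M. emeasure (K x) z = 0"
      by (subst (asm) nn_integral_0_iff_AE) auto
    then have "AE x in M. j -` A \<in> sets (k x) \<and> emeasure (k x) (j -` A) = emeasure (K x) b"
      using AE_space
    proof eventually_elim
      fix x assume x: "emeasure (K x) z = 0" "x \<in> space M"
      then have "z \<in> null_sets (completion (K x))"
        using K_prob by (intro null_sets_completionI) auto
      then have "n \<in> null_sets (k x)"
        unfolding k_def by (rule null_sets_completion_subset[OF nz(1)])
      moreover have "b \<in> sets (K x)" using K_prob x by simp
      ultimately show "j -` A \<in> sets (k x) \<and> emeasure (k x) (j -` A) = emeasure (K x) b"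
        unfolding b by (auto simp: emeasure_Un_null_set k_def)
    qed
    moreover have "emeasure M (A \<inter> S) = (\<integral>\<^sup>+x\<in>S. emeasure (K x) b \<partial>M)" if S: "S \<in> sets ?F" for S
    proof -
      have SM: "S \<in> sets M" "S \<subseteq> space M" using S subF sets.sets_into_space by auto
      have "AE x in M. x \<in> A \<inter> S \<longleftrightarrow> x \<in> (g -` b \<inter> space M) \<inter> S"
        using j(2) AE_not_in[OF gz] AE_space
      proof eventually_elim
        fix x assume x: "j (g x) = x" "x \<notin> g -` z \<inter> space M" "x \<in> space M"
        have "x \<in> A \<longleftrightarrow> g x \<in> j -` A" using x by simp
        also have "\<dots> \<longleftrightarrow> g x \<in> b" using b nz x by auto
        finally show "x \<in> A \<inter> S \<longleftrightarrow> x \<in> (g -` b \<inter> space M) \<inter> S" using x by auto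
      qed
      then have "emeasure M (A \<inter> S) = emeasure M ((g -` b \<inter> space M) \<inter> S)"
        by (rule emeasure_eq_AE) (use A SM in auto)
      also have "(g -` b \<inter> space M) \<inter> S = g -` b \<inter> S" using SM by auto
      finally show ?thesis using K_int[OF S, of b] by simp
    qed
    ultimately show ?thesis using \<open>b \<in> sets borel\<close> by blast
  qed
  \<comment> \<open>applied to \<open>S\<close> and to its complement, this puts almost all of \<open>k x\<close> on the side of \<open>x\<close>\<close>
  have nul: "AE x in M. x \<notin> S \<longrightarrow> emeasure (k x) (j -` S) = 0" if S: "S \<in> sets ?F" for S
  proof -
    have SM: "S \<in> sets M" using S subF by auto
    obtain b where b: "b \<in> sets borel" "AE x in M. j -` S \<in> sets (k x) \<and> emeasure (k x) (j -` S) = emeasure (K x) b"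
      "\<And>S'. S' \<in> sets ?F \<Longrightarrow> emeasure M (S \<inter> S') = (\<integral>\<^sup>+x\<in>S'. emeasure (K x) b \<partial>M)"
      using dis[OF SM] by blast
    have "space M - S \<in> sets ?F" using S sets.compl_sets[of S ?F] spF by simp
    then have "(\<integral>\<^sup>+x\<in>space M - S. emeasure (K x) b \<partial>M) = emeasure M (S \<inter> (space M - S))"
      by (rule b(3)[symmetric])
    also have "\<dots> = 0" by simp
    finally have "AE x in M. emeasure (K x) b * indicator (space M - S) x = 0"
      using b(1) SM by (subst (asm) nn_integral_0_iff_AE) auto
    with b(2) AE_space show ?thesis by eventually_elim (auto simp: indicator_def split: if_splits)
  qed
  have N0: "AE x in M. emeasure (k x) (j -` N) = 0"
  proof -
    obtain b where b: "b \<in> sets borel" "AE x in M. j -` N \<in> sets (k x) \<and> emeasure (k x) (j -` N) = emeasure (K x) b"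
      "\<And>S'. S' \<in> sets ?F \<Longrightarrow> emeasure M (N \<inter> S') = (\<integral>\<^sup>+x\<in>S'. emeasure (K x) b \<partial>M)"
      using dis[of N] N by blast
    have "emeasure M (N \<inter> space M) = 0" using N sets.sets_into_space[of N M] by (auto simp: Int_absorb2)
    then have "(\<integral>\<^sup>+x\<in>space M. emeasure (K x) b \<partial>M) = 0"
      using b(3)[of "space M"] sets.top[of ?F] spF by simp
    then have "AE x in M. emeasure (K x) b * indicator (space M) x = 0"
      using b(1) by (subst (asm) nn_integral_0_iff_AE) auto
    with b(2) AE_space show ?thesis by eventually_elim auto
  qed
  have all_sets: "AE x in M. j -` A \<in> sets (k x)" if "A \<in> sets M" for A
    using dis[OF that] by (auto elim: eventually_mono)
  have BF: "S \<in> sets ?F" "space M - S \<in> sets ?F" "S \<in> sets M" "space M - S \<in> sets M" if "S \<in> B" for S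
  proof -
    show 1: "S \<in> sets ?F" using that B setsF by auto
    then show 2: "space M - S \<in> sets ?F" using sets.compl_sets[of S ?F] spF by simp
    show "S \<in> sets M" "space M - S \<in> sets M" using 1 2 subF by auto
  qed
  have "AE x in M. \<forall>S\<in>B. j -` S \<in> sets (k x) \<and> j -` (space M - S) \<in> sets (k x) \<and>
      (x \<notin> S \<longrightarrow> emeasure (k x) (j -` S) = 0) \<and>
      (x \<notin> space M - S \<longrightarrow> emeasure (k x) (j -` (space M - S)) = 0)"
    using BF by (intro AE_ball_countable' B(1) AE_conjI all_sets nul) auto
  then have conc: "AE x in M. AE r in k x. j r \<in> part_of \<beta> x"
    using N0 all_sets[OF null_setsD2[OF N]] AE_not_in[OF N] AE_space
  proof eventually_elim
    fix x assume x: "\<forall>S\<in>B. j -` S \<in> sets (k x) \<and> j -` (space M - S) \<in> sets (k x) \<and>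
      (x \<notin> S \<longrightarrow> emeasure (k x) (j -` S) = 0) \<and>
      (x \<notin> space M - S \<longrightarrow> emeasure (k x) (j -` (space M - S)) = 0)"
      "emeasure (k x) (j -` N) = 0" "j -` N \<in> sets (k x)" "x \<notin> N" "x \<in> space M"
    have "AE r in k x. j r \<in> S \<longleftrightarrow> x \<in> S" if "S \<in> B" for S
    proof (cases "x \<in> S")
      case True
      then have "j -` (space M - S) \<in> null_sets (k x)" using x that by auto
      from AE_not_in[OF this] show ?thesis by eventually_elim (use True j(1) in auto)
    next
      case False
      then have "j -` S \<in> null_sets (k x)" using x that by auto
      from AE_not_in[OF this] show ?thesis by eventually_elim (use False in auto)
    qed
    then have "AE r in k x. \<forall>S\<in>B. j r \<in> S \<longleftrightarrow> x \<in> S" by (intro AE_ball_countable' B(1))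
    moreover have "j -` N \<in> null_sets (k x)" using x by auto
    from AE_not_in[OF this] have "AE r in k x. j r \<notin> N" by eventually_elim auto
    ultimately show "AE r in k x. j r \<in> part_of \<beta> x"
    proof eventually_elim
      fix r assume "\<forall>S\<in>B. j r \<in> S \<longleftrightarrow> x \<in> S" "j r \<notin> N"
      then have "part_of \<beta> x = part_of \<beta> (j r)" using x j(1) by (intro sep) auto
      then show "j r \<in> part_of \<beta> x" using part_of_in(2)[OF part j(1)] by simp
    qed
  qed
  \<comment> \<open>any point of \<open>C\<close> may represent it, as \<open>K\<close> is constant on \<open>C\<close>\<close>
  define \<kappa> where "\<kappa> C = transported (K (SOME x. x \<in> C)) j C" for C
  have \<kappa>: "\<kappa> (part_of \<beta> x) = transported (K x) j (part_of \<beta> x)" if "x \<in> space M" for x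
  proof -
    have "(SOME y. y \<in> part_of \<beta> x) \<in> part_of \<beta> x" using part_of_in(2)[OF part that] by (rule someI)
    then show ?thesis using K_const[OF that] by (simp add: \<kappa>_def)
  qed
  have A_part: "AE x in M. A \<inter> part_of \<beta> x \<in> sets (\<kappa> (part_of \<beta> x)) \<and>
      emeasure (\<kappa> (part_of \<beta> x)) (A \<inter> part_of \<beta> x) = emeasure (k x) (j -` A)" if A: "A \<in> sets M" for A
    using conc all_sets[OF A] AE_space
  proof eventually_elim
    fix x assume x: "AE r in k x. j r \<in> part_of \<beta> x" "j -` A \<in> sets (k x)" "x \<in> space M"
    note tr = transported[OF K_prob[OF x(3)] x(1)[unfolded k_def]]
    have "part_of \<beta> x \<in> sets (transported (K x) j (part_of \<beta> x))"
      using sets.top[of "transported (K x) j (part_of \<beta> x)"] tr(1) by simp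
    then have jp: "j -` part_of \<beta> x \<in> sets (k x)" using tr(2) by (simp add: k_def)
    have eq: "j -` (A \<inter> part_of \<beta> x) = j -` A \<inter> j -` part_of \<beta> x" by auto
    have m: "A \<inter> part_of \<beta> x \<in> sets (transported (K x) j (part_of \<beta> x))"
      using x(2) jp unfolding tr(2) k_def[symmetric] eq by auto
    have "emeasure (k x) (j -` (A \<inter> part_of \<beta> x)) = emeasure (k x) (j -` A)"
      by (rule emeasure_eq_AE) (use x jp eq in \<open>auto elim: eventually_mono\<close>)
    then show "A \<inter> part_of \<beta> x \<in> sets (\<kappa> (part_of \<beta> x)) \<and>
      emeasure (\<kappa> (part_of \<beta> x)) (A \<inter> part_of \<beta> x) = emeasure (k x) (j -` A)"
      using m tr(3)[OF m] \<kappa>[OF x(3)] by (simp add: k_def del: emeasure_completion)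
  qed
  have A_ker: "\<exists>b\<in>sets borel. (AE x in M. emeasure (\<kappa> (part_of \<beta> x)) (A \<inter> part_of \<beta> x) = emeasure (K x) b) \<and>
      emeasure M A = (\<integral>\<^sup>+x. emeasure (K x) b \<partial>M)" if A: "A \<in> sets M" for A
  proof -
    obtain b where b: "b \<in> sets borel" "AE x in M. j -` A \<in> sets (k x) \<and> emeasure (k x) (j -` A) = emeasure (K x) b"
      "\<And>S'. S' \<in> sets ?F \<Longrightarrow> emeasure M (A \<inter> S') = (\<integral>\<^sup>+x\<in>S'. emeasure (K x) b \<partial>M)"
      using dis[OF A] by blast
    have "AE x in M. emeasure (\<kappa> (part_of \<beta> x)) (A \<inter> part_of \<beta> x) = emeasure (K x) b"
      using A_part[OF A] b(2) by eventually_elim simp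
    moreover have "emeasure M A = (\<integral>\<^sup>+x\<in>space M. emeasure (K x) b \<partial>M)"
      using b(3)[of "space M"] sets.top[of ?F] spF A sets.sets_into_space[OF A] by (simp add: Int_absorb2)
    moreover have "\<dots> = (\<integral>\<^sup>+x. emeasure (K x) b \<partial>M)" by (intro nn_integral_cong) auto
    ultimately show ?thesis using b(1) by auto
  qed
  show thesis
  proof
    show "conditional_measures M \<beta> \<kappa>"
      unfolding conditional_measures_def
    proof (intro conjI ballI)
      show "AE x in M. prob_space (\<kappa> (part_of \<beta> x)) \<and> complete_measure (\<kappa> (part_of \<beta> x)) \<and>
          space (\<kappa> (part_of \<beta> x)) = part_of \<beta> x"
        using conc AE_space
      proof eventually_elim
        fix x assume x: "AE r in k x. j r \<in> part_of \<beta> x" "x \<in> space M"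
        show "prob_space (\<kappa> (part_of \<beta> x)) \<and> complete_measure (\<kappa> (part_of \<beta> x)) \<and>
          space (\<kappa> (part_of \<beta> x)) = part_of \<beta> x"
          using transported(1,4,5)[OF K_prob[OF x(2)] x(1)[unfolded k_def]] \<kappa>[OF x(2)] by simp
      qed
      fix A assume A: "A \<in> sets M"
      show "AE x in M. A \<inter> part_of \<beta> x \<in> sets (\<kappa> (part_of \<beta> x))"
        using A_part[OF A] by eventually_elim simp
      obtain b where b: "b \<in> sets borel" "AE x in M. emeasure (\<kappa> (part_of \<beta> x)) (A \<inter> part_of \<beta> x) = emeasure (K x) b"
        "emeasure M A = (\<integral>\<^sup>+x. emeasure (K x) b \<partial>M)" using A_ker[OF A] by blast
      show "(\<lambda>x. emeasure (\<kappa> (part_of \<beta> x)) (A \<inter> part_of \<beta> x)) \<in> borel_measurable M"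
        by (rule borel_measurable_AE_cong[OF K_measM[OF b(1)]]) (use b(2) in \<open>auto elim: eventually_mono\<close>)
      show "emeasure M A = (\<integral>\<^sup>+x. emeasure (\<kappa> (part_of \<beta> x)) (A \<inter> part_of \<beta> x) \<partial>M)"
        unfolding b(3) by (rule nn_integral_cong_AE) (use b(2) in \<open>auto elim: eventually_mono\<close>)
    qed
    show "\<exists>u\<in>borel_measurable ?F. AE x in M. emeasure (\<kappa> (part_of \<beta> x)) (A \<inter> part_of \<beta> x) = u x"
      if A: "A \<in> sets M" for A
    proof -
      obtain b where b: "b \<in> sets borel" "AE x in M. emeasure (\<kappa> (part_of \<beta> x)) (A \<inter> part_of \<beta> x) = emeasure (K x) b"
        using A_ker[OF A] by blast
      show ?thesis by (rule bexI[of _ "\<lambda>x. emeasure (K x) b"]) (use b K_meas[OF b(1)] in simp_all)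
    qed
  qed
qed

section \<open>Conditional entropy of partitions\<close>

lemma neg_log_antimono: "0 \<le> p \<Longrightarrow> p \<le> q \<Longrightarrow> q \<le> 1 \<Longrightarrow> neg_log q \<le> neg_log p"
  by (auto simp: neg_log_def intro!: ennreal_leI)

text \<open>Continuity of \<open>- log\<close> along decreasing sequences, including the limit \<open>0\<close>, where the value is
  \<open>\<infinity>\<close>.\<close>

lemma neg_log_SUP:
  assumes "decseq p" "p \<longlonglongrightarrow> l" and p: "\<And>n. 0 \<le> p n" "\<And>n. p n \<le> (1::real)"
  shows "(SUP n. neg_log (p n)) = neg_log l"
proof (rule antisym)
  have l: "0 \<le> l" "\<And>n. l \<le> p n"
    using p LIMSEQ_le_const[OF assms(2)] decseq_ge[OF assms(1,2)] by blast+
  show "(SUP n. neg_log (p n)) \<le> neg_log l"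
    by (intro SUP_least neg_log_antimono l p)
  show "neg_log l \<le> (SUP n. neg_log (p n))"
  proof (cases "l = 0")
    case True
    have "(SUP n. neg_log (p n)) = top"
    proof (rule ennreal_SUP_eq_top)
      fix m :: nat
      have "\<forall>\<^sub>F n in sequentially. p n < exp (- real m)"
        using order_tendstoD(2)[OF assms(2)] True by simp
      then obtain n where n: "p n < exp (- real m)" by (auto simp: eventually_sequentially)
      have "of_nat m \<le> neg_log (p n)"
      proof (cases "p n = 0")
        case False
        then have "0 < p n" using p(1)[of n] by simp
        then have "ln (p n) < ln (exp (- real m))" using n by (subst ln_less_cancel_iff) auto
        then have "real m \<le> - ln (p n)" by simp
        then show ?thesis using False by (simp add: neg_log_def ennreal_of_nat_eq_real_of_nat ennreal_leI)
      qed (simp add: neg_log_def)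
      then show "\<exists>n\<in>UNIV. of_nat m \<le> neg_log (p n)" by blast
    qed
    then show ?thesis by (simp only: top_greatest)
  next
    case False
    then have pos: "0 < p n" for n using l(1) l(2)[of n] by linarith
    have "(\<lambda>n. ennreal (- ln (p n))) \<longlonglongrightarrow> ennreal (- ln l)"
      using False by (intro tendsto_ennrealI tendsto_intros assms(2))
    moreover have "ennreal (- ln (p n)) \<le> (SUP n. neg_log (p n))" for n
      using pos[of n] by (intro SUP_upper2[of n]) (auto simp: neg_log_def)
    ultimately have "ennreal (- ln l) \<le> (SUP n. neg_log (p n))"
      by (intro LIMSEQ_le_const2) auto
    then show ?thesis using False by (simp add: neg_log_def)
  qed
qed

lemma measurable_neg_log [measurable]: "neg_log \<in> borel_measurable borel"
  unfolding neg_log_def by measurable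

definition cond_weight :: "('a set \<Rightarrow> 'a measure) \<Rightarrow> 'a set set \<Rightarrow> 'a set \<Rightarrow> 'a \<Rightarrow> real" where
  "cond_weight \<kappa> \<beta> A x = measure (\<kappa> (part_of \<beta> x)) (A \<inter> part_of \<beta> x)"

lemma subalgebra_saturated:
  assumes "partition_on (space M) \<beta>"
  shows "subalgebra M (sigma (space M) (saturated M \<beta>))"
    and "sets (sigma (space M) (saturated M \<beta>)) = saturated M \<beta>"
proof -
  have "saturated M \<beta> \<subseteq> Pow (space M)"
    using sets.space_closed[of M] by (auto simp: saturated_def)
  then show *: "sets (sigma (space M) (saturated M \<beta>)) = saturated M \<beta>"
    using sigma_algebra.sets_measure_of_eq[OF sigma_algebra_saturated[OF assms]] by simp
  show "subalgebra M (sigma (space M) (saturated M \<beta>))"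
    unfolding subalgebra_def * by (auto simp: saturated_def space_measure_of_conv)
qed

context
  fixes M :: "'a measure" and \<beta> :: "'a set set" and \<kappa> :: "'a set \<Rightarrow> 'a measure"
  assumes prob: "prob_space M" and part: "partition_on (space M) \<beta>"
    and \<kappa>: "conditional_measures M \<beta> \<kappa>"
begin

lemma AE_fibre_space:
  "AE x in M. prob_space (\<kappa> (part_of \<beta> x)) \<and> complete_measure (\<kappa> (part_of \<beta> x)) \<and>
     space (\<kappa> (part_of \<beta> x)) = part_of \<beta> x"
  using \<kappa> unfolding conditional_measures_def by (rule conjunct1)

lemma conditional_measuresD:
  assumes "A \<in> sets M"
  shows "AE x in M. A \<inter> part_of \<beta> x \<in> sets (\<kappa> (part_of \<beta> x))"
    and "(\<lambda>x. emeasure (\<kappa> (part_of \<beta> x)) (A \<inter> part_of \<beta> x)) \<in> borel_measurable M"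
    and "emeasure M A = (\<integral>\<^sup>+x. emeasure (\<kappa> (part_of \<beta> x)) (A \<inter> part_of \<beta> x) \<partial>M)"
  using \<kappa>[unfolded conditional_measures_def, THEN conjunct2, rule_format, OF assms] by blast+

text \<open>The weight is constant on the elements of \<open>\<beta>\<close>, so its level sets are unions of elements.\<close>

lemma cond_weight_measurable:
  assumes A: "A \<in> sets M"
  shows "cond_weight \<kappa> \<beta> A \<in> borel_measurable (sigma (space M) (saturated M \<beta>))"
proof (rule measurableI)
  have m: "cond_weight \<kappa> \<beta> A \<in> borel_measurable M"
    using conditional_measuresD(2)[OF A] unfolding cond_weight_def measure_def by measurable
  fix B :: "real set" assume "B \<in> sets borel"
  then have "cond_weight \<kappa> \<beta> A -` B \<inter> space M \<in> sets M" by (rule measurable_sets[OF m])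
  moreover have "C \<subseteq> cond_weight \<kappa> \<beta> A -` B \<inter> space M \<or> C \<inter> (cond_weight \<kappa> \<beta> A -` B \<inter> space M) = {}"
    if C: "C \<in> \<beta>" for C
  proof -
    have sp: "C \<subseteq> space M" using partition_onD1[OF part] C by blast
    have "cond_weight \<kappa> \<beta> A x = measure (\<kappa> C) (A \<inter> C)" if "x \<in> C" for x
      using part_of_eq[OF part C that] by (simp add: cond_weight_def)
    then show ?thesis using sp by (cases "measure (\<kappa> C) (A \<inter> C) \<in> B") auto
  qed
  ultimately show "cond_weight \<kappa> \<beta> A -` B \<inter> space (sigma (space M) (saturated M \<beta>))
      \<in> sets (sigma (space M) (saturated M \<beta>))"
    unfolding subalgebra_saturated(2)[OF part] by (simp add: saturated_def space_measure_of_conv)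
qed simp

lemma emeasure_eq_integral_cond_weight:
  assumes A: "A \<in> sets M" and Q: "Q \<in> saturated M \<beta>"
  shows "emeasure M (A \<inter> Q) = (\<integral>\<^sup>+x\<in>Q. ennreal (cond_weight \<kappa> \<beta> A x) \<partial>M)"
proof -
  have "A \<inter> Q \<in> sets M" using A Q by (auto simp: saturated_def)
  then have "emeasure M (A \<inter> Q) = (\<integral>\<^sup>+x. emeasure (\<kappa> (part_of \<beta> x)) ((A \<inter> Q) \<inter> part_of \<beta> x) \<partial>M)"
    by (rule conditional_measuresD(3))
  also have "\<dots> = (\<integral>\<^sup>+x\<in>Q. ennreal (cond_weight \<kappa> \<beta> A x) \<partial>M)"
  proof (rule nn_integral_cong_AE)
    show "AE x in M. emeasure (\<kappa> (part_of \<beta> x)) (A \<inter> Q \<inter> part_of \<beta> x) = ennreal (cond_weight \<kappa> \<beta> A x) * indicator Q x"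
      using AE_fibre_space AE_space
    proof eventually_elim
      fix x assume x: "prob_space (\<kappa> (part_of \<beta> x)) \<and> complete_measure (\<kappa> (part_of \<beta> x)) \<and>
        space (\<kappa> (part_of \<beta> x)) = part_of \<beta> x" "x \<in> space M"
      then interpret k: prob_space "\<kappa> (part_of \<beta> x)" by simp
      show "emeasure (\<kappa> (part_of \<beta> x)) (A \<inter> Q \<inter> part_of \<beta> x) = ennreal (cond_weight \<kappa> \<beta> A x) * indicator Q x"
      proof (cases "x \<in> Q")
        case True
        then have "A \<inter> Q \<inter> part_of \<beta> x = A \<inter> part_of \<beta> x"
          using saturated_part_of(1)[OF part Q x(2)] by auto
        then show ?thesis using True by (simp add: cond_weight_def k.emeasure_eq_measure)
      next
        case False
        then have "A \<inter> Q \<inter> part_of \<beta> x = {}"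
          using saturated_part_of(2)[OF part Q x(2)] by auto
        then show ?thesis using False by simp
      qed
    qed
  qed
  finally show ?thesis .
qed

lemma cond_weight_le_1: "AE x in M. cond_weight \<kappa> \<beta> A x \<le> 1"
  using AE_fibre_space
proof eventually_elim
  fix x assume "prob_space (\<kappa> (part_of \<beta> x)) \<and> complete_measure (\<kappa> (part_of \<beta> x)) \<and>
    space (\<kappa> (part_of \<beta> x)) = part_of \<beta> x"
  then show "cond_weight \<kappa> \<beta> A x \<le> 1" using prob_space.prob_le_1 by (auto simp: cond_weight_def)
qed

text \<open>The weight is the conditional probability of \<open>A\<close> given the \<open>\<sigma>\<close>-algebra of measurable unions of
  elements, so it may replace the indicator of \<open>A\<close> under integrals against functions of that
  \<open>\<sigma>\<close>-algebra.\<close>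

lemma nn_integral_cond_weight:
  assumes A: "A \<in> sets M" and u: "u \<in> borel_measurable (sigma (space M) (saturated M \<beta>))"
  shows "(\<integral>\<^sup>+x. u x * indicator A x \<partial>M) = (\<integral>\<^sup>+x. u x * ennreal (cond_weight \<kappa> \<beta> A x) \<partial>M)"
proof -
  interpret prob_space M by (rule prob)
  let ?S = "sigma (space M) (saturated M \<beta>)"
  interpret finite_measure_subalgebra M ?S by unfold_locales (rule subalgebra_saturated[OF part])
  have w: "(\<lambda>x. ennreal (cond_weight \<kappa> \<beta> A x)) \<in> borel_measurable ?S"
    using cond_weight_measurable[OF A] by measurable
  have ind: "(indicator A :: 'a \<Rightarrow> ennreal) \<in> borel_measurable M" using A by simp
  have "AE x in M. ennreal (cond_weight \<kappa> \<beta> A x) = nn_cond_exp M ?S (indicator A) x"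
  proof (rule nn_cond_exp_charact[OF _ ind w])
    fix Q assume "Q \<in> sets ?S"
    then have Q: "Q \<in> saturated M \<beta>" by (simp only: subalgebra_saturated(2)[OF part])
    then have "(\<integral>\<^sup>+x\<in>Q. indicator A x \<partial>M) = (\<integral>\<^sup>+x. indicator (A \<inter> Q) x \<partial>M)"
      by (intro nn_integral_cong) (auto simp: indicator_def)
    also have "\<dots> = emeasure M (A \<inter> Q)" using A Q by (intro nn_integral_indicator) (auto simp: saturated_def)
    also have "\<dots> = (\<integral>\<^sup>+x\<in>Q. ennreal (cond_weight \<kappa> \<beta> A x) \<partial>M)"
      by (rule emeasure_eq_integral_cond_weight[OF A Q])
    finally show "(\<integral>\<^sup>+x\<in>Q. indicator A x \<partial>M) = (\<integral>\<^sup>+x\<in>Q. ennreal (cond_weight \<kappa> \<beta> A x) \<partial>M)" .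
  qed
  then have "(\<integral>\<^sup>+x. u x * ennreal (cond_weight \<kappa> \<beta> A x) \<partial>M) = (\<integral>\<^sup>+x. u x * nn_cond_exp M ?S (indicator A) x \<partial>M)"
    by (intro nn_integral_cong_AE) (auto elim: eventually_mono)
  also have "\<dots> = (\<integral>\<^sup>+x. u x * indicator A x \<partial>M)"
    by (rule nn_cond_exp_intg[OF u ind])
  finally show ?thesis ..
qed

text \<open>The information function of a finite partition splits over its cells. On each cell the indicator
  is replaced by the weight \<open>w\<close>, which turns \<open>- log w\<close> into \<open>- w log w\<close>.\<close>

lemma nn_integral_neg_log_cells:
  assumes P: "finite P" "P \<subseteq> sets M"
  shows "(\<lambda>x. neg_log (cond_weight \<kappa> \<beta> (cell M P (pattern P x)) x)) \<in> borel_measurable M"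
    and "(\<integral>\<^sup>+x. neg_log (cond_weight \<kappa> \<beta> (cell M P (pattern P x)) x) \<partial>M)
      = cond_fentropy M P (saturated M \<beta>)"
proof -
  interpret prob_space M by (rule prob)
  let ?S = "sigma (space M) (saturated M \<beta>)"
  let ?c = "cell M P" and ?w = "\<lambda>a. cond_weight \<kappa> \<beta> (cell M P a)"
  note sub = subalgebra_saturated(1)[OF part]
  have c [measurable]: "?c a \<in> sets M" for a by (rule cell_sets[OF P])
  have w: "?w a \<in> borel_measurable ?S" for a by (rule cond_weight_measurable[OF c])
  have wM [measurable]: "?w a \<in> borel_measurable M" for a using w by (rule measurable_from_subalg[OF sub])
  have eq: "neg_log (?w (pattern P x) x) = (\<Sum>a\<in>Pow P. neg_log (?w a x) * indicator (?c a) x)"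
    if "x \<in> space M" for x
  proof -
    have "(\<Sum>a\<in>Pow P. neg_log (?w a x) * indicator (?c a) x)
        = (\<Sum>a\<in>Pow P. if a = pattern P x then neg_log (?w a x) else 0)"
      using that by (intro sum.cong) (auto simp: cell_def)
    then show ?thesis using P(1) pattern_in_Pow[of P x] by simp
  qed
  have nl: "(\<lambda>x. neg_log (?w a x)) \<in> borel_measurable ?S" for a
    by (rule measurable_compose[OF w measurable_neg_log])
  have [measurable]: "(\<lambda>x. neg_log (?w a x)) \<in> borel_measurable M" for a
    using nl by (rule measurable_from_subalg[OF sub])
  show "(\<lambda>x. neg_log (?w (pattern P x) x)) \<in> borel_measurable M"
    by (subst measurable_cong[OF eq]) measurable
  \<comment> \<open>the weight is at most \<open>1\<close> almost everywhere only; the truncation is so everywhere\<close>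
  define v where "v a x = min 1 (?w a x)" for a x
  have v01: "0 \<le> v a x" "v a x \<le> 1" for a x by (auto simp: v_def cond_weight_def)
  have v [measurable]: "v a \<in> borel_measurable M" for a unfolding v_def by measurable
  have vS: "v a \<in> borel_measurable ?S" for a
    unfolding v_def by (intro borel_measurable_min borel_measurable_const w)
  have vw: "AE x in M. v a x = ?w a x" for a
    using cond_weight_le_1[of "?c a"] by eventually_elim (simp add: v_def)
  have integ: "integrable M (\<lambda>x. - v a x * ln (v a x))" for a
    by (rule integrable_const_bound[of _ 1]) (use xlogx_bounds[OF v01] in auto)
  have "(\<integral>\<^sup>+x. neg_log (?w (pattern P x) x) \<partial>M) = (\<integral>\<^sup>+x. (\<Sum>a\<in>Pow P. neg_log (?w a x) * indicator (?c a) x) \<partial>M)"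
    by (intro nn_integral_cong eq)
  also have "\<dots> = (\<Sum>a\<in>Pow P. \<integral>\<^sup>+x. neg_log (?w a x) * indicator (?c a) x \<partial>M)"
    by (rule nn_integral_sum) measurable
  also have "\<dots> = (\<Sum>a\<in>Pow P. ennreal (\<integral>x. - v a x * ln (v a x) \<partial>M))"
  proof (rule sum.cong[OF refl])
    fix a
    have "(\<integral>\<^sup>+x. neg_log (?w a x) * indicator (?c a) x \<partial>M) = (\<integral>\<^sup>+x. neg_log (?w a x) * ennreal (?w a x) \<partial>M)"
      by (rule nn_integral_cond_weight[OF c nl])
    also have "\<dots> = (\<integral>\<^sup>+x. ennreal (- v a x * ln (v a x)) \<partial>M)"
    proof (rule nn_integral_cong_AE)
      show "AE x in M. neg_log (?w a x) * ennreal (?w a x) = ennreal (- v a x * ln (v a x))"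
        using vw[of a]
      proof eventually_elim
        fix x assume x: "v a x = ?w a x"
        show "neg_log (?w a x) * ennreal (?w a x) = ennreal (- v a x * ln (v a x))"
        proof (cases "v a x = 0")
          case True
          then show ?thesis using x by simp
        next
          case False
          then have "ln (v a x) \<le> 0" using v01[of a x] by simp
          then have "ennreal (- ln (v a x)) * ennreal (v a x) = ennreal (- ln (v a x) * v a x)"
            using v01[of a x] by (intro ennreal_mult[symmetric]) auto
          then show ?thesis using False unfolding x[symmetric] by (simp add: neg_log_def mult.commute)
        qed
      qed
    qed
    also have "\<dots> = ennreal (\<integral>x. - v a x * ln (v a x) \<partial>M)"
      by (rule nn_integral_eq_integral[OF integ]) (use xlogx_bounds[OF v01] in auto)
    finally show "(\<integral>\<^sup>+x. neg_log (?w a x) * indicator (?c a) x \<partial>M) = ennreal (\<integral>x. - v a x * ln (v a x) \<partial>M)" .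
  qed
  also have "\<dots> = ennreal (\<Sum>a\<in>Pow P. \<integral>x. - v a x * ln (v a x) \<partial>M)"
    by (rule sum_ennreal) (intro Bochner_Integration.integral_nonneg xlogx_bounds v01)
  also have "\<dots> = cond_fentropy M P (sets ?S)"
  proof (rule cond_fentropy_eq_integral[OF sub P vS v01, symmetric])
    fix a q assume "q \<in> sets ?S"
    then have q: "q \<in> saturated M \<beta>" by (simp only: subalgebra_saturated(2)[OF part])
    then have qM [measurable]: "q \<in> sets M" by (simp add: saturated_def)
    have "ennreal (prob (?c a \<inter> q)) = (\<integral>\<^sup>+x\<in>q. ennreal (?w a x) \<partial>M)"
      using emeasure_eq_integral_cond_weight[OF c q, of a] by (simp add: emeasure_eq_measure)
    also have "\<dots> = (\<integral>\<^sup>+x. ennreal (indicator q x * v a x) \<partial>M)"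
      by (rule nn_integral_cong_AE) (use vw[of a] in \<open>auto elim!: eventually_mono simp: indicator_def\<close>)
    also have "\<dots> = ennreal (\<integral>x. indicator q x * v a x \<partial>M)"
      by (intro nn_integral_eq_integral integrable_const_bound[of _ 1])
         (use v01 in \<open>auto simp: indicator_def\<close>)
    finally show "prob (?c a \<inter> q) = (\<integral>x. indicator q x * v a x \<partial>M)"
      by (subst (asm) ennreal_inj) (use v01 in \<open>auto intro!: Bochner_Integration.integral_nonneg\<close>)
  qed
  finally show "(\<integral>\<^sup>+x. neg_log (?w (pattern P x) x) \<partial>M) = cond_fentropy M P (saturated M \<beta>)"
    by (simp only: subalgebra_saturated(2)[OF part])
qed

lemma AE_emeasure_saturated:
  assumes "T \<in> saturated M \<beta>"
  shows "AE x in M. emeasure (\<kappa> (part_of \<beta> x)) (T \<inter> part_of \<beta> x) = indicator T x"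
  using AE_fibre_space AE_space
proof eventually_elim
  fix x assume x: "prob_space (\<kappa> (part_of \<beta> x)) \<and> complete_measure (\<kappa> (part_of \<beta> x)) \<and>
    space (\<kappa> (part_of \<beta> x)) = part_of \<beta> x" "x \<in> space M"
  then interpret k: prob_space "\<kappa> (part_of \<beta> x)" by simp
  show "emeasure (\<kappa> (part_of \<beta> x)) (T \<inter> part_of \<beta> x) = indicator T x"
  proof (cases "x \<in> T")
    case True
    then have "T \<inter> part_of \<beta> x = space (\<kappa> (part_of \<beta> x))"
      using saturated_part_of(1)[OF part assms x(2)] x(1) by auto
    then show ?thesis using True by (simp add: k.emeasure_space_1)
  next
    case False
    then have "T \<inter> part_of \<beta> x = {}" using saturated_part_of(2)[OF part assms x(2)] by auto
    then show ?thesis using False by simp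
  qed
qed

end

text \<open>The conditional measure of a union \<open>T\<close> of elements is the indicator of \<open>T\<close>. Being a function of
  \<open>F\<close> mod 0, it exhibits \<open>T\<close> as a set generated by \<open>F\<close> mod 0.\<close>

lemma saturated_subset_entropy_closure:
  assumes leb: "lebesgue_prob_space M" and gen: "generates M \<beta> F"
  shows "saturated M \<beta> \<subseteq> entropy_closure M F"
proof
  fix T assume T: "T \<in> saturated M \<beta>"
  interpret prob_space M by (rule leb[unfolded lebesgue_prob_space_def, THEN conjunct1])
  interpret complete_measure M
    by (rule leb[unfolded lebesgue_prob_space_def, THEN conjunct2, THEN conjunct1])
  have part: "partition_on (space M) \<beta>" and F: "F \<subseteq> saturated M \<beta>"
    using gen by (simp_all add: generates_def)
  have FM: "F \<subseteq> events" and TM: "T \<in> events" "T \<subseteq> space M"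
    using F T sets.sets_into_space[of T M] by (auto simp: saturated_def)
  obtain \<kappa> where \<kappa>: "conditional_measures M \<beta> \<kappa>"
    and u: "\<And>A. A \<in> sets M \<Longrightarrow> \<exists>u\<in>borel_measurable (sigma (space M) F).
      AE x in M. emeasure (\<kappa> (part_of \<beta> x)) (A \<inter> part_of \<beta> x) = u x"
    using conditional_measures_exist[OF leb gen] by blast
  obtain u where um: "u \<in> borel_measurable (sigma (space M) F)"
    and uT: "AE x in M. emeasure (\<kappa> (part_of \<beta> x)) (T \<inter> part_of \<beta> x) = u x"
    using u[OF TM(1)] by blast
  interpret C: sigma_algebra "space M" "entropy_closure M F" by (rule sigma_algebra_entropy_closure[OF FM])
  have Fpow: "F \<subseteq> Pow (space M)" using FM sets.space_closed[of M] by (rule subset_trans)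
  define T' where "T' = u -` {1} \<inter> space M"
  have "u -` {1} \<inter> space (sigma (space M) F) \<in> sets (sigma (space M) F)"
    using um by (rule measurable_sets) simp
  then have "T' \<in> sigma_sets (space M) F"
    using Fpow by (simp add: T'_def sets_measure_of space_measure_of)
  then have T': "T' \<in> entropy_closure M F"
    using C.sigma_sets_subset[OF subset_entropy_closure[OF FM]] by blast
  then have T'M: "T' \<in> events" by (simp add: entropy_closure_def)
  have "AE x in M. x \<in> T \<longleftrightarrow> x \<in> T'"
    using AE_emeasure_saturated[OF prob_space_axioms part \<kappa> T] uT AE_space
    by eventually_elim (auto simp: T'_def indicator_def)
  then have "AE x in M. x \<notin> T - T'" "AE x in M. x \<notin> T' - T"
    by (auto elim: eventually_mono)
  then have "T - T' \<in> null_sets M" "T' - T \<in> null_sets M"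
    using TM T'M by (auto simp: null_sets_iff_AE dest: sets.sets_into_space)
  then have "T - T' \<in> entropy_closure M F" "T' - T \<in> entropy_closure M F"
    using null_sets_subset_entropy_closure by blast+
  then have "(T' - (T' - T)) \<union> (T - T') \<in> entropy_closure M F" using T' by auto
  also have "(T' - (T' - T)) \<union> (T - T') = T" by auto
  finally show "T \<in> entropy_closure M F" .
qed

lemma cond_fentropy_saturated:
  assumes leb: "lebesgue_prob_space M" and gen: "generates M \<beta> F" and P: "finite P" "P \<subseteq> sets M"
  shows "cond_fentropy M P (saturated M \<beta>) = cond_fentropy M P F"
proof (rule antisym)
  interpret prob_space M by (rule leb[unfolded lebesgue_prob_space_def, THEN conjunct1])
  have F: "F \<subseteq> saturated M \<beta>" using gen by (simp add: generates_def)
  then have FM: "F \<subseteq> events" by (auto simp: saturated_def)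
  show "cond_fentropy M P (saturated M \<beta>) \<le> cond_fentropy M P F"
    by (rule cond_fentropy_antimono[OF F])
  show "cond_fentropy M P F \<le> cond_fentropy M P (saturated M \<beta>)"
    unfolding cond_fentropy_def[of M P "saturated M \<beta>"]
  proof (rule INF_greatest, clarify)
    fix Q assume Q: "finite Q" "Q \<subseteq> saturated M \<beta>"
    have "Q \<subseteq> entropy_closure M F" using Q(2) saturated_subset_entropy_closure[OF leb gen] by (rule subset_trans)
    then show "cond_fentropy M P F \<le> ennreal (fentropy M (P \<union> Q) - fentropy M Q)"
      by (rule cond_fentropy_le_closure[OF Q(1) _ FM P])
  qed
qed

lemma part_of_subset_cell:
  assumes part: "partition_on (space M) \<alpha>" and P: "P \<subseteq> saturated M \<alpha>" and x: "x \<in> space M"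
  shows "part_of \<alpha> x \<subseteq> cell M P (pattern P x)"
proof
  fix y assume y: "y \<in> part_of \<alpha> x"
  have "x \<in> S \<longleftrightarrow> y \<in> S" if "S \<in> P" for S
    using saturated_part_of[OF part _ x, of S] P that y by blast
  then have "pattern P y = pattern P x" by (auto simp: pattern_def)
  then show "y \<in> cell M P (pattern P x)"
    using part_of_subset[OF part x] y by (auto simp: cell_def)
qed

text \<open>The element \<open>\<alpha> x\<close> is, in almost every fibre, the decreasing intersection of the cells containing \<open>x\<close> of
  finite families \<open>P n\<close> that exhaust a separating family. Monotone convergence of the information
  functions then reduces the claim to finite families. A finite family outside the
  sequence gives no more, as its cells also contain the elements of \<open>\<alpha>\<close>.\<close>

theorem cond_entropy_eq_family_entropy:
  assumes leb: "lebesgue_prob_space M" and gen\<alpha>: "generates M \<alpha> G" and gen\<beta>: "generates M \<beta> F"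
  shows "cond_entropy M \<alpha> \<beta> = family_entropy M G F"
proof -
  interpret prob_space M by (rule leb[unfolded lebesgue_prob_space_def, THEN conjunct1])
  have part\<alpha>: "partition_on (space M) \<alpha>" and G: "G \<subseteq> saturated M \<alpha>"
    and part: "partition_on (space M) \<beta>"
    using gen\<alpha> gen\<beta> by (simp_all add: generates_def)
  have GM: "G \<subseteq> events" using G by (auto simp: saturated_def)
  obtain N B where N: "N \<in> null_sets M" and B: "countable B" "B \<subseteq> G"
    and sep: "\<forall>x\<in>space M - N. \<forall>y\<in>space M - N. (\<forall>S\<in>B. x \<in> S \<longleftrightarrow> y \<in> S) \<longrightarrow> part_of \<alpha> x = part_of \<alpha> y"
    using gen\<alpha> unfolding generates_def by (elim conjE bexE exE) (rule that)
  have BM: "B \<subseteq> events" using B(2) GM by (rule subset_trans)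
  define \<kappa> where "\<kappa> = (SOME \<kappa>. conditional_measures M \<beta> \<kappa>)"
  have \<kappa>: "conditional_measures M \<beta> \<kappa>"
    unfolding \<kappa>_def using conditional_measures_exist[OF leb gen\<beta>] by (metis someI_ex)
  note fib = AE_fibre_space[OF prob_space_axioms part \<kappa>]
  define J where "J P x = neg_log (cond_weight \<kappa> \<beta> (cell M P (pattern P x)) x)" for P x
  have J: "J P \<in> borel_measurable M" "(\<integral>\<^sup>+x. J P x \<partial>M) = cond_fentropy M P F"
    if "finite P" "P \<subseteq> events" for P
    using nn_integral_neg_log_cells[OF prob_space_axioms part \<kappa> that]
      cond_fentropy_saturated[OF leb gen\<beta> that] by (simp_all add: J_def[abs_def])
  define I where "I x = neg_log (measure (\<kappa> (part_of \<beta> x)) (part_of \<alpha> x \<inter> part_of \<beta> x))" for x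
  have ce: "cond_entropy M \<alpha> \<beta> = (\<integral>\<^sup>+x. I x \<partial>M)"
    by (simp add: cond_entropy_def cond_measure_def \<kappa>_def I_def)
  have Bsets: "AE x in M. \<forall>S\<in>B. S \<inter> part_of \<beta> x \<in> sets (\<kappa> (part_of \<beta> x))"
    using BM by (intro AE_ball_countable' B(1) conditional_measuresD(1)[OF prob_space_axioms part \<kappa>]) auto
  have Nnull: "AE x in M. N \<inter> part_of \<beta> x \<in> null_sets (\<kappa> (part_of \<beta> x))"
  proof -
    have "N \<in> events" using N by auto
    note d = conditional_measuresD[OF prob_space_axioms part \<kappa> this]
    have "(\<integral>\<^sup>+x. emeasure (\<kappa> (part_of \<beta> x)) (N \<inter> part_of \<beta> x) \<partial>M) = 0"
      using d(3) null_setsD1[OF N] by simp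
    then have "AE x in M. emeasure (\<kappa> (part_of \<beta> x)) (N \<inter> part_of \<beta> x) = 0"
      using nn_integral_0_iff_AE[OF d(2)] by simp
    with d(1) show ?thesis by eventually_elim auto
  qed
  define P where "P n = {S \<in> B. to_nat_on B S < n}" for n
  have P: "finite (P n)" "P n \<subseteq> B" "P n \<subseteq> P (Suc n)" for n
  proof -
    have "inj_on (to_nat_on B) (P n)" by (rule inj_on_subset[OF inj_on_to_nat_on[OF B(1)]]) (auto simp: P_def)
    moreover have "to_nat_on B ` P n \<subseteq> {..<n}" by (auto simp: P_def)
    ultimately show "finite (P n)" by (metis finite_imageD finite_subset finite_lessThan)
  qed (auto simp: P_def)
  have PB: "(\<Union>n. P n) = B" by (auto simp: P_def)
  have Pe: "P n \<subseteq> events" "P n \<subseteq> saturated M \<alpha>" for n using P(2)[of n] B(2) BM G by blast+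
  \<comment> \<open>outside \<open>N\<close> the intersection of the sets \<open>c n\<close> is \<open>\<alpha> x \<inter> \<beta> x\<close>, and the fibre measures are complete\<close>
  have AE_fibre: "AE x in M. (part_of \<alpha> x \<inter> part_of \<beta> x \<in> sets (\<kappa> (part_of \<beta> x))) \<and>
      (\<forall>n. J (P n) x \<le> J (P (Suc n)) x) \<and> (SUP n. J (P n) x) = I x"
    using fib Bsets Nnull AE_not_in[OF N] AE_space
  proof eventually_elim
    fix x assume x: "prob_space (\<kappa> (part_of \<beta> x)) \<and> complete_measure (\<kappa> (part_of \<beta> x)) \<and>
        space (\<kappa> (part_of \<beta> x)) = part_of \<beta> x"
      "\<forall>S\<in>B. S \<inter> part_of \<beta> x \<in> sets (\<kappa> (part_of \<beta> x))"
      "N \<inter> part_of \<beta> x \<in> null_sets (\<kappa> (part_of \<beta> x))" "x \<notin> N" "x \<in> space M"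
    let ?k = "\<kappa> (part_of \<beta> x)" and ?b = "part_of \<beta> x" and ?a = "part_of \<alpha> x"
    interpret k: prob_space ?k using x(1) by blast
    interpret kc: complete_measure ?k using x(1) by blast
    have sp: "space ?k = ?b" using x(1) by blast
    have b: "?b \<subseteq> space M" by (rule part_of_subset[OF part x(5)])
    define c where "c n = cell M (P n) (pattern (P n) x) \<inter> ?b" for n
    have c_eq: "c n = {y \<in> ?b. \<forall>S\<in>P n. y \<in> S \<longleftrightarrow> x \<in> S}" for n
      using b by (auto simp: c_def cell_def pattern_def)
    have c_sets: "c n \<in> sets ?k" for n
    proof -
      have "{y \<in> space ?k. y \<in> S \<longleftrightarrow> x \<in> S} \<in> sets ?k" if "S \<in> P n" for S
      proof -
        have S: "S \<inter> ?b \<in> sets ?k" using x(2) P(2)[of n] that by blast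
        then have "space ?k - (S \<inter> ?b) \<in> sets ?k" by auto
        moreover have "{y \<in> space ?k. y \<in> S \<longleftrightarrow> x \<in> S} = (if x \<in> S then S \<inter> ?b else space ?k - (S \<inter> ?b))"
          using sp by auto
        ultimately show ?thesis using S by simp
      qed
      then have "{y \<in> space ?k. \<forall>S\<in>P n. y \<in> S \<longleftrightarrow> x \<in> S} \<in> sets ?k"
        by (intro sets.sets_Collect_finite_All P(1))
      then show ?thesis by (simp add: c_eq sp)
    qed
    have dec: "decseq c"
      by (rule decseq_SucI) (use P(3) in \<open>auto simp: c_eq\<close>)
    have sub: "?a \<inter> ?b \<subseteq> (\<Inter>n. c n)"
      using part_of_subset_cell[OF part\<alpha> Pe(2) x(5)] by (auto simp: c_def)
    have diff: "(\<Inter>n. c n) - (?a \<inter> ?b) \<subseteq> N \<inter> ?b"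
    proof
      fix y assume y: "y \<in> (\<Inter>n. c n) - (?a \<inter> ?b)"
      then have yb: "y \<in> ?b" "y \<in> space M" using b by (auto simp: c_eq)
      have "\<forall>S\<in>B. x \<in> S \<longleftrightarrow> y \<in> S" using y PB by (auto simp: c_eq)
      then have "y \<notin> N \<Longrightarrow> part_of \<alpha> x = part_of \<alpha> y" using sep x(4,5) yb by blast
      then have "y \<notin> N \<Longrightarrow> y \<in> ?a" using part_of_in(2)[OF part\<alpha> yb(2)] by simp
      then show "y \<in> N \<inter> ?b" using y yb by auto
    qed
    have d_null: "(\<Inter>n. c n) - (?a \<inter> ?b) \<in> null_sets ?k" by (rule kc.complete2[OF diff x(3)])
    have I_sets: "(\<Inter>n. c n) \<in> sets ?k" using c_sets by auto
    have ab_eq: "?a \<inter> ?b = (\<Inter>n. c n) - ((\<Inter>n. c n) - (?a \<inter> ?b))" using sub by auto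
    have ab_sets: "?a \<inter> ?b \<in> sets ?k" by (subst ab_eq) (use d_null I_sets in auto)
    have "measure ?k ((\<Inter>n. c n) - ((\<Inter>n. c n) - (?a \<inter> ?b))) = measure ?k (\<Inter>n. c n)"
      by (rule measure_Diff_null_set[OF I_sets d_null])
    then have meas: "measure ?k (?a \<inter> ?b) = measure ?k (\<Inter>n. c n)" using ab_eq by simp
    have Jc: "J (P n) x = neg_log (measure ?k (c n))" for n
      by (simp add: J_def cond_weight_def c_def)
    have "(\<lambda>n. measure ?k (c n)) \<longlonglongrightarrow> measure ?k (\<Inter>n. c n)"
      by (rule k.finite_Lim_measure_decseq) (use c_sets dec in auto)
    moreover have pdec: "decseq (\<lambda>n. measure ?k (c n))"
      using dec c_sets by (intro decseq_SucI k.finite_measure_mono) (auto simp: decseq_Suc_iff)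
    ultimately have "(SUP n. J (P n) x) = I x"
      unfolding Jc I_def meas by (intro neg_log_SUP) auto
    moreover have "J (P n) x \<le> J (P (Suc n)) x" for n
      unfolding Jc using pdec by (intro neg_log_antimono) (auto simp: decseq_Suc_iff)
    ultimately show "?a \<inter> ?b \<in> sets ?k \<and> (\<forall>n. J (P n) x \<le> J (P (Suc n)) x) \<and> (SUP n. J (P n) x) = I x"
      using ab_sets by blast
  qed
  show ?thesis
  proof (rule antisym)
    have "cond_entropy M \<alpha> \<beta> = (\<integral>\<^sup>+x. (SUP n. J (P n) x) \<partial>M)"
      unfolding ce by (rule nn_integral_cong_AE) (use AE_fibre in \<open>auto elim: eventually_mono\<close>)
    also have "\<dots> = (SUP n. \<integral>\<^sup>+x. J (P n) x \<partial>M)"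
      by (rule nn_integral_monotone_convergence_SUP_AE)
         (use AE_fibre J(1)[OF P(1) Pe(1)] in \<open>auto elim: eventually_mono\<close>)
    also have "\<dots> = (SUP n. cond_fentropy M (P n) F)" by (simp only: J(2)[OF P(1) Pe(1)])
    also have "\<dots> \<le> family_entropy M G F"
      by (intro SUP_least cond_fentropy_le_family_entropy P(1) subset_trans[OF P(2) B(2)])
    finally show "cond_entropy M \<alpha> \<beta> \<le> family_entropy M G F" .
    show "family_entropy M G F \<le> cond_entropy M \<alpha> \<beta>"
      unfolding family_entropy_def
    proof (rule SUP_least, clarify)
      fix R assume R: "finite R" "R \<subseteq> G"
      have RM: "R \<subseteq> events" "R \<subseteq> saturated M \<alpha>" using R(2) GM G by blast+
      have cells: "AE x in M. \<forall>a\<in>Pow R. cell M R a \<inter> part_of \<beta> x \<in> sets (\<kappa> (part_of \<beta> x))"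
      proof (rule AE_ball_countable')
        show "countable (Pow R)" by (rule countable_finite) (simp add: R(1))
        show "AE x in M. cell M R a \<inter> part_of \<beta> x \<in> sets (\<kappa> (part_of \<beta> x))" for a
          by (rule conditional_measuresD(1)[OF prob_space_axioms part \<kappa> cell_sets[OF R(1) RM(1)]])
      qed
      have "(\<integral>\<^sup>+x. J R x \<partial>M) \<le> (\<integral>\<^sup>+x. I x \<partial>M)"
      proof (rule nn_integral_mono_AE)
        show "AE x in M. J R x \<le> I x"
          using fib cells AE_fibre AE_space
        proof eventually_elim
          fix x assume x: "prob_space (\<kappa> (part_of \<beta> x)) \<and> complete_measure (\<kappa> (part_of \<beta> x)) \<and>
              space (\<kappa> (part_of \<beta> x)) = part_of \<beta> x"
            "\<forall>a\<in>Pow R. cell M R a \<inter> part_of \<beta> x \<in> sets (\<kappa> (part_of \<beta> x))"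
            "(part_of \<alpha> x \<inter> part_of \<beta> x \<in> sets (\<kappa> (part_of \<beta> x))) \<and>
              (\<forall>n. J (P n) x \<le> J (P (Suc n)) x) \<and> (SUP n. J (P n) x) = I x" "x \<in> space M"
          interpret k: prob_space "\<kappa> (part_of \<beta> x)" using x(1) by blast
          have "cell M R (pattern R x) \<inter> part_of \<beta> x \<in> sets (\<kappa> (part_of \<beta> x))"
            using x(2)[rule_format, OF pattern_in_Pow] .
          moreover have "part_of \<alpha> x \<inter> part_of \<beta> x \<subseteq> cell M R (pattern R x) \<inter> part_of \<beta> x"
            using part_of_subset_cell[OF part\<alpha> RM(2) x(4)] by (rule Int_mono[OF _ order_refl])
          ultimately show "J R x \<le> I x"
            unfolding J_def I_def cond_weight_def
            by (intro neg_log_antimono measure_nonneg k.prob_le_1 k.finite_measure_mono)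
        qed
      qed
      then show "cond_fentropy M R F \<le> cond_entropy M \<alpha> \<beta>"
        using J(2)[OF R(1) RM(1)] by (simp only: ce)
    qed
  qed
qed

section \<open>Generating families of derived partitions\<close>

text \<open>The separating sets of a measurable partition are unions of elements only mod 0. Each \<open>B n\<close> is
  replaced by the union \<open>B' n\<close> of the elements it contains mod \<open>N\<close>. The two differ inside \<open>N\<close> only, so
  \<open>B' n\<close> is measurable by completeness.\<close>

lemma generates_saturated:
  assumes "complete_measure M" "measurable_partition M \<eta>"
  shows "generates M \<eta> (saturated M \<eta>)"
proof -
  interpret complete_measure M by fact
  obtain N B where part: "partition_on (space M) \<eta>" and N: "N \<in> null_sets M"
    and B: "\<forall>n::nat. B n \<in> sets M" and sat: "\<forall>n. \<forall>C\<in>\<eta>. C - N \<subseteq> B n \<or> B n \<inter> C \<subseteq> N"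
    and sep: "\<forall>C\<in>\<eta>. \<forall>D\<in>\<eta>. C \<noteq> D \<longrightarrow>
      (\<exists>n. (C - N \<subseteq> B n \<and> B n \<inter> D \<subseteq> N) \<or> (D - N \<subseteq> B n \<and> B n \<inter> C \<subseteq> N))"
    using assms(2) unfolding measurable_partition_def by (elim conjE bexE exE) (rule that)
  define B' where "B' n = \<Union>{C \<in> \<eta>. C - N \<subseteq> B n}" for n
  have mem: "x \<in> B' n \<longleftrightarrow> part_of \<eta> x - N \<subseteq> B n" if x: "x \<in> space M" for x n
  proof
    assume "x \<in> B' n"
    then obtain C where C: "C \<in> \<eta>" "x \<in> C" "C - N \<subseteq> B n" unfolding B'_def by blast
    then show "part_of \<eta> x - N \<subseteq> B n" using part_of_eq[OF part C(1,2)] by simp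
  next
    assume "part_of \<eta> x - N \<subseteq> B n"
    then show "x \<in> B' n" unfolding B'_def using part_of_in[OF part x] by blast
  qed
  have sub: "B' n \<subseteq> space M" for n using partition_onD1[OF part] by (auto simp: B'_def)
  have B'_sat: "B' n \<in> saturated M \<eta>" for n
  proof -
    have "B n - N \<subseteq> B' n"
    proof
      fix y assume y: "y \<in> B n - N"
      then have sp: "y \<in> space M" using B sets.sets_into_space by blast
      note p = part_of_in[OF part sp]
      have "part_of \<eta> y - N \<subseteq> B n" using sat p y by blast
      then show "y \<in> B' n" using mem[OF sp] by simp
    qed
    moreover have "B' n \<subseteq> B n \<union> N" by (auto simp: B'_def)
    ultimately have "B' n = (B n - N) \<union> (B' n \<inter> N)" by auto
    moreover have "B' n \<inter> N \<in> sets M" by (rule complete[OF _ N]) auto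
    moreover have "B n - N \<in> sets M" using B N by auto
    ultimately have "B' n \<in> sets M" by (metis sets.Un)
    moreover have "C \<subseteq> B' n \<or> C \<inter> B' n = {}" if C: "C \<in> \<eta>" for C
    proof (cases "C - N \<subseteq> B n")
      case True
      then show ?thesis using C by (auto simp: B'_def)
    next
      case False
      have "x \<notin> B' n" if "x \<in> C" for x
        using mem[of x n] sub[of n] part_of_eq[OF part C that] False by auto
      then show ?thesis by auto
    qed
    ultimately show ?thesis by (simp add: saturated_def)
  qed
  have sepB: "part_of \<eta> x = part_of \<eta> y"
    if x: "x \<in> space M - N" and y: "y \<in> space M - N" and same: "\<forall>S\<in>range B'. x \<in> S \<longleftrightarrow> y \<in> S" for x y
  proof (rule ccontr)
    let ?C = "part_of \<eta> x" and ?D = "part_of \<eta> y"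
    assume "?C \<noteq> ?D"
    moreover have xy: "?C \<in> \<eta>" "?D \<in> \<eta>" "x \<in> ?C" "y \<in> ?D" using part_of_in[OF part] x y by auto
    ultimately obtain n where n: "(?C - N \<subseteq> B n \<and> B n \<inter> ?D \<subseteq> N) \<or> (?D - N \<subseteq> B n \<and> B n \<inter> ?C \<subseteq> N)"
      using sep by blast
    have "?C - N \<subseteq> B n \<longleftrightarrow> ?D - N \<subseteq> B n" using same mem[of x n] mem[of y n] x y by auto
    then have "?C - N \<subseteq> B n" "?D - N \<subseteq> B n" using n by blast+
    then have "x \<in> B n" "y \<in> B n" using xy x y by auto
    then show False using n xy x y by blast
  qed
  then show ?thesis
    unfolding generates_def
  proof (intro conjI bexI[of _ N] exI[of _ "range B'"] ballI impI part N order_refl)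
    show "countable (range B')" by simp
    show "range B' \<subseteq> saturated M \<eta>" using B'_sat by auto
  qed (rule sepB)
qed

lemma generates_common_refinement:
  assumes I: "countable I" "I \<noteq> {}" and gen: "\<And>i. i \<in> I \<Longrightarrow> generates M (\<alpha> i) (G i)"
  shows "generates M (common_refinement (\<alpha> ` I)) (\<Union>i\<in>I. G i)"
proof -
  have part: "partition_on (space M) (\<alpha> i)" and sat: "G i \<subseteq> saturated M (\<alpha> i)"
    and ex: "\<exists>N B. N \<in> null_sets M \<and> countable B \<and> B \<subseteq> G i \<and>
      (\<forall>x\<in>space M - N. \<forall>y\<in>space M - N. (\<forall>S\<in>B. x \<in> S \<longleftrightarrow> y \<in> S) \<longrightarrow> part_of (\<alpha> i) x = part_of (\<alpha> i) y)"
    if "i \<in> I" for i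
    using gen[OF that] unfolding generates_def by blast+
  obtain N B where N: "\<And>i. i \<in> I \<Longrightarrow> N i \<in> null_sets M" and B: "\<And>i. i \<in> I \<Longrightarrow> countable (B i)" "\<And>i. i \<in> I \<Longrightarrow> B i \<subseteq> G i"
    and sep: "\<And>i. i \<in> I \<Longrightarrow> \<forall>x\<in>space M - N i. \<forall>y\<in>space M - N i. (\<forall>S\<in>B i. x \<in> S \<longleftrightarrow> y \<in> S) \<longrightarrow> part_of (\<alpha> i) x = part_of (\<alpha> i) y"
    using ex by metis
  let ?R = "common_refinement (\<alpha> ` I)"
  have partR: "partition_on (space M) ?R"
    by (rule partition_on_common_refinement) (use part I in auto)
  have eqR: "part_of ?R x = part_of ?R y"
    if x: "x \<in> space M" and y: "y \<in> space M" and same: "\<And>i. i \<in> I \<Longrightarrow> part_of (\<alpha> i) x = part_of (\<alpha> i) y" for x y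
  proof -
    note p = part_of_in[OF partR x]
    obtain f where f: "f \<in> (\<Pi> P\<in>\<alpha> ` I. P)" "part_of ?R x = \<Inter>(f ` \<alpha> ` I)"
      using p(1) by (auto simp: common_refinement)
    have "y \<in> f (\<alpha> i)" if i: "i \<in> I" for i
    proof -
      have "f (\<alpha> i) \<in> \<alpha> i" "x \<in> f (\<alpha> i)" using f p(2) i by auto
      then have "f (\<alpha> i) = part_of (\<alpha> i) y" using part_of_eq[OF part[OF i]] same[OF i] by simp
      then show ?thesis using part_of_in(2)[OF part[OF i] y] by simp
    qed
    then have "y \<in> part_of ?R x" using f(2) by auto
    then show ?thesis using part_of_eq[OF partR p(1)] by simp
  qed
  have satR: "G i \<subseteq> saturated M ?R" if i: "i \<in> I" for i
  proof
    fix S assume "S \<in> G i"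
    then have S: "S \<in> sets M" "\<And>C. C \<in> \<alpha> i \<Longrightarrow> C \<subseteq> S \<or> C \<inter> S = {}" using sat[OF i] by (auto simp: saturated_def)
    have "C \<subseteq> S \<or> C \<inter> S = {}" if C: "C \<in> ?R" for C
    proof -
      obtain D where "D \<in> \<alpha> i" "C \<subseteq> D" using common_refinement_exists[OF C, of "\<alpha> i"] i by blast
      then show ?thesis using S(2)[of D] by blast
    qed
    then show "S \<in> saturated M ?R" using S by (simp add: saturated_def)
  qed
  show ?thesis
    unfolding generates_def
  proof (intro conjI bexI[of _ "\<Union>i\<in>I. N i"] exI[of _ "\<Union>i\<in>I. B i"] partR ballI impI)
    show "(\<Union>i\<in>I. G i) \<subseteq> saturated M ?R" using satR by blast
    show "countable (\<Union>i\<in>I. B i)" using I B by auto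
    show "(\<Union>i\<in>I. B i) \<subseteq> (\<Union>i\<in>I. G i)" using B(2) by blast
    show "(\<Union>i\<in>I. N i) \<in> null_sets M" using N I by (intro null_sets_UN') auto
    fix x y assume x: "x \<in> space M - (\<Union>i\<in>I. N i)" and y: "y \<in> space M - (\<Union>i\<in>I. N i)"
      and same: "\<forall>S\<in>\<Union>i\<in>I. B i. x \<in> S \<longleftrightarrow> y \<in> S"
    have "part_of (\<alpha> i) x = part_of (\<alpha> i) y" if i: "i \<in> I" for i
    proof -
      have "x \<in> space M - N i" "y \<in> space M - N i" "\<forall>S\<in>B i. x \<in> S \<longleftrightarrow> y \<in> S" using x y same i by auto
      then show ?thesis using sep[OF i] by blast
    qed
    then show "part_of ?R x = part_of ?R y" using x y by (intro eqR) auto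
  qed
qed

lemma generates_join:
  assumes "generates M \<xi> G" "generates M \<eta> H"
  shows "generates M (partition_join \<xi> \<eta>) (G \<union> H)"
proof -
  \<comment> \<open>indexed by truth values, since \<open>\<xi> = \<eta>\<close> is possible with \<open>G \<noteq> H\<close>\<close>
  have "generates M (common_refinement ((\<lambda>b. if b then \<xi> else \<eta>) ` UNIV)) (\<Union>b\<in>UNIV. if b then G else H)"
    by (rule generates_common_refinement) (use assms in auto)
  moreover have "(\<lambda>b. if b then \<xi> else \<eta>) ` UNIV = {\<xi>, \<eta>}" "(\<Union>b\<in>UNIV. if b then G else H) = G \<union> H"
    by (auto simp: UNIV_bool)
  ultimately show ?thesis by (simp add: partition_join_def)
qed

text \<open>Stated with images because translates of partitions are images under powers of \<open>T\<close>.\<close>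

definition automorphism :: "'a measure \<Rightarrow> ('a \<Rightarrow> 'a) \<Rightarrow> bool" where
  "automorphism M U \<longleftrightarrow> bij_betw U (space M) (space M) \<and>
     (\<forall>A\<in>sets M. U ` A \<in> sets M \<and> emeasure M (U ` A) = emeasure M A)"

lemma generates_image:
  assumes U: "automorphism M U" and gen: "generates M \<eta> G"
  shows "generates M ((`) U ` \<eta>) ((`) U ` G)"
proof -
  have bij: "bij_betw U (space M) (space M)" and Um: "\<And>A. A \<in> sets M \<Longrightarrow> U ` A \<in> sets M"
    and Ue: "\<And>A. A \<in> sets M \<Longrightarrow> emeasure M (U ` A) = emeasure M A"
    using U by (auto simp: automorphism_def)
  have inj: "inj_on U (space M)" and surj: "U ` space M = space M"
    using bij by (auto simp: bij_betw_def)
  have part: "partition_on (space M) \<eta>" and sat: "G \<subseteq> saturated M \<eta>" using gen by (simp_all add: generates_def)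
  obtain N B where N: "N \<in> null_sets M" and B: "countable B" "B \<subseteq> G"
    and sep: "\<forall>x\<in>space M - N. \<forall>y\<in>space M - N. (\<forall>S\<in>B. x \<in> S \<longleftrightarrow> y \<in> S) \<longrightarrow> part_of \<eta> x = part_of \<eta> y"
    using gen unfolding generates_def by (elim conjE bexE exE) (rule that)
  have sub: "C \<subseteq> space M" if "C \<in> \<eta>" for C using partition_onD1[OF part] that by blast
  have BM: "S \<subseteq> space M" if "S \<in> B" for S
  proof (rule sets.sets_into_space)
    have "S \<in> saturated M \<eta>" using that B(2) sat by blast
    then show "S \<in> sets M" by (simp add: saturated_def)
  qed
  have memU: "U z \<in> U ` A \<longleftrightarrow> z \<in> A" if "z \<in> space M" "A \<subseteq> space M" for z A
    using inj that by (auto simp: inj_on_def)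
  have part': "partition_on (space M) ((`) U ` \<eta>)"
  proof (rule partition_onI)
    have "\<Union>((`) U ` \<eta>) = U ` \<Union>\<eta>" by auto
    then show "\<Union>((`) U ` \<eta>) = space M" by (simp only: partition_onD1[OF part, symmetric] surj)
    show "{} \<notin> (`) U ` \<eta>" using partition_onD3[OF part] by auto
    show "disjnt p q" if p: "p \<in> (`) U ` \<eta>" and q: "q \<in> (`) U ` \<eta>" and "p \<noteq> q" for p q
    proof -
      obtain C where C: "p = U ` C" "C \<in> \<eta>" using p by (rule imageE)
      obtain D where D: "q = U ` D" "D \<in> \<eta>" using q by (rule imageE)
      note CD = C(2) D(2) C(1) D(1)
      then have "C \<inter> D = {}" using \<open>p \<noteq> q\<close> partition_onD2[OF part] by (auto simp: disjoint_def)
      then have "U ` C \<inter> U ` D = {}"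
        using inj_on_image_Int[OF inj sub[OF CD(1)] sub[OF CD(2)]] by simp
      then show ?thesis using CD by (simp add: disjnt_def)
    qed
  qed
  have part_U: "part_of ((`) U ` \<eta>) (U z) = U ` part_of \<eta> z" if z: "z \<in> space M" for z
    by (rule part_of_eq[OF part']) (use part_of_in[OF part z] in auto)
  show ?thesis
    unfolding generates_def
  proof (intro conjI bexI[of _ "U ` N"] exI[of _ "(`) U ` B"] part' ballI impI)
    show "(`) U ` G \<subseteq> saturated M ((`) U ` \<eta>)"
    proof clarify
      fix S assume S: "S \<in> G"
      then have SM: "S \<in> sets M" "S \<subseteq> space M" using sat sets.sets_into_space[of S M] by (auto simp: saturated_def)
      have "U ` C \<subseteq> U ` S \<or> U ` C \<inter> U ` S = {}" if C: "C \<in> \<eta>" for C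
      proof -
        have "C \<subseteq> S \<or> C \<inter> S = {}" using S sat C by (auto simp: saturated_def)
        then show ?thesis using inj_on_image_Int[OF inj sub[OF C] SM(2)] by auto
      qed
      then show "U ` S \<in> saturated M ((`) U ` \<eta>)" using Um[OF SM(1)] by (auto simp: saturated_def)
    qed
    show "countable ((`) U ` B)" using B by simp
    show "(`) U ` B \<subseteq> (`) U ` G" using B by auto
    have NM: "N \<in> sets M" using N by auto
    show "U ` N \<in> null_sets M" using N Um[OF NM] Ue[OF NM] by (auto simp: null_sets_def)
    fix x y assume x: "x \<in> space M - U ` N" and y: "y \<in> space M - U ` N"
      and same: "\<forall>S\<in>(`) U ` B. x \<in> S \<longleftrightarrow> y \<in> S"
    have "x \<in> U ` space M" "y \<in> U ` space M" using x y surj by simp_all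
    then obtain z w where zw: "x = U z" "y = U w" "z \<in> space M" "w \<in> space M" by blast
    have "\<forall>S\<in>B. z \<in> S \<longleftrightarrow> w \<in> S" using same zw memU BM by auto
    moreover have "z \<in> space M - N" "w \<in> space M - N" using x y zw by auto
    ultimately have "part_of \<eta> z = part_of \<eta> w" using sep by blast
    then show "part_of ((`) U ` \<eta>) x = part_of ((`) U ` \<eta>) y" using part_U zw by simp
  qed
qed

section \<open>Iterates\<close>

lemma automorphism_comp: "automorphism M U \<Longrightarrow> automorphism M W \<Longrightarrow> automorphism M (U \<circ> W)"
  unfolding automorphism_def image_comp[symmetric] by (auto intro: bij_betw_trans)

lemma automorphism_funpow: "automorphism M U \<Longrightarrow> automorphism M (U ^^ n)"
proof (induction n)
  case 0
  show ?case by (auto simp: automorphism_def bij_betw_def)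
next
  case (Suc n)
  then show ?case using automorphism_comp[of M U "U ^^ n"] by (simp only: funpow.simps)
qed

context
  fixes M :: "'a measure" and T :: "'a \<Rightarrow> 'a"
  assumes inv: "invertible_measure_preserving M T"
begin

lemma automorphism_T: "automorphism M T" and automorphism_inv: "automorphism M (the_inv_into (space M) T)"
proof -
  let ?V = "the_inv_into (space M) T"
  have bij: "bij_betw T (space M) (space M)" and Tm: "T \<in> measurable M M" and Vm: "?V \<in> measurable M M"
    and mp: "\<And>A. A \<in> sets M \<Longrightarrow> emeasure M (T -` A \<inter> space M) = emeasure M A"
    using inv by (auto simp: invertible_measure_preserving_def)
  have bijV: "bij_betw ?V (space M) (space M)" by (rule bij_betw_the_inv_into[OF bij])
  have inj: "inj_on T (space M)" and surj: "T ` space M = space M" using bij by (auto simp: bij_betw_def)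
  have VT: "?V (T x) = x" if "x \<in> space M" for x by (rule the_inv_into_f_f[OF inj that])
  have TV: "T (?V x) = x" if "x \<in> space M" for x using f_the_inv_into_f[OF inj] surj that by auto
  have Vsp: "?V x \<in> space M" "T x \<in> space M" if "x \<in> space M" for x
    using bijV bij that by (auto simp: bij_betw_def)
  have imgV: "?V ` A = T -` A \<inter> space M" if "A \<subseteq> space M" for A
    using that VT TV Vsp by (auto simp: image_iff) (metis subsetD)+
  have imgT: "T ` A = ?V -` A \<inter> space M" if "A \<subseteq> space M" for A
    using that VT TV Vsp by (auto simp: image_iff) (metis subsetD)+
  have preT: "T -` (T ` A) \<inter> space M = A" if "A \<subseteq> space M" for A
    using that inj by (auto simp: inj_on_def)
  show "automorphism M ?V"
    unfolding automorphism_def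
  proof (intro conjI ballI bijV)
    fix A assume A: "A \<in> sets M"
    note eq = imgV[OF sets.sets_into_space[OF A]]
    show "?V ` A \<in> sets M" unfolding eq by (rule measurable_sets[OF Tm A])
    show "emeasure M (?V ` A) = emeasure M A" unfolding eq by (rule mp[OF A])
  qed
  show "automorphism M T"
    unfolding automorphism_def
  proof (intro conjI ballI bij)
    fix A assume A: "A \<in> sets M"
    note sp = sets.sets_into_space[OF A]
    show TA: "T ` A \<in> sets M" unfolding imgT[OF sp] by (rule measurable_sets[OF Vm A])
    show "emeasure M (T ` A) = emeasure M A" using mp[OF TA] preT[OF sp] by simp
  qed
qed

lemma automorphism_int_iterate: "automorphism M (int_iterate M T n)"
  unfolding int_iterate_def using automorphism_funpow[OF automorphism_T] automorphism_funpow[OF automorphism_inv]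
  by auto

lemma int_iterate_space: "x \<in> space M \<Longrightarrow> int_iterate M T n x \<in> space M"
  using automorphism_int_iterate[of n] by (auto simp: automorphism_def bij_betw_def)

lemma int_iterate_pred:
  assumes x: "x \<in> space M"
  shows "int_iterate M T (n - 1) x = the_inv_into (space M) T (int_iterate M T n x)"
proof (cases "n \<le> 0")
  case True
  then have "nat (- (n - 1)) = Suc (nat (- n))" by simp
  then show ?thesis using True by (cases "n = 0") (auto simp: int_iterate_def)
next
  case False
  have inj: "inj_on T (space M)" using inv by (simp add: invertible_measure_preserving_def bij_betw_def)
  have "nat n = Suc (nat (n - 1))" using False by simp
  then have "int_iterate M T n x = T (int_iterate M T (n - 1) x)"
    using False by (simp add: int_iterate_def)
  then show ?thesis using the_inv_into_f_f[OF inj int_iterate_space[OF x]] by simp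
qed

lemma int_iterate_add:
  assumes x: "x \<in> space M"
  shows "int_iterate M T (m + n) x = int_iterate M T m (int_iterate M T n x)"
proof -
  have bij: "bij_betw T (space M) (space M)" using inv by (simp add: invertible_measure_preserving_def)
  have TV: "T (the_inv_into (space M) T y) = y" if "y \<in> space M" for y
    using f_the_inv_into_f[OF bij_betw_imp_inj_on[OF bij]] bij_betw_imp_surj_on[OF bij] that by simp
  have succ: "int_iterate M T (k + 1) y = T (int_iterate M T k y)" if "y \<in> space M" for k y
    using TV[OF int_iterate_space[OF that, of "k + 1"]] int_iterate_pred[OF that, of "k + 1"] by simp
  note pred = int_iterate_pred
  show ?thesis
  proof (induction m rule: int_induct[where k=0])
    case base
    show ?case by (simp add: int_iterate_def)
  next
    case (step1 i)
    then show ?case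
      using succ[OF x, of "i + n"] succ[OF int_iterate_space[OF x], of i] by (simp add: algebra_simps)
  next
    case (step2 i)
    then show ?case
      using pred[OF x, of "i + n"] pred[OF int_iterate_space[OF x], of i] by (simp add: algebra_simps)
  qed
qed

lemma image_int_iterate_add:
  assumes "G \<subseteq> sets M"
  shows "(`) (int_iterate M T m) ` (`) (int_iterate M T n) ` G = (`) (int_iterate M T (m + n)) ` G"
proof -
  have "int_iterate M T m ` int_iterate M T n ` A = int_iterate M T (m + n) ` A" if "A \<in> G" for A
    using that assms sets.sets_into_space[of A M] int_iterate_add[of _ m n] by (auto simp: image_image subset_eq intro!: image_cong)
  then show ?thesis by (auto simp: image_image intro!: image_cong)
qed

end

section \<open>The inequality\<close>

context prob_space begin

lemma family_entropy_finite:
  assumes "finite P" "P \<subseteq> events" "F \<subseteq> events"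
  shows "family_entropy M P F = cond_fentropy M P F"
proof (rule antisym)
  show "family_entropy M P F \<le> cond_fentropy M P F"
    unfolding family_entropy_def by (rule SUP_least) (auto intro!: cond_fentropy_mono assms)
qed (intro cond_fentropy_le_family_entropy assms order_refl)

text \<open>\<open>A k\<close> and \<open>B k\<close> are two stationary filtrations: \<open>U\<close> moves index \<open>k\<close> to \<open>k + 1\<close>. A finite part \<open>v\<close> of
  \<open>B 1\<close> is compared with \<open>A 1, ..., A (n + 1)\<close> through the chain rule in two orders, and \<open>D n\<close>, which is
  finite, is cancelled.\<close>

lemma family_entropy_filtration_le:
  fixes A B :: "int \<Rightarrow> 'a set set"
  assumes U: "bij_betw U (space M) (space M)" and mp: "\<And>E. E \<in> events \<Longrightarrow> prob (U ` E) = prob E"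
    and A: "\<And>k. A k \<subseteq> events" and B: "\<And>k. B k \<subseteq> events"
    and A_Suc: "\<And>k. (`) U ` A k = A (k + 1)" and B_Suc: "\<And>k. (`) U ` B k = B (k + 1)"
  shows "family_entropy M (A 1 \<union> B 1) (\<Union>k\<le>0. A k \<union> B k)
    \<le> family_entropy M (A 1) (\<Union>k\<le>0. A k) + family_entropy M (B 1 \<union> (\<Union>k. A k)) ((\<Union>k\<le>0. B k) \<union> (\<Union>k. A k))"
proof -
  let ?H = "family_entropy M"
  define P where "P m = (\<Union>k\<le>m. A k \<union> B k)" for m :: int
  define h where "h = ?H (A 1) (\<Union>k\<le>0. A k)"
  define R where "R = ?H (B 1 \<union> (\<Union>k. A k)) ((\<Union>k\<le>0. B k) \<union> (\<Union>k. A k))"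
  have P_ev: "P m \<subseteq> events" and UA: "(\<Union>k\<in>I. A k) \<subseteq> events" for m I using A B by (auto simp: P_def)
  have shift: "?H ((`) U ` G) ((`) U ` F) = ?H G F" if "G \<subseteq> events" "F \<subseteq> events" for G F
    by (rule family_entropy_image[OF U mp that])
  have img_UN: "(`) U ` (\<Union>k\<in>I. A k) = (\<Union>k\<in>(\<lambda>k. k + 1) ` I. A k)" for I
    using A_Suc by (simp add: image_UN)
  have img_P: "(`) U ` P m = P (m + 1)" for m
  proof -
    have "(`) U ` P m = (\<Union>k\<in>(\<lambda>k. k + 1) ` {..m}. A k \<union> B k)"
      using A_Suc B_Suc by (simp add: P_def image_UN image_Un)
    also have "(\<lambda>k. k + 1) ` {..m} = {..m + 1}"
      by (auto intro: image_eqI[of _ _ "x - 1" for x])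
    finally show ?thesis by (simp add: P_def)
  qed
  have img_le: "(`) U ` (\<Union>k\<le>m. A k) = (\<Union>k\<le>m + 1. A k)" for m
  proof -
    have "(\<lambda>k. k + 1) ` {..m} = {..m + 1}" by (auto intro: image_eqI[of _ _ "x - 1" for x])
    then show ?thesis using img_UN[of "{..m}"] by simp
  qed
  have h_shift: "?H (A (int n + 1)) (\<Union>k\<le>int n. A k) = h" for n
  proof (induction n)
    case (Suc n)
    have "?H ((`) U ` A (int n + 1)) ((`) U ` (\<Union>k\<le>int n. A k)) = h"
      using shift[OF A UA] Suc by simp
    then show ?case unfolding img_le A_Suc by (simp add: add.commute)
  qed (simp add: h_def)
  define D where "D n = ?H (\<Union>k\<in>{1..int n}. A k) (P 0)" for n :: nat
  have D_step: "D (Suc n) \<le> D n + h" for n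
  proof -
    have "{1..int (Suc n)} = insert (int n + 1) {1..int n}" by auto
    then have "D (Suc n) = ?H ((\<Union>k\<in>{1..int n}. A k) \<union> A (int n + 1)) (P 0)"
      by (simp add: D_def Un_commute)
    also have "\<dots> = D n + ?H (A (int n + 1)) (P 0 \<union> (\<Union>k\<in>{1..int n}. A k))"
      unfolding D_def by (rule family_entropy_chain[OF UA A P_ev])
    also have "?H (A (int n + 1)) (P 0 \<union> (\<Union>k\<in>{1..int n}. A k)) \<le> ?H (A (int n + 1)) (\<Union>k\<le>int n. A k)"
    proof (rule family_entropy_antimono)
      have "k \<in> {..0} \<or> k \<in> {1..int n}" if "k \<le> int n" for k using that by auto
      then show "(\<Union>k\<le>int n. A k) \<subseteq> P 0 \<union> (\<Union>k\<in>{1..int n}. A k)" by (fastforce simp: P_def)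
    qed
    finally show ?thesis by (simp add: h_shift add_left_mono)
  qed
  show ?thesis
  proof (cases "h = top")
    case True
    then show ?thesis by (simp add: h_def[symmetric])
  next
    case False
    have D_fin: "D n < top" for n
    proof (induction n)
      case 0
      show ?case using cond_fentropy_le[of "{}" "P 0" M "{}"] P_ev
        by (simp add: D_def family_entropy_finite le_less_trans)
    next
      case (Suc n)
      then show ?case using D_step[of n] False by (simp add: le_less_trans less_top)
    qed
    define F where "F n = P 0 \<union> (\<Union>k\<in>{1..int n}. A k)" for n :: nat
    have F_ev: "F n \<subseteq> events" for n using P_ev UA by (auto simp: F_def)
    \<comment> \<open>\<open>v\<close> is finite here, so that the condition may afterwards be exhausted by \<open>n\<close>\<close>
    have step: "?H (v \<union> A 1) (P 0) \<le> h + cond_fentropy M v (F (Suc n))"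
      if v: "finite v" "v \<subseteq> B 1" for v n
    proof -
      have v_ev: "v \<subseteq> events" using v(2) B by blast
      have "?H (v \<union> A 1) (P 0) + D n \<le> ?H (v \<union> A 1) (P 0) + ?H (\<Union>k\<in>{2..int n + 1}. A k) (P 0 \<union> (v \<union> A 1))"
      proof (rule add_left_mono)
        have "(\<lambda>k. k + 1) ` {1..int n} = {2..int n + 1}"
          by (auto intro: image_eqI[of _ _ "x - 1" for x])
        then have "D n = ?H (\<Union>k\<in>{2..int n + 1}. A k) (P 1)"
          unfolding D_def using shift[OF UA P_ev, of "{1..int n}" 0] by (simp add: img_UN img_P)
        also have "\<dots> \<le> ?H (\<Union>k\<in>{2..int n + 1}. A k) (P 0 \<union> (v \<union> A 1))"
          by (rule family_entropy_antimono) (use v in \<open>fastforce simp: P_def\<close>)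
        finally show "D n \<le> ?H (\<Union>k\<in>{2..int n + 1}. A k) (P 0 \<union> (v \<union> A 1))" .
      qed
      also have "\<dots> = ?H ((v \<union> A 1) \<union> (\<Union>k\<in>{2..int n + 1}. A k)) (P 0)"
        by (rule family_entropy_chain[symmetric, OF _ UA P_ev]) (use v_ev A in auto)
      also have "(v \<union> A 1) \<union> (\<Union>k\<in>{2..int n + 1}. A k) = (\<Union>k\<in>{1..int (Suc n)}. A k) \<union> v"
      proof -
        have "{1..int (Suc n)} = insert 1 {2..int n + 1}" by auto
        then show ?thesis by auto
      qed
      also have "?H ((\<Union>k\<in>{1..int (Suc n)}. A k) \<union> v) (P 0) = D (Suc n) + ?H v (F (Suc n))"
        unfolding D_def F_def by (rule family_entropy_chain[OF UA v_ev P_ev])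
      also have "\<dots> \<le> (D n + h) + cond_fentropy M v (F (Suc n))"
        by (intro add_mono D_step eq_refl family_entropy_finite v v_ev F_ev)
      finally have "D n + ?H (v \<union> A 1) (P 0) \<le> D n + (h + cond_fentropy M v (F (Suc n)))"
        by (simp add: ac_simps)
      then show ?thesis using D_fin[of n] by (auto simp: ennreal_add_left_cancel_le)
    qed
    have F_UN: "(\<Union>n. F (Suc n)) = (\<Union>k\<le>0. B k) \<union> (\<Union>k. A k)"
    proof -
      have P0: "P 0 \<subseteq> F n" for n by (simp add: F_def)
      have Ak: "A k \<subseteq> F (Suc (nat k))" for k
      proof (cases "k \<le> 0")
        case True
        then have "A k \<subseteq> P 0" unfolding P_def by blast
        then show ?thesis using P0 by blast
      next
        case False
        then have "k \<in> {1..int (Suc (nat k))}" by simp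
        then show ?thesis unfolding F_def by blast
      qed
      have Bk: "B k \<subseteq> F (Suc 0)" if "k \<le> 0" for k
      proof -
        have "B k \<subseteq> P 0" unfolding P_def using that by blast
        then show ?thesis using P0 by blast
      qed
      have Fn: "F n \<subseteq> (\<Union>k\<le>0. B k) \<union> (\<Union>k. A k)" for n unfolding F_def P_def by blast
      show ?thesis
      proof (intro equalityI Un_least UN_least Fn)
        show "B k \<subseteq> (\<Union>n. F (Suc n))" if "k \<in> {..0}" for k
          using that by (intro SUP_upper2[of 0] Bk) simp_all
        show "A k \<subseteq> (\<Union>n. F (Suc n))" for k by (rule SUP_upper2[of "nat k"]) (simp_all add: Ak)
      qed
    qed
    have bound: "?H (v \<union> A 1) (P 0) \<le> h + R" if v: "finite v" "v \<subseteq> B 1" for v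
    proof -
      have "?H (v \<union> A 1) (P 0) \<le> h + (INF n. cond_fentropy M v (F (Suc n)))"
        using step[OF v] by (rule le_add_INF_ennreal)
      also have "(INF n. cond_fentropy M v (F (Suc n))) = cond_fentropy M v (\<Union>n. F (Suc n))"
        by (rule cond_fentropy_Union_incseq[symmetric], rule incseq_SucI) (fastforce simp: F_def)
      also have "\<dots> \<le> R"
        unfolding F_UN R_def by (rule cond_fentropy_le_family_entropy) (use v in auto)
      finally show ?thesis by (simp add: add_left_mono)
    qed
    have "?H (A 1 \<union> B 1) (P 0) \<le> h + R"
      unfolding family_entropy_def[of M "A 1 \<union> B 1"]
    proof (rule SUP_least, clarify)
      fix S assume S: "finite S" "S \<subseteq> A 1 \<union> B 1"
      have "cond_fentropy M S (P 0) \<le> ?H ((S \<inter> B 1) \<union> A 1) (P 0)"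
        by (rule cond_fentropy_le_family_entropy) (use S in auto)
      also have "\<dots> \<le> h + R" by (rule bound) (use S in auto)
      finally show "cond_fentropy M S (P 0) \<le> h + R" .
    qed
    then show ?thesis by (simp add: P_def h_def R_def)
  qed
qed

end

lemma partition_entropy_eq_family_entropy:
  assumes leb: "lebesgue_prob_space M" and inv: "invertible_measure_preserving M T"
    and gen: "generates M \<alpha> G"
  shows "partition_entropy M \<alpha> T
    = family_entropy M ((`) (int_iterate M T (- 1)) ` G) (\<Union>n\<in>{0..}. (`) (int_iterate M T n) ` G)"
proof -
  have "generates M (shift_partition M T n \<alpha>) ((`) (int_iterate M T n) ` G)" for n
    unfolding shift_partition_def by (rule generates_image[OF automorphism_int_iterate[OF inv] gen])
  then show ?thesis
    unfolding partition_entropy_def past_partition_def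
    by (intro cond_entropy_eq_family_entropy[OF leb] generates_common_refinement) auto
qed

theorem lemma6p1:
  fixes M :: "'a measure" and T :: "'a \<Rightarrow> 'a" and \<xi> \<eta> :: "'a set set"
  assumes "lebesgue_prob_space M"
    and "invertible_measure_preserving M T"
    and "measurable_partition M \<xi>"
    and "measurable_partition M \<eta>"
  shows "partition_entropy M (partition_join \<xi> \<eta>) T
           \<le> partition_entropy M \<eta> T + partition_entropy M (partition_join \<xi> (full_partition M T \<eta>)) T"
proof -
  note leb = assms(1) and inv = assms(2)
  interpret prob_space M by (rule leb[unfolded lebesgue_prob_space_def, THEN conjunct1])
  have cm: "complete_measure M"
    by (rule leb[unfolded lebesgue_prob_space_def, THEN conjunct2, THEN conjunct1])
  let ?it = "int_iterate M T"
  define X Y where "X = saturated M \<xi>" and "Y = saturated M \<eta>"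
  define A B where "A k = (`) (?it (- k)) ` Y" and "B k = (`) (?it (- k)) ` X" for k
  have gX: "generates M \<xi> X" and gY: "generates M \<eta> Y"
    unfolding X_def Y_def using assms generates_saturated[OF cm] by blast+
  have XY: "X \<subseteq> events" "Y \<subseteq> events" by (auto simp: X_def Y_def saturated_def)
  have auto: "automorphism M (?it n)" for n by (rule automorphism_int_iterate[OF inv])
  have ev: "(`) (?it n) ` G \<subseteq> events" if "G \<subseteq> events" for n G
    using auto[of n] that by (auto simp: automorphism_def)
  have A_ev: "A k \<subseteq> events" and B_ev: "B k \<subseteq> events" for k
    unfolding A_def B_def by (intro ev XY)+
  have A_shift: "(`) (?it n) ` A k = A (k - n)" and B_shift: "(`) (?it n) ` B k = B (k - n)" for n k
    unfolding A_def B_def using image_int_iterate_add[OF inv XY(1), of n "- k"] image_int_iterate_add[OF inv XY(2), of n "- k"]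
    by (simp_all add: algebra_simps)
  have YA: "(`) (?it n) ` Y = A (- n)" and XB: "(`) (?it n) ` X = B (- n)" for n
    by (simp_all add: A_def B_def)
  have UN_surj: "(\<Union>n. f (g n)) = (\<Union>k. f k)" if "surj g" for f :: "int \<Rightarrow> 'a set set" and g
    using that by (metis image_image)
  have gfull: "generates M (full_partition M T \<eta>) (\<Union>k. A k)"
  proof -
    have "generates M (full_partition M T \<eta>) (\<Union>n. (`) (?it n) ` Y)"
      unfolding full_partition_def
      by (rule generates_common_refinement)
         (auto simp: shift_partition_def intro: generates_image[OF auto gY])
    also have "(\<Union>n. (`) (?it n) ` Y) = (\<Union>k. A k)"
      using UN_surj[of uminus A] surjI[of uminus "uminus :: int \<Rightarrow> int"] by (simp add: YA)
    finally show ?thesis .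
  qed
  have UN_neg: "(\<Union>n\<in>{0..}. f (- n)) = (\<Union>k\<le>0. f k)" for f :: "int \<Rightarrow> 'a set set"
  proof -
    have "{..0::int} = uminus ` {0..}" by (auto intro: image_eqI[of _ _ "- x" for x])
    then show ?thesis by (simp only: image_image)
  qed
  have full_shift: "(`) (?it n) ` (\<Union>k. A k) = (\<Union>k. A k)" for n
  proof -
    have "(`) (?it n) ` (\<Union>k. A k) = (\<Union>k. A (k - n))" by (simp add: image_UN A_shift)
    also have "\<dots> = (\<Union>k. A k)" by (rule UN_surj, rule surjI[of _ "\<lambda>k. k + n"]) simp
    finally show ?thesis .
  qed
  have 1: "partition_entropy M (partition_join \<xi> \<eta>) T = family_entropy M (A 1 \<union> B 1) (\<Union>k\<le>0. A k \<union> B k)"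
    unfolding partition_entropy_eq_family_entropy[OF leb inv generates_join[OF gX gY]]
    using UN_neg[of "\<lambda>k. A k \<union> B k"] by (simp add: image_Un YA XB Un_commute)
  have 2: "partition_entropy M \<eta> T = family_entropy M (A 1) (\<Union>k\<le>0. A k)"
    unfolding partition_entropy_eq_family_entropy[OF leb inv gY]
    using UN_neg[of A] by (simp add: YA)
  have 3: "partition_entropy M (partition_join \<xi> (full_partition M T \<eta>)) T
      = family_entropy M (B 1 \<union> (\<Union>k. A k)) ((\<Union>k\<le>0. B k) \<union> (\<Union>k. A k))"
  proof -
    have "(\<Union>n\<in>{0..}. B (- n) \<union> (\<Union>k. A k)) = (\<Union>k\<le>0. B k) \<union> (\<Union>k. A k)"
      unfolding UN_neg[of B, symmetric] by fastforce
    then show ?thesis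
      unfolding partition_entropy_eq_family_entropy[OF leb inv generates_join[OF gX gfull]]
      by (simp only: image_Un XB full_shift minus_minus)
  qed
  show ?thesis
    unfolding 1 2 3
  proof (rule family_entropy_filtration_le[of "?it (- 1)"])
    show "bij_betw (?it (- 1)) (space M) (space M)" using auto[of "- 1"] by (simp add: automorphism_def)
    show "prob (?it (- 1) ` E) = prob E" if "E \<in> events" for E
      using auto[of "- 1"] that by (simp add: automorphism_def measure_def)
  qed (use A_ev B_ev A_shift[of "- 1"] B_shift[of "- 1"] in simp_all)
qed

end
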